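(* Let $T>0$, $b>0$, let $m_0,f,g$ satisfy the standing assumptions (i)–(iv) of the context, and let $C>C_1:=\|m_0\|e^{TC_g}$. (1) If $\eta\in\mathcal P^1(\Gamma_T^C)$ is an equilibrium distribution of weighted trajectories, then $m(t):=\lfloor\eta\rfloor_t$, $t\in[0,T]$, is a weak solution on $[0,T]$ of the nonlocal balance equation $$\partial_t m(t)+\operatorname{div}(f(t,x,m(t))m(t))=g(t,x,m(t))m(t),\qquad m(0)=m_0 .$$ (2) Conversely, if $m(\cdot)$ is a weak solution of this equation on $[0,T]$ satisfying the initial condition $m(0)=m_0$, then there exists an equilibrium distribution of weighted trajectories $\eta\in\mathcal P^1(\Gamma_T^C)$ such that $\lfloor\eta\rfloor_t=m(t)$ for all $t\in[0,T]$. (3) In particular, there exists a unique weak solution of the initial value problem for this balance equation with $m(0)=m_0$.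
   Context: $\mathcal M(X)$ is the set of finite nonnegative Borel measures on a Polish space $X$; $\|m\|:=m(X)$ is the total mass; $\mathcal P(X)$ is the set of Borel probabilities and $\mathcal P^1(X)$ those with finite first moment. $\mathcal M^1(\mathbb R^d)$ is the set of $m\in\mathcal M(\mathbb R^d)$ with $\int\|x\|\,m(dx)<\infty$. Metric on measures (PRW-distance): for $b>0$ and $m_1,m_2\in\mathcal M(\mathbb R^d)$, $$\mathcal W_{1,b}(m_1,m_2):=\inf\Big\{b\|m_1-\widehat m_1\|+b\|m_2-\widehat m_2\|+\int\|x_1-x_2\|\,\varpi(d(x_1,x_2))\Big\},$$ the infimum being over $\widehat m_1\le m_1$, $\widehat m_2\le m_2$ (setwise) in $\mathcal M(\mathbb R^d)$ with $\|\widehat m_1\|=\|\widehat m_2\|$ and over measures $\varpi$ on $\mathbb R^d\times\mathbb R^d$ with marginals $\widehat m_1,\widehat m_2$. The space $\mathcal M(\mathbb R^d)$ carries this metric. Standing assumptions on $f:[0,T]\times\mathbb R^d\times\mathcal M(\mathbb R^d)\to\mathbb R^d$, $g:[0,T]\times\mathbb R^d\times\mathcal M(\mathbb R^d)\to\mathbb R$ and $m_0$: (i) $m_0\in\mathcal M^1(\mathbb R^d)$; (ii) $f$ and $g$ are continuous; (iii) $f$ and $g$ are Lipschitz in $(x,m)$ with constants $C_{Lf}$, $C_{Lg}$: $\|f(t,x_1,m_1)-f(t,x_2,m_2)\|\le C_{Lf}(\|x_1-x_2\|+\mathcal W_{1,b}(m_1,m_2))$, and similarly for $g$ with $C_{Lg}$;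 (iv) $\|f(t,x,m)\|\le C_f$ and $|g(t,x,m)|\le C_g$ for all $t,x,m$. Weighted curves: $\Gamma_T^C$ is the set of continuous curves $\gamma(\cdot)=(x(\cdot),w(\cdot)):[0,T]\to\mathbb R^d\times[0,C]$, with the uniform metric. For $\eta\in\mathcal P^1(\Gamma_T^C)$, $t\in[0,T]$, the measure $\lfloor\eta\rfloor_t$ on $\mathbb R^d$ is defined by $$\int_{\mathbb R^d}\phi(x)\,\lfloor\eta\rfloor_t(dx)=\int_{\Gamma_T^C}\phi(x(t))w(t)\,\eta(d(x(\cdot),w(\cdot))),\quad\phi\in C_b(\mathbb R^d).$$ Equilibrium distribution: $\eta\in\mathcal P^1(\Gamma_T^C)$ is an equilibrium distribution of weighted trajectories (equivalently, of curves with time-varying weights) if $\lfloor\eta\rfloor_0=m_0$ and $\eta$-a.e. $(x(\cdot),w(\cdot))$ satisfies on $[0,T]$ $$\dot x(t)=f(t,x(t),\lfloor\eta\rfloor_t),\qquad \dot w(t)=g(t,x(t),\lfloor\eta\rfloor_t)\,w(t),\qquad w(0)=\|m_0\|.$$ Weak solution: a continuous map $m(\cdot):[0,T]\to\mathcal M(\mathbb R^d)$ is a weak solution of the balance equation (with initial datum $m_0$) if for all $\phi\in C_c^1([0,T]\times\mathbb R^d)$ and $s\in[0,T]$, $$\int\phi(s,x)m(s,dx)-\int\phi(0,x)m_0(dx)=\int_0^s\!\!\int\big[\partial_t\phi(t,x)+\langle\nabla\phi(t,x),f(t,x,m(t))\rangle+\phi(t,x)g(t,x,m(t))\big]m(t,dx)\,dt,$$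 where $\nabla$ is the gradient in $x$. *)

theory Defs
  imports "HOL-Probability.Probability"
begin

section \<open>Spaces of measures\<close>

definition finite_borel_measures :: "'a::topological_space measure set" where
  "finite_borel_measures = {m. sets m = sets borel \<and> finite_measure m}"

definition finite_borel_measures1 :: "'a::real_normed_vector measure set" where
  "finite_borel_measures1 = {m \<in> finite_borel_measures. integrable m norm}"

definition total_mass :: "'a measure \<Rightarrow> real" where
  "total_mass m = measure m (space m)"

definition borel_of :: "'a topology \<Rightarrow> 'a measure" where
  "borel_of X = sigma (topspace X) {U. openin X U}"

text \<open>Borel probabilities with finite first moment on a metric space; the base point
  \<open>x0\<close> is immaterial by the triangle inequality.\<close>

definition prob_measures1 :: "'a metric \<Rightarrow> 'a measure set" where
  "prob_measures1 X =
    {\<eta>. sets \<eta> = sets (borel_of (mtopology_of X)) \<and> prob_space \<eta> \<and>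
        (\<exists>x0\<in>mspace X. (\<integral>\<^sup>+x. ennreal (mdist X x0 x) \<partial>\<eta>) < \<infinity>)}"

section \<open>The PRW distance\<close>

text \<open>On measures with equal \<open>\<sigma>\<close>-algebras the library order \<open>\<le>\<close> is the setwise one.
  Plans are measures on the Borel sets of the product, and their cost may be infinite, so the
  infimum is taken in \<^typ>\<open>ennreal\<close>. It is finite on finite measures, because
  \<open>n1 = n2 = 0\<close> is admissible.\<close>

definition prw_admissible ::
    "'a::euclidean_space measure \<Rightarrow> 'a measure \<Rightarrow> ('a measure \<times> 'a measure \<times> ('a \<times> 'a) measure) set"
  where
  "prw_admissible m1 m2 =
    {(n1, n2, p).
       n1 \<in> finite_borel_measures \<and> n2 \<in> finite_borel_measures \<and>
       n1 \<le> m1 \<and> n2 \<le> m2 \<and> total_mass n1 = total_mass n2 \<and>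
       sets p = sets borel \<and> distr p borel fst = n1 \<and> distr p borel snd = n2}"

definition prw_dist :: "real \<Rightarrow> 'a::euclidean_space measure \<Rightarrow> 'a measure \<Rightarrow> real" where
  "prw_dist b m1 m2 =
    enn2real (INF (n1, n2, p) \<in> prw_admissible m1 m2.
      ennreal (b * total_mass (diff_measure m1 n1) + b * total_mass (diff_measure m2 n2)) +
      (\<integral>\<^sup>+z. ennreal (norm (fst z - snd z)) \<partial>p))"

section \<open>Assumptions on the coefficients\<close>

text \<open>Only the values of a coefficient on \<open>[0,T] \<times> \<real>\<^sup>d \<times> \<M>(\<real>\<^sup>d)\<close> matter, where the last factor
  carries the PRW distance. The codomain is \<open>\<real>\<^sup>d\<close> for the velocity and \<open>\<real>\<close> for the growth rate.\<close>

definition continuous_coeff ::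
    "real \<Rightarrow> real \<Rightarrow> (real \<Rightarrow> 'a::euclidean_space \<Rightarrow> 'a measure \<Rightarrow> 'c::real_normed_vector) \<Rightarrow> bool" where
  "continuous_coeff T b h \<longleftrightarrow>
    (\<forall>t\<in>{0..T}. \<forall>x. \<forall>m\<in>finite_borel_measures. \<forall>e>0. \<exists>d>0.
       \<forall>t'\<in>{0..T}. \<forall>x'. \<forall>m'\<in>finite_borel_measures.
         \<bar>t' - t\<bar> < d \<and> norm (x' - x) < d \<and> prw_dist b m' m < d \<longrightarrow>
         norm (h t' x' m' - h t x m) < e)"

definition lipschitz_coeff ::
    "real \<Rightarrow> real \<Rightarrow> real \<Rightarrow> (real \<Rightarrow> 'a::euclidean_space \<Rightarrow> 'a measure \<Rightarrow> 'c::real_normed_vector) \<Rightarrow> bool"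
  where
  "lipschitz_coeff T b L h \<longleftrightarrow>
    (\<forall>t\<in>{0..T}. \<forall>x1 x2. \<forall>m1\<in>finite_borel_measures. \<forall>m2\<in>finite_borel_measures.
       norm (h t x1 m1 - h t x2 m2) \<le> L * (norm (x1 - x2) + prw_dist b m1 m2))"

definition bounded_coeff ::
    "real \<Rightarrow> real \<Rightarrow> (real \<Rightarrow> 'a::euclidean_space \<Rightarrow> 'a measure \<Rightarrow> 'c::real_normed_vector) \<Rightarrow> bool" where
  "bounded_coeff T K h \<longleftrightarrow>
    (\<forall>t\<in>{0..T}. \<forall>x. \<forall>m\<in>finite_borel_measures. norm (h t x m) \<le> K)"

section \<open>Weighted curves\<close>

text \<open>Continuous curves \<open>[0,T] \<rightarrow> \<real>\<^sup>d \<times> [0,C]\<close> with the supremum metric; elements of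
  \<^const>\<open>cfunspace\<close> are extensional, that is, \<^term>\<open>undefined\<close> outside \<open>[0,T]\<close>.\<close>

definition weighted_curves :: "real \<Rightarrow> real \<Rightarrow> (real \<Rightarrow> 'a::euclidean_space \<times> real) metric" where
  "weighted_curves T C =
    cfunspace (top_of_set {0..T}) (submetric euclidean_metric (UNIV \<times> {0..C}))"

text \<open>The measure \<open>\<lfloor>\<eta>\<rfloor>\<^sub>t\<close>, specified by its integrals of bounded continuous functions;
  \<open>weighted_marginal_ex1\<close> below shows that it is well defined.\<close>

definition is_weighted_marginal ::
    "(real \<Rightarrow> 'a::euclidean_space \<times> real) measure \<Rightarrow> real \<Rightarrow> 'a measure \<Rightarrow> bool" where
  "is_weighted_marginal \<eta> t \<mu> \<longleftrightarrow>
    \<mu> \<in> finite_borel_measures \<and>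
    (\<forall>\<phi> :: 'a \<Rightarrow> real. continuous_on UNIV \<phi> \<and> bounded (range \<phi>) \<longrightarrow>
       (\<integral>x. \<phi> x \<partial>\<mu>) = (\<integral>\<gamma>. \<phi> (fst (\<gamma> t)) * snd (\<gamma> t) \<partial>\<eta>))"

definition weighted_marginal ::
    "(real \<Rightarrow> 'a::euclidean_space \<times> real) measure \<Rightarrow> real \<Rightarrow> 'a measure" where
  "weighted_marginal \<eta> t = (THE \<mu>. is_weighted_marginal \<eta> t \<mu>)"

lemma weighted_curves_eval_measurable:
  fixes \<eta> :: "(real \<Rightarrow> 'a::euclidean_space \<times> real) measure"
  assumes \<eta>: "sets \<eta> = sets (borel_of (mtopology_of (weighted_curves T C)))" and t: "t \<in> {0..T}"
  shows "(\<lambda>\<gamma>. \<gamma> t) \<in> borel_measurable \<eta>"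
proof (rule borel_measurableI)
  fix S :: "('a \<times> real) set" assume S: "open S"
  let ?X = "weighted_curves T C :: (real \<Rightarrow> 'a \<times> real) metric"
  interpret X: Metric_space "mspace ?X" "mdist ?X" by (rule Metric_space_mspace_mdist)
  have sp: "space \<eta> = mspace ?X"
    using sets_eq_imp_space_eq[OF \<eta>]
    by (simp add: borel_of_def space_measure_of_conv)
  have le: "dist (f t) (g t) \<le> mdist ?X f g" if "f \<in> mspace ?X" "g \<in> mspace ?X" for f g
  proof -
    have "mdist ?X f g = mdist (funspace {0..T} (submetric euclidean_metric (UNIV \<times> {0..C}))) f g"
      by (simp add: weighted_curves_def cfunspace_def)
    moreover have "f \<in> mspace (funspace {0..T} (submetric euclidean_metric (UNIV \<times> {0..C})))"
      "g \<in> mspace (funspace {0..T} (submetric euclidean_metric (UNIV \<times> {0..C})))"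
      using that unfolding weighted_curves_def cfunspace_def by simp_all
    ultimately have "\<forall>s\<in>{0..T}. dist (f s) (g s) \<le> mdist ?X f g"
      using funspace_mdist_le[of f "{0..T}" "submetric euclidean_metric (UNIV \<times> {0..C})" g "mdist ?X f g"] t
      by auto
    with t show ?thesis by blast
  qed
  have "openin X.mtopology {\<gamma> \<in> mspace ?X. \<gamma> t \<in> S}"
    unfolding X.openin_mtopology
  proof (intro conjI allI impI)
    show "{\<gamma> \<in> mspace ?X. \<gamma> t \<in> S} \<subseteq> mspace ?X" by blast
    fix \<gamma> assume \<gamma>: "\<gamma> \<in> {\<gamma> \<in> mspace ?X. \<gamma> t \<in> S}"
    then obtain e where e: "e > 0" "\<forall>y. dist y (\<gamma> t) < e \<longrightarrow> y \<in> S"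
      using S by (auto simp: open_dist)
    have "X.mball \<gamma> e \<subseteq> {\<gamma> \<in> mspace ?X. \<gamma> t \<in> S}"
    proof
      fix g assume g: "g \<in> X.mball \<gamma> e"
      then have "g \<in> mspace ?X" "mdist ?X \<gamma> g < e" by auto
      moreover have "dist (g t) (\<gamma> t) < e"
        using le[of \<gamma> g] calculation \<gamma> by (auto simp: dist_commute)
      ultimately show "g \<in> {\<gamma> \<in> mspace ?X. \<gamma> t \<in> S}" using e(2) by blast
    qed
    with e show "\<exists>r>0. X.mball \<gamma> r \<subseteq> {\<gamma> \<in> mspace ?X. \<gamma> t \<in> S}" by blast
  qed
  then have "{\<gamma> \<in> mspace ?X. \<gamma> t \<in> S} \<in> sets (borel_of (mtopology_of ?X))"
    unfolding borel_of_def mtopology_of_def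
    by (subst sets_measure_of) (use openin_subset in blast, blast intro: sigma_sets.Basic)
  then show "(\<lambda>\<gamma>. \<gamma> t) -` S \<inter> space \<eta> \<in> sets \<eta>"
    unfolding \<eta> sp by (simp add: vimage_def Int_def conj_commute)
qed

lemma weighted_curves_weight:
  assumes "\<gamma> \<in> mspace (weighted_curves T C)" "t \<in> {0..T}"
  shows "0 \<le> snd (\<gamma> t)" "snd (\<gamma> t) \<le> C"
proof -
  have "\<gamma> \<in> mspace (funspace {0..T} (submetric euclidean_metric (UNIV \<times> {0..C})))"
    using assms unfolding weighted_curves_def cfunspace_def by simp
  from funspace_imp_welldefined[OF this assms(2)] show "0 \<le> snd (\<gamma> t)" "snd (\<gamma> t) \<le> C"
    by (auto simp: mem_Times_iff)
qed

lemma finite_borel_measure_eqI: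
  fixes \<mu> \<nu> :: "'a::metric_space measure"
  assumes \<mu>: "\<mu> \<in> finite_borel_measures" and \<nu>: "\<nu> \<in> finite_borel_measures"
    and eq: "\<And>\<phi> :: 'a \<Rightarrow> real. continuous_on UNIV \<phi> \<Longrightarrow> bounded (range \<phi>) \<Longrightarrow>
               (\<integral>x. \<phi> x \<partial>\<mu>) = (\<integral>x. \<phi> x \<partial>\<nu>)"
  shows "\<mu> = \<nu>"
proof -
  have lim: "(\<lambda>n. \<integral>x. max 0 (1 - real n * infdist x F) \<partial>\<rho>) \<longlonglongrightarrow> measure \<rho> F"
    if \<rho>: "\<rho> \<in> finite_borel_measures" and F: "closed F" "F \<noteq> {}" for \<rho> :: "'a measure" and F
  proof -
    interpret finite_measure \<rho> using \<rho> by (simp add: finite_borel_measures_def)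
    have sets[measurable_cong]: "sets \<rho> = sets borel" using \<rho> by (simp add: finite_borel_measures_def)
    have sp: "space \<rho> = UNIV" using sets_eq_imp_space_eq[OF sets] by simp
    have c: "continuous_on UNIV (\<lambda>x. max 0 (1 - real n * infdist x F))" for n
      by (intro continuous_intros)
    have "(\<lambda>n. \<integral>x. max 0 (1 - real n * infdist x F) \<partial>\<rho>) \<longlonglongrightarrow> (\<integral>x. indicat_real F x \<partial>\<rho>)"
    proof (rule integral_dominated_convergence[where w = "\<lambda>_. 1"])
      show "(\<lambda>x. max 0 (1 - real n * infdist x F)) \<in> borel_measurable \<rho>" for n
        using borel_measurable_continuous_onI[OF c[of n]] sets by (simp cong: measurable_cong_sets)
      show "indicat_real F \<in> borel_measurable \<rho>"
        using F by (intro borel_measurable_indicator) (simp add: sets borel_closed)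
      show "AE x in \<rho>. (\<lambda>n. max 0 (1 - real n * infdist x F)) \<longlonglongrightarrow> indicat_real F x"
      proof (rule AE_I2)
        fix x
        show "(\<lambda>n. max 0 (1 - real n * infdist x F)) \<longlonglongrightarrow> indicat_real F x"
        proof (cases "x \<in> F")
          case True then show ?thesis by simp
        next
          case False
          then have pos: "infdist x F > 0"
            using F by (meson infdist_pos_not_in_closed)
          obtain N :: nat where N: "1 < real N * infdist x F"
            using reals_Archimedean3[OF pos] by blast
          have "max 0 (1 - real n * infdist x F) = indicat_real F x" if "n \<ge> N" for n
          proof -
            have "real N * infdist x F \<le> real n * infdist x F"
              using that pos by (intro mult_right_mono) auto
            then show ?thesis using N False by simp
          qed
          then show ?thesis
            by (intro tendsto_eventually) (auto simp: eventually_sequentially)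
        qed
      qed
      show "AE x in \<rho>. norm (max 0 (1 - real n * infdist x F)) \<le> 1" for n
        by (auto intro!: AE_I2 simp: infdist_nonneg)
    qed simp
    also have "(\<integral>x. indicat_real F x \<partial>\<rho>) = measure \<rho> F"
      using F sets sp by simp
    finally show ?thesis .
  qed
  interpret m: finite_measure \<mu> using \<mu> by (simp add: finite_borel_measures_def)
  interpret n: finite_measure \<nu> using \<nu> by (simp add: finite_borel_measures_def)
  have sets: "sets \<mu> = sets borel" "sets \<nu> = sets borel"
    using \<mu> \<nu> by (simp_all add: finite_borel_measures_def)
  have closed_eq: "emeasure \<mu> F = emeasure \<nu> F" if "closed F" for F
  proof (cases "F = {}")
    case False
    have "(\<integral>x. max 0 (1 - real k * infdist x F) \<partial>\<mu>) = (\<integral>x. max 0 (1 - real k * infdist x F) \<partial>\<nu>)" for k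
    proof (rule eq)
      show "continuous_on UNIV (\<lambda>x. max 0 (1 - real k * infdist x F))"
        by (intro continuous_intros)
      have "norm (max 0 (1 - real k * infdist x F)) \<le> 1" for x
        by (simp add: infdist_nonneg)
      then show "bounded (range (\<lambda>x. max 0 (1 - real k * infdist x F)))"
        unfolding bounded_iff by blast
    qed
    then have "measure \<mu> F = measure \<nu> F"
      using lim[OF \<mu> that False] lim[OF \<nu> that False] by (simp add: LIMSEQ_unique)
    then show ?thesis
      by (simp add: m.emeasure_eq_measure n.emeasure_eq_measure)
  qed simp
  show ?thesis
  proof (rule measure_eqI_generator_eq[where E = "{F. closed F}" and \<Omega> = UNIV and A = "\<lambda>_. UNIV"])
    show "Int_stable {F :: 'a set. closed F}" by (auto simp: Int_stable_def)
    show "sets \<mu> = sigma_sets UNIV {F. closed F}" "sets \<nu> = sigma_sets UNIV {F. closed F}"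
      unfolding sets by (simp_all add: borel_eq_closed)
  qed (auto simp: closed_eq)
qed

lemma weighted_marginal_ex1:
  fixes \<eta> :: "(real \<Rightarrow> 'a::euclidean_space \<times> real) measure"
  assumes \<eta>: "\<eta> \<in> prob_measures1 (weighted_curves T C)" and t: "t \<in> {0..T}"
  shows "\<exists>!\<mu>. is_weighted_marginal \<eta> t \<mu>"
proof -
  have s: "sets \<eta> = sets (borel_of (mtopology_of (weighted_curves T C)))"
    using \<eta> by (simp add: prob_measures1_def)
  interpret prob_space \<eta> using \<eta> by (simp add: prob_measures1_def)
  have sp: "space \<eta> = mspace (weighted_curves T C)"
    using sets_eq_imp_space_eq[OF s] by (simp add: borel_of_def space_measure_of_conv)
  have ev: "(\<lambda>\<gamma>. \<gamma> t) \<in> borel_measurable \<eta>"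
    by (rule weighted_curves_eval_measurable[OF s t])
  have [measurable]: "(\<lambda>\<gamma>. fst (\<gamma> t)) \<in> borel_measurable \<eta>" "(\<lambda>\<gamma>. snd (\<gamma> t)) \<in> borel_measurable \<eta>"
    using measurable_compose[OF ev borel_measurable_continuous_onI[OF continuous_on_fst[OF continuous_on_id]]]
      measurable_compose[OF ev borel_measurable_continuous_onI[OF continuous_on_snd[OF continuous_on_id]]]
    by simp_all
  have w: "0 \<le> snd (\<gamma> t)" "snd (\<gamma> t) \<le> C" if "\<gamma> \<in> space \<eta>" for \<gamma>
    using weighted_curves_weight[OF _ t] that by (auto simp: sp)
  define \<mu> where "\<mu> = distr (density \<eta> (\<lambda>\<gamma>. ennreal (snd (\<gamma> t)))) borel (\<lambda>\<gamma>. fst (\<gamma> t))"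
  have "(\<integral>\<^sup>+\<gamma>. ennreal (snd (\<gamma> t)) \<partial>\<eta>) \<le> (\<integral>\<^sup>+\<gamma>. ennreal C \<partial>\<eta>)"
    by (intro nn_integral_mono ennreal_leI w)
  also have "\<dots> < \<infinity>" by (simp add: emeasure_space_1)
  finally have fin: "(\<integral>\<^sup>+\<gamma>. ennreal (snd (\<gamma> t)) \<partial>\<eta>) < \<infinity>" .
  have "finite_measure (density \<eta> (\<lambda>\<gamma>. ennreal (snd (\<gamma> t))))"
    using fin by (intro finite_measureI) (simp add: emeasure_density cong: nn_integral_cong)
  then have "finite_measure \<mu>"
    unfolding \<mu>_def by (rule finite_measure.finite_measure_distr) simp
  then have M: "\<mu> \<in> finite_borel_measures"
    by (simp add: finite_borel_measures_def \<mu>_def)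
  have "(\<integral>x. \<phi> x \<partial>\<mu>) = (\<integral>\<gamma>. \<phi> (fst (\<gamma> t)) * snd (\<gamma> t) \<partial>\<eta>)"
    if "continuous_on UNIV \<phi>" for \<phi> :: "'a \<Rightarrow> real"
  proof -
    have [measurable]: "\<phi> \<in> borel_measurable borel"
      by (rule borel_measurable_continuous_onI[OF that])
    have "(\<integral>x. \<phi> x \<partial>\<mu>) = (\<integral>\<gamma>. \<phi> (fst (\<gamma> t)) \<partial>density \<eta> (\<lambda>\<gamma>. ennreal (snd (\<gamma> t))))"
      unfolding \<mu>_def by (rule integral_distr) simp_all
    also have "\<dots> = (\<integral>\<gamma>. snd (\<gamma> t) *\<^sub>R \<phi> (fst (\<gamma> t)) \<partial>\<eta>)"
      by (rule integral_density) (auto intro!: AE_I2 w)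
    finally show ?thesis by (simp add: mult.commute)
  qed
  with M have "is_weighted_marginal \<eta> t \<mu>" by (simp add: is_weighted_marginal_def)
  moreover have "\<nu> = \<mu>" if "is_weighted_marginal \<eta> t \<nu>" for \<nu>
    using that calculation by (intro finite_borel_measure_eqI) (auto simp: is_weighted_marginal_def)
  ultimately show ?thesis by blast
qed

section \<open>Equilibrium distributions and weak solutions\<close>

definition equilibrium_distribution ::
    "real \<Rightarrow> real \<Rightarrow> (real \<Rightarrow> 'a::euclidean_space \<Rightarrow> 'a measure \<Rightarrow> 'a) \<Rightarrow>
     (real \<Rightarrow> 'a \<Rightarrow> 'a measure \<Rightarrow> real) \<Rightarrow> 'a measure \<Rightarrow> (real \<Rightarrow> 'a \<times> real) measure \<Rightarrow> bool" where
  "equilibrium_distribution T C f g m0 \<eta> \<longleftrightarrow>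
    \<eta> \<in> prob_measures1 (weighted_curves T C) \<and>
    weighted_marginal \<eta> 0 = m0 \<and>
    (AE \<gamma> in \<eta>.
       (\<forall>t\<in>{0..T}.
          ((\<lambda>s. fst (\<gamma> s)) has_vector_derivative f t (fst (\<gamma> t)) (weighted_marginal \<eta> t))
            (at t within {0..T}) \<and>
          ((\<lambda>s. snd (\<gamma> s)) has_real_derivative
            g t (fst (\<gamma> t)) (weighted_marginal \<eta> t) * snd (\<gamma> t)) (at t within {0..T})) \<and>
       snd (\<gamma> 0) = total_mass m0)"

text \<open>\<open>\<phi>\<close> is in \<open>C\<^sub>c\<^sup>1([0,T] \<times> \<real>\<^sup>d)\<close> with time derivative \<open>\<phi>t\<close> and spatial gradient \<open>\<phi>x\<close>;
  derivatives at \<open>t = 0\<close> and \<open>t = T\<close> are one-sided, and \<open>\<phi>\<close> need not vanish there.\<close>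

definition C1c_test_function ::
    "real \<Rightarrow> (real \<Rightarrow> 'a::euclidean_space \<Rightarrow> real) \<Rightarrow> (real \<Rightarrow> 'a \<Rightarrow> real) \<Rightarrow> (real \<Rightarrow> 'a \<Rightarrow> 'a) \<Rightarrow> bool"
  where
  "C1c_test_function T \<phi> \<phi>t \<phi>x \<longleftrightarrow>
    (\<forall>t\<in>{0..T}. \<forall>x.
       ((\<lambda>(s, y). \<phi> s y) has_derivative (\<lambda>(h, v). \<phi>t t x * h + \<phi>x t x \<bullet> v))
         (at (t, x) within {0..T} \<times> UNIV)) \<and>
    continuous_on ({0..T} \<times> UNIV) (\<lambda>(t, x). \<phi>t t x) \<and>
    continuous_on ({0..T} \<times> UNIV) (\<lambda>(t, x). \<phi>x t x) \<and>
    compact (closure {(t, x). t \<in> {0..T} \<and> \<phi> t x \<noteq> 0})"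

definition weak_solution ::
    "real \<Rightarrow> real \<Rightarrow> (real \<Rightarrow> 'a::euclidean_space \<Rightarrow> 'a measure \<Rightarrow> 'a) \<Rightarrow>
     (real \<Rightarrow> 'a \<Rightarrow> 'a measure \<Rightarrow> real) \<Rightarrow> 'a measure \<Rightarrow> (real \<Rightarrow> 'a measure) \<Rightarrow> bool" where
  "weak_solution T b f g m0 m \<longleftrightarrow>
    (\<forall>t\<in>{0..T}. m t \<in> finite_borel_measures) \<and>
    (\<forall>t\<in>{0..T}. ((\<lambda>s. prw_dist b (m s) (m t)) \<longlongrightarrow> 0) (at t within {0..T})) \<and>
    (\<forall>\<phi> \<phi>t \<phi>x. C1c_test_function T \<phi> \<phi>t \<phi>x \<longrightarrow>
       (\<forall>s\<in>{0..T}.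
          (\<integral>x. \<phi> s x \<partial>m s) - (\<integral>x. \<phi> 0 x \<partial>m0) =
          (LINT t:{0..s}|lborel.
             (\<integral>x. \<phi>t t x + \<phi>x t x \<bullet> f t x (m t) + \<phi> t x * g t x (m t) \<partial>m t))))"

end

theory Submission
  imports Defs
begin

text \<open>Everything is reduced to the characteristic flow. Write the weight of a particle as an exponential
  and follow the pair of position and logarithmic weight: along a curve of measures \<open>\<mu>\<close> the state
  solves \<open>Z' = (f, g) (t, fst Z, \<mu> t)\<close> with \<open>Z 0 x = (x, 0)\<close>, and \<open>Z\<close> carries \<open>m0\<close> to the measure
  \<open>transport m0 (Z t)\<close>, the image of \<open>exp (snd (Z t x)) m0(dx)\<close> under the position. The equation is
  closed by the requirement \<open>\<mu> t = transport m0 (Z t)\<close>. The three claims are then consequences of the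
  following four facts.

  The closed system has exactly one solution (\<open>characteristic_flow_exists\<close>,
  \<open>characteristic_flow_unique\<close>). The unknown of the fixed point problem is the displacement
  \<open>Z t x - (x, 0)\<close>, a bounded continuous function of \<open>(t, x)\<close>, and not the curve of measures; this
  avoids the completeness of the space of measures. Picard's map contracts in an exponentially
  weighted supremum norm, because moving the states by at most \<open>d\<close> moves the transported measure by
  at most a multiple of \<open>d\<close> in the PRW distance: transport the common weight and discard the rest.

  The flow yields an equilibrium distribution (\<open>flow_equilibrium\<close>): the normalised \<open>m0\<close> is mapped to
  curves by sending \<open>x\<close> to its trajectory, with weight \<open>total_mass m0 * exp (snd (Z t x))\<close>.

  Equilibrium distributions are weak solutions (\<open>equilibrium_is_weak_solution\<close>): differentiate
  \<open>\<phi> (t, x(t)) w(t)\<close> along a curve and integrate over all curves. Speeds are bounded by \<open>Cf\<close> and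
  weights by \<open>C\<close>, so dominated convergence also gives the continuity in the PRW distance.

  Weak solutions come from the flow (\<open>weak_solution_flow\<close>). This is the uniqueness theorem for the
  linear equation that arises when a weak solution \<open>m\<close> is inserted into \<open>f\<close> and \<open>g\<close>, and it is
  the main difficulty, as the coefficients are only Lipschitz in \<open>x\<close>. It is proved by duality: for a
  Lipschitz terminal value \<open>\<psi>\<close> at time \<open>s\<close> let \<open>\<phi> t\<close> be its backward evolution along the
  characteristics. Formally the integral of \<open>\<phi> t\<close> against \<open>m t\<close> is constant, but \<open>\<phi> t\<close> is
  no admissible test function. Its mollification at scale \<open>\<epsilon>\<close> in the space variable is one, and
  the commutator of mollification and transport costs only a multiple of \<open>\<epsilon>\<close> per unit of time
  (\<open>mollify_step\<close>); here the directional derivative of \<open>\<phi>\<close> along characteristics is used, never a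
  derivative of \<open>\<phi>\<close> in space. Letting \<open>\<epsilon>\<close> tend to zero identifies the integral of \<open>\<psi>\<close> against
  \<open>m s\<close> with its integral against the transported measure (\<open>weak_curve_representation\<close>).

  Two weak solutions thus give two solutions of the closed system, which coincide.\<close>

section \<open>Test functions and the PRW distance\<close>

lemma finite_borel_measuresD:
  assumes "m \<in> finite_borel_measures"
  shows "sets m = sets borel" "space m = UNIV" "finite_measure m"
  using assms sets_eq_imp_space_eq[of m borel] by (auto simp: finite_borel_measures_def)

lemma integrable_bounded_finite_borel:
  fixes \<phi> :: "'a::topological_space \<Rightarrow> 'b::{banach,second_countable_topology}"
  assumes m: "m \<in> finite_borel_measures" and "\<phi> \<in> borel_measurable borel" and "\<And>x. norm (\<phi> x) \<le> U"
  shows "integrable m \<phi>"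
proof -
  interpret finite_measure m using finite_borel_measuresD[OF m] by simp
  show ?thesis
    using assms(2,3) finite_borel_measuresD(1)[OF m]
    by (intro integrable_const_bound[where B = U]) (auto cong: measurable_cong_sets)
qed

lemma nn_integral_add_diff_measure:
  assumes m: "m \<in> finite_borel_measures" and n: "n \<in> finite_borel_measures" and le: "n \<le> m"
    and \<phi>: "\<phi> \<in> borel_measurable borel"
  shows "(\<integral>\<^sup>+x. \<phi> x \<partial>m) = (\<integral>\<^sup>+x. \<phi> x \<partial>n) + (\<integral>\<^sup>+x. \<phi> x \<partial>diff_measure m n)"
proof -
  note M = finite_borel_measuresD[OF m] and N = finite_borel_measuresD[OF n]
  have s[measurable_cong, simp]: "sets m = sets borel" "sets n = sets borel" "sets (diff_measure m n) = sets borel"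
    using M N by simp_all
  have le': "emeasure n A \<le> emeasure m A" for A
    using le M N by (subst (asm) le_measure) (auto simp: emeasure_notin_sets)
  have em: "emeasure m A = emeasure n A + emeasure (diff_measure m n) A" if "A \<in> sets borel" for A
    using that le' emeasure_diff_measure[OF M(3) N(3), of A]
    by (simp add: M N add_diff_inverse_ennreal)
  from \<phi> show ?thesis
  proof (induction rule: borel_measurable_induct)
    case (cong f g)
    then show ?case by (metis space_borel UNIV_I ext)
  next
    case (set A)
    then show ?case by (simp add: em)
  next
    case (mult u c)
    then show ?case by (simp add: nn_integral_cmult distrib_left)
  next
    case (add u v)
    then show ?case by (simp add: nn_integral_add ac_simps)
  next
    case (seq U)
    have [measurable]: "\<And>i. U i \<in> borel_measurable borel" by (rule seq)
    have inc: "incseq (\<lambda>i. \<integral>\<^sup>+x. U i x \<partial>\<mu>)" for \<mu> :: "'a measure"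
      using seq(3) by (auto simp: incseq_def le_fun_def intro!: nn_integral_mono)
    have "(SUP i. (\<integral>\<^sup>+x. U i x \<partial>n) + (\<integral>\<^sup>+x. U i x \<partial>diff_measure m n)) =
      (SUP i. (\<integral>\<^sup>+x. U i x \<partial>n)) + (SUP i. (\<integral>\<^sup>+x. U i x \<partial>diff_measure m n))"
      by (rule ennreal_SUP_add[OF inc inc])
    then show ?case
      using seq by (simp add: nn_integral_monotone_convergence_SUP image_comp)
  qed
qed

text \<open>Monotone approximation gives the decomposition \<open>m = n + diff_measure m n\<close> for nonnegative
  functions; adding the constant \<open>U\<close> reduces a signed function to a nonnegative one.\<close>

lemma integral_diff_bound:
  fixes \<phi> :: "'a::topological_space \<Rightarrow> real"
  assumes m: "m \<in> finite_borel_measures" and n: "n \<in> finite_borel_measures" and le: "n \<le> m"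
    and \<phi>[measurable]: "\<phi> \<in> borel_measurable borel" and U: "\<And>x. \<bar>\<phi> x\<bar> \<le> U"
  shows "\<bar>(\<integral>x. \<phi> x \<partial>m) - (\<integral>x. \<phi> x \<partial>n)\<bar> \<le> U * total_mass (diff_measure m n)"
proof -
  note M = finite_borel_measuresD[OF m] and N = finite_borel_measuresD[OF n]
  define d where "d = diff_measure m n"
  have le': "emeasure n A \<le> emeasure m A" for A
    using le M N by (subst (asm) le_measure) (auto simp: emeasure_notin_sets)
  have dU: "emeasure d (space d) = emeasure m UNIV - emeasure n UNIV"
    unfolding d_def using le' emeasure_diff_measure[OF M(3) N(3), of UNIV]
    by (simp add: M N)
  interpret m: finite_measure m by (rule M)
  have d: "d \<in> finite_borel_measures"
    using M m.emeasure_finite[of UNIV] dU by (auto simp: finite_borel_measures_def d_def intro!: finite_measureI)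
  note D = finite_borel_measuresD[OF d]
  have eq: "(\<integral>x. \<psi> x \<partial>m) = (\<integral>x. \<psi> x \<partial>n) + (\<integral>x. \<psi> x \<partial>d)"
    if [measurable]: "\<psi> \<in> borel_measurable borel" and B: "\<And>x. 0 \<le> \<psi> x" "\<And>x. \<psi> x \<le> B"
    for \<psi> :: "'a \<Rightarrow> real" and B :: real
  proof -
    have i: "integrable m \<psi>" "integrable n \<psi>" "integrable d \<psi>"
      by (rule integrable_bounded_finite_borel[where U=B, OF _ that(1)]; use m n d B in force)+
    have "ennreal (\<integral>x. \<psi> x \<partial>m) = ennreal ((\<integral>x. \<psi> x \<partial>n) + (\<integral>x. \<psi> x \<partial>d))"
      using nn_integral_add_diff_measure[OF m n le, of "\<lambda>x. ennreal (\<psi> x)"] i B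
      by (simp add: nn_integral_eq_integral d_def[symmetric] ennreal_plus[symmetric] del: ennreal_plus)
    moreover have "0 \<le> (\<integral>x. \<psi> x \<partial>m)" "0 \<le> (\<integral>x. \<psi> x \<partial>n) + (\<integral>x. \<psi> x \<partial>d)" using B by simp_all
    ultimately show ?thesis by (simp only: ennreal_inj)
  qed
  have U0: "0 \<le> U" using U[of undefined] by linarith
  have bd: "norm (\<phi> x) \<le> U" "\<phi> x + U \<ge> 0" "\<phi> x + U \<le> 2*U" for x using U[of x] by (auto simp: abs_le_iff)
  have i: "integrable m \<phi>" "integrable n \<phi>" "integrable d \<phi>"
    by (rule integrable_bounded_finite_borel[where U=U, OF _ \<phi> bd(1)]; fact)+
  interpret n: finite_measure n by (rule N)
  interpret d: finite_measure d by (rule D)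
  have "(\<integral>x. \<phi> x + U \<partial>m) = (\<integral>x. \<phi> x + U \<partial>n) + (\<integral>x. \<phi> x + U \<partial>d)"
    by (rule eq[where B="2*U"]) (use bd in auto)
  moreover have "(\<integral>x. U \<partial>m) = (\<integral>x. U \<partial>n) + (\<integral>x. U \<partial>d)"
    by (rule eq[where B="U"]) (use U0 in auto)
  ultimately have "(\<integral>x. \<phi> x \<partial>m) - (\<integral>x. \<phi> x \<partial>n) = (\<integral>x. \<phi> x \<partial>d)"
    using i by simp
  also have "\<bar>\<dots>\<bar> \<le> (\<integral>x. \<bar>\<phi> x\<bar> \<partial>d)" by (rule integral_abs_bound)
  also have "\<dots> \<le> (\<integral>x. U \<partial>d)" using i U by (intro integral_mono) auto
  finally show ?thesis by (simp add: total_mass_def d_def mult.commute)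
qed

text \<open>The easy half of Kantorovich--Rubinstein duality: every admissible triple splits the
  difference of the integrals into the two discarded masses and the transport cost.\<close>

lemma prw_dist_test_function:
  fixes \<phi> :: "'a::euclidean_space \<Rightarrow> real"
  assumes b: "b > 0" and m1: "m1 \<in> finite_borel_measures" and m2: "m2 \<in> finite_borel_measures"
    and U: "\<And>x. \<bar>\<phi> x\<bar> \<le> U" and Lip: "\<And>x y. \<bar>\<phi> x - \<phi> y\<bar> \<le> \<Lambda> * norm (x - y)" and "0 \<le> \<Lambda>"
    and \<phi>[measurable]: "\<phi> \<in> borel_measurable borel"
  shows "\<bar>(\<integral>x. \<phi> x \<partial>m1) - (\<integral>x. \<phi> x \<partial>m2)\<bar> \<le> (U / b + \<Lambda>) * prw_dist b m1 m2"
proof -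
  let ?cost = "\<lambda>(n1, n2, p). ennreal (b * total_mass (diff_measure m1 n1) + b * total_mass (diff_measure m2 n2)) +
      (\<integral>\<^sup>+z. ennreal (norm (fst z - snd z :: 'a)) \<partial>p)"
  define I where "I = (INF z \<in> prw_admissible m1 m2. ?cost z)"
  define c where "c = U / b + \<Lambda>"
  define D where "D = \<bar>(\<integral>x. \<phi> x \<partial>m1) - (\<integral>x. \<phi> x \<partial>m2)\<bar>"
  have U0: "0 \<le> U" using U[of undefined] by linarith
  have c0: "0 \<le> c" using U0 b assms by (simp add: c_def)
  let ?z = "null_measure (borel :: 'a measure)"
  have z: "?z \<in> finite_borel_measures"
    by (auto simp: finite_borel_measures_def intro!: finite_measureI)
  have dz: "distr (null_measure (borel :: ('a\<times>'a) measure)) borel h = ?z" if "h \<in> borel_measurable borel" for h :: "'a\<times>'a \<Rightarrow> 'a"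
    by (rule measure_eqI) (use that in \<open>auto simp: emeasure_distr\<close>)
  \<comment> \<open>The infimum must be finite: \<open>enn2real\<close> would turn an infinite value into \<open>0\<close>.\<close>
  have "(?z, ?z, null_measure borel) \<in> prw_admissible m1 m2"
    using z finite_borel_measuresD[OF m1] finite_borel_measuresD[OF m2]
      dz[OF borel_measurable_continuous_onI[OF continuous_on_fst[OF continuous_on_id]]]
      dz[OF borel_measurable_continuous_onI[OF continuous_on_snd[OF continuous_on_id]]]
    by (auto simp: prw_admissible_def le_measure)
  then have "I \<le> ?cost (?z, ?z, null_measure borel)" unfolding I_def by (rule INF_lower)
  also have "\<dots> < \<infinity>" by simp
  finally have I: "I < \<infinity>" .
  \<comment> \<open>The infimum need not be attained, so an almost optimal triple is chosen.\<close>
  have "D \<le> c * y" if y: "enn2real I < y" for y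
  proof -
    have y0: "y > 0" using y enn2real_nonneg[of I] by linarith
    have "I < ennreal y" using y I by (metis ennreal_enn2real ennreal_less_iff enn2real_nonneg infinity_ennreal_def)
    then obtain n1 n2 p where adm: "(n1, n2, p) \<in> prw_admissible m1 m2" and cost: "?cost (n1, n2, p) < ennreal y"
      unfolding I_def INF_less_iff by auto
    from adm have n1: "n1 \<in> finite_borel_measures" and n2: "n2 \<in> finite_borel_measures"
      and le: "n1 \<le> m1" "n2 \<le> m2" and p: "sets p = sets borel" "distr p borel fst = n1" "distr p borel snd = n2"
      by (auto simp: prw_admissible_def)
    have ps[measurable_cong]: "sets p = sets (borel :: ('a\<times>'a) measure)" by (fact p)
    have ps': "sets p = sets ((borel :: 'a measure) \<Otimes>\<^sub>M (borel :: 'a measure))" by (simp only: p(1) borel_prod)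
    have psp: "space p = UNIV" using sets_eq_imp_space_eq[OF ps] by simp
    have fst_m[measurable]: "fst \<in> p \<rightarrow>\<^sub>M borel" and snd_m[measurable]: "snd \<in> p \<rightarrow>\<^sub>M borel"
      unfolding measurable_cong_sets[OF ps' refl] by (rule measurable_fst, rule measurable_snd)
    define d1 d2 where "d1 = total_mass (diff_measure m1 n1)" and "d2 = total_mass (diff_measure m2 n2)"
    have d0: "d1 \<ge> 0" "d2 \<ge> 0" by (simp_all add: d1_def d2_def total_mass_def)
    let ?N = "\<integral>\<^sup>+z. ennreal (norm (fst z - snd z :: 'a)) \<partial>p"
    have N: "?N < \<infinity>" using cost
      by (auto simp: less_top[symmetric] top_unique)
    have int: "integrable p (\<lambda>z. norm (fst z - snd z))"
      by (rule integrableI_bounded) (use N in auto)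
    then have NI: "?N = ennreal (\<integral>z. norm (fst z - snd z) \<partial>p)"
      by (intro nn_integral_eq_integral) auto
    have cy: "b * d1 + b * d2 + (\<integral>z. norm (fst z - snd z) \<partial>p) < y"
    proof -
      have "ennreal (b * d1 + b * d2 + (\<integral>z. norm (fst z - snd z) \<partial>p)) < ennreal y"
        using cost d0 b by (simp add: NI d1_def d2_def ennreal_plus)
      moreover have "0 \<le> b * d1 + b * d2 + (\<integral>z. norm (fst z - snd z) \<partial>p)" using d0 b by simp
      ultimately show ?thesis by (simp only: ennreal_less_iff)
    qed
    have "emeasure n1 UNIV = emeasure p (space p)"
      unfolding p(2)[symmetric] by (subst emeasure_distr) (auto simp: psp)
    then have fp: "finite_measure p"
      using finite_measure.emeasure_finite[OF finite_borel_measuresD(3)[OF n1], of UNIV]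
      by (intro finite_measureI) simp
    have \<phi>b: "norm (\<phi> x) \<le> U" for x using U by simp
    interpret p: finite_measure p by (rule fp)
    have i: "integrable p (\<lambda>z. \<phi> (fst z))" "integrable p (\<lambda>z. \<phi> (snd z))"
      by (rule p.integrable_const_bound[where B=U]; use \<phi>b in simp)+
    have "(\<integral>x. \<phi> x \<partial>n1) - (\<integral>x. \<phi> x \<partial>n2) = (\<integral>z. \<phi> (fst z) - \<phi> (snd z) \<partial>p)"
      unfolding p(2,3)[symmetric] using i by (simp add: integral_distr)
    also have "\<bar>\<dots>\<bar> \<le> (\<integral>z. \<bar>\<phi> (fst z) - \<phi> (snd z)\<bar> \<partial>p)" by (rule integral_abs_bound)
    also have "\<dots> \<le> (\<integral>z. \<Lambda> * norm (fst z - snd z) \<partial>p)"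
      using i int Lip by (intro integral_mono) auto
    finally have 1: "\<bar>(\<integral>x. \<phi> x \<partial>n1) - (\<integral>x. \<phi> x \<partial>n2)\<bar> \<le> \<Lambda> * (\<integral>z. norm (fst z - snd z) \<partial>p)" by simp
    have 2: "\<bar>(\<integral>x. \<phi> x \<partial>m1) - (\<integral>x. \<phi> x \<partial>n1)\<bar> \<le> U * d1" "\<bar>(\<integral>x. \<phi> x \<partial>m2) - (\<integral>x. \<phi> x \<partial>n2)\<bar> \<le> U * d2"
      unfolding d1_def d2_def by (rule integral_diff_bound; fact)+
    let ?J = "\<integral>z. norm (fst z - snd z) \<partial>p"
    have J0: "?J \<ge> 0" by simp
    have "D \<le> U * d1 + U * d2 + \<Lambda> * ?J" using 1 2 unfolding D_def by linarith
    also have "\<dots> \<le> c * (b * d1 + b * d2 + ?J)"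
    proof -
      have "c * (b * d1 + b * d2 + ?J) = U * d1 + U * d2 + \<Lambda> * ?J + (\<Lambda> * (b * d1 + b * d2) + U / b * ?J)"
        using b by (simp add: c_def field_simps)
      moreover have "0 \<le> \<Lambda> * (b * d1 + b * d2) + U / b * ?J"
        using b U0 d0 \<open>0 \<le> \<Lambda>\<close> J0 by (intro add_nonneg_nonneg mult_nonneg_nonneg) auto
      ultimately show ?thesis by linarith
    qed
    also have "\<dots> \<le> c * y" using cy c0 by (intro mult_left_mono) auto
    finally show ?thesis .
  qed
  note * = this
  have "D \<le> c * enn2real I"
  proof (rule field_le_epsilon)
    fix e :: real assume e: "e > 0"
    \<comment> \<open>The denominator is \<open>c + 1\<close> because \<open>c\<close> may vanish.\<close>
    have "D \<le> c * (enn2real I + e / (c + 1))" using e c0 by (intro *) auto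
    also have "\<dots> = c * enn2real I + e * (c / (c + 1))" by (simp add: distrib_left)
    also have "\<dots> \<le> c * enn2real I + e" using e c0 by (intro add_left_mono mult_left_le) auto
    finally show "D \<le> c * enn2real I + e" .
  qed
  then show ?thesis unfolding D_def c_def I_def prw_dist_def .
qed

lemma prw_dist_nonneg [simp]: "0 \<le> prw_dist b m1 m2"
  by (simp add: prw_dist_def)

section \<open>Weighted images of a measure\<close>

definition weighted_push :: "'b measure \<Rightarrow> ('b \<Rightarrow> real) \<Rightarrow> ('b \<Rightarrow> 'a::topological_space) \<Rightarrow> 'a measure" where
  "weighted_push M w x = distr (density M (\<lambda>\<omega>. ennreal (w \<omega>))) borel x"

lemma sets_weighted_push [simp]: "sets (weighted_push M w x) = sets borel"
  by (simp add: weighted_push_def)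

lemma emeasure_weighted_push_UNIV:
  assumes "integrable M w" "AE \<omega> in M. 0 \<le> w \<omega>" and [measurable]: "x \<in> borel_measurable M"
  shows "emeasure (weighted_push M w x) UNIV = ennreal (\<integral>\<omega>. w \<omega> \<partial>M)"
proof -
  have [measurable]: "w \<in> borel_measurable M" using assms by auto
  have "emeasure (weighted_push M w x) UNIV = (\<integral>\<^sup>+\<omega>. ennreal (w \<omega>) \<partial>M)"
    by (simp add: weighted_push_def emeasure_distr emeasure_density cong: nn_integral_cong)
  then show ?thesis using assms by (simp add: nn_integral_eq_integral)
qed

lemma weighted_push_in:
  assumes "integrable M w" "AE \<omega> in M. 0 \<le> w \<omega>" and [measurable]: "x \<in> borel_measurable M"
  shows "weighted_push M w x \<in> finite_borel_measures"
  using emeasure_weighted_push_UNIV[OF assms]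
  by (auto simp: finite_borel_measures_def weighted_push_def intro!: finite_measureI)

lemma total_mass_weighted_push:
  assumes "integrable M w" "AE \<omega> in M. 0 \<le> w \<omega>" and [measurable]: "x \<in> borel_measurable M"
  shows "total_mass (weighted_push M w x) = (\<integral>\<omega>. w \<omega> \<partial>M)"
proof -
  have "space (weighted_push M w x) = UNIV" by (simp add: weighted_push_def)
  then show ?thesis
    using emeasure_weighted_push_UNIV[OF assms] integral_nonneg_AE[OF assms(2)]
    by (simp add: total_mass_def measure_def)
qed

lemma integral_weighted_push:
  fixes \<phi> :: "'a::topological_space \<Rightarrow> real"
  assumes [measurable]: "w \<in> borel_measurable M" and "AE \<omega> in M. 0 \<le> w \<omega>" and [measurable]: "x \<in> borel_measurable M"
    and [measurable]: "\<phi> \<in> borel_measurable borel"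
  shows "(\<integral>y. \<phi> y \<partial>weighted_push M w x) = (\<integral>\<omega>. \<phi> (x \<omega>) * w \<omega> \<partial>M)"
proof -
  have "(\<integral>y. \<phi> y \<partial>weighted_push M w x) = (\<integral>\<omega>. \<phi> (x \<omega>) \<partial>density M (\<lambda>\<omega>. ennreal (w \<omega>)))"
    unfolding weighted_push_def by (rule integral_distr) simp_all
  also have "\<dots> = (\<integral>\<omega>. w \<omega> *\<^sub>R \<phi> (x \<omega>) \<partial>M)"
    by (rule integral_density) (use assms in auto)
  finally show ?thesis by (simp add: mult.commute)
qed

lemma weighted_push_mono:
  assumes [measurable]: "w \<in> borel_measurable M" "v \<in> borel_measurable M" "x \<in> borel_measurable M"
    and "AE \<omega> in M. w \<omega> \<le> v \<omega>"
  shows "weighted_push M w x \<le> weighted_push M v x"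
  unfolding weighted_push_def using assms(4)
  by (subst le_measure)
     (auto simp: emeasure_distr emeasure_density ennreal_leI intro!: nn_integral_mono_AE mult_right_mono)

text \<open>Two weighted images of one measure are coupled by moving the common weight \<open>min w1 w2\<close>
  along \<open>x1\<close> and \<open>x2\<close> and discarding the rest.\<close>

lemma prw_dist_weighted_push:
  fixes x1 x2 :: "'b \<Rightarrow> 'a::euclidean_space"
  assumes b: "b > 0" and M: "finite_measure M"
    and [measurable]: "x1 \<in> borel_measurable M" "x2 \<in> borel_measurable M"
    and w[measurable]: "w1 \<in> borel_measurable M" "w2 \<in> borel_measurable M"
    and w1: "AE \<omega> in M. 0 \<le> w1 \<omega> \<and> w1 \<omega> \<le> B" and w2: "AE \<omega> in M. 0 \<le> w2 \<omega> \<and> w2 \<omega> \<le> B" and B: "0 \<le> B"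
    and int: "integrable M (\<lambda>\<omega>. norm (x1 \<omega> - x2 \<omega>))"
  shows "prw_dist b (weighted_push M w1 x1) (weighted_push M w2 x2) \<le>
           b * (\<integral>\<omega>. \<bar>w1 \<omega> - w2 \<omega>\<bar> \<partial>M) + B * (\<integral>\<omega>. norm (x1 \<omega> - x2 \<omega>) \<partial>M)"
proof -
  interpret finite_measure M by (rule M)
  let ?m1 = "weighted_push M w1 x1" and ?m2 = "weighted_push M w2 x2"
  \<comment> \<open>the weight that is transported\<close>
  define v where "v = (\<lambda>\<omega>. min (w1 \<omega>) (w2 \<omega>))"
  have v[measurable]: "v \<in> borel_measurable M" by (simp add: v_def)
  have vAE: "AE \<omega> in M. 0 \<le> v \<omega> \<and> v \<omega> \<le> B" using w1 w2 by eventually_elim (auto simp: v_def)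
  have i: "integrable M w" if [measurable]: "w \<in> borel_measurable M" and "AE \<omega> in M. 0 \<le> w \<omega> \<and> w \<omega> \<le> B" for w
  proof (rule integrable_const_bound[where B=B])
    show "AE \<omega> in M. norm (w \<omega>) \<le> B" using that(2) by eventually_elim simp
  qed simp
  note i = i[OF w(1) w1] i[OF w(2) w2] i[OF v vAE]
  have n1: "AE \<omega> in M. 0 \<le> w1 \<omega>" using w1 by eventually_elim simp
  have n2: "AE \<omega> in M. 0 \<le> w2 \<omega>" using w2 by eventually_elim simp
  have n3: "AE \<omega> in M. 0 \<le> v \<omega>" using vAE by eventually_elim simp
  note n = n1 n2 n3
  let ?n1 = "weighted_push M v x1" and ?n2 = "weighted_push M v x2"
  let ?p = "weighted_push M v (\<lambda>\<omega>. (x1 \<omega>, x2 \<omega>))"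
  have le: "?n1 \<le> ?m1" "?n2 \<le> ?m2" by (rule weighted_push_mono; simp add: v_def)+
  have pf: "distr ?p borel fst = ?n1" "distr ?p borel snd = ?n2"
    unfolding weighted_push_def by (subst distr_distr; simp add: comp_def borel_prod[symmetric])+
  have adm: "(?n1, ?n2, ?p) \<in> prw_admissible ?m1 ?m2"
    unfolding prw_admissible_def using le pf i n
    by (simp add: weighted_push_in total_mass_weighted_push)
  have dm: "total_mass (diff_measure m' n') = total_mass m' - total_mass n'"
    if "m' \<in> finite_borel_measures" "n' \<in> finite_borel_measures" "n' \<le> m'" for m' n' :: "'a measure"
  proof -
    note M' = finite_borel_measuresD[OF that(1)] and N' = finite_borel_measuresD[OF that(2)]
    have le': "emeasure n' A \<le> emeasure m' A" for A
      using that(3) M' N' by (subst (asm) le_measure) (auto simp: emeasure_notin_sets)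
    interpret m': finite_measure m' by (rule M')
    interpret n': finite_measure n' by (rule N')
    have nm: "measure n' UNIV \<le> measure m' UNIV"
      using le'[of UNIV] by (simp add: m'.emeasure_eq_measure n'.emeasure_eq_measure)
    have "emeasure (diff_measure m' n') UNIV = ennreal (measure m' UNIV - measure n' UNIV)"
      using emeasure_diff_measure[OF M'(3) N'(3) _ le', of UNIV] M' N'
      by (simp add: m'.emeasure_eq_measure n'.emeasure_eq_measure ennreal_minus)
    then have "measure (diff_measure m' n') UNIV = measure m' UNIV - measure n' UNIV"
      using nm by (intro measure_eq_emeasure_eq_ennreal) auto
    then show ?thesis by (simp add: total_mass_def M' N')
  qed
  have d1: "total_mass (diff_measure ?m1 ?n1) = (\<integral>\<omega>. w1 \<omega> - v \<omega> \<partial>M)"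
    using i n by (simp add: dm le weighted_push_in total_mass_weighted_push)
  have d2: "total_mass (diff_measure ?m2 ?n2) = (\<integral>\<omega>. w2 \<omega> - v \<omega> \<partial>M)"
    using i n by (simp add: dm le weighted_push_in total_mass_weighted_push)
  have "(\<integral>\<omega>. w1 \<omega> - v \<omega> \<partial>M) + (\<integral>\<omega>. w2 \<omega> - v \<omega> \<partial>M) = (\<integral>\<omega>. (w1 \<omega> - v \<omega>) + (w2 \<omega> - v \<omega>) \<partial>M)"
    using i by simp
  also have "\<dots> = (\<integral>\<omega>. \<bar>w1 \<omega> - w2 \<omega>\<bar> \<partial>M)" by (rule Bochner_Integration.integral_cong) (auto simp: v_def min_def)
  finally have dd: "b * total_mass (diff_measure ?m1 ?n1) + b * total_mass (diff_measure ?m2 ?n2) = b * (\<integral>\<omega>. \<bar>w1 \<omega> - w2 \<omega>\<bar> \<partial>M)"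
    unfolding d1 d2 by (simp add: distrib_left[symmetric])
  have mp: "(\<lambda>z. norm (fst z - snd z)) \<in> borel_measurable (borel :: ('a\<times>'a) measure)"
    unfolding borel_prod[symmetric] by measurable
  have "(\<integral>\<^sup>+z. ennreal (norm (fst z - snd z)) \<partial>?p) = (\<integral>\<^sup>+\<omega>. ennreal (v \<omega>) * ennreal (norm (x1 \<omega> - x2 \<omega>)) \<partial>M)"
    unfolding weighted_push_def using mp by (subst nn_integral_distr) (auto simp: borel_prod[symmetric] nn_integral_density)
  also have "\<dots> \<le> (\<integral>\<^sup>+\<omega>. ennreal (B * norm (x1 \<omega> - x2 \<omega>)) \<partial>M)"
  proof (rule nn_integral_mono_AE)
    show "AE \<omega> in M. ennreal (v \<omega>) * ennreal (norm (x1 \<omega> - x2 \<omega>)) \<le> ennreal (B * norm (x1 \<omega> - x2 \<omega>))"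
      using vAE by eventually_elim (simp add: ennreal_mult[symmetric] ennreal_leI mult_right_mono)
  qed
  also have "\<dots> = ennreal (B * (\<integral>\<omega>. norm (x1 \<omega> - x2 \<omega>) \<partial>M))"
    using int B by (subst nn_integral_eq_integral) auto
  finally have p: "(\<integral>\<^sup>+z. ennreal (norm (fst z - snd z)) \<partial>?p) \<le> ennreal (B * (\<integral>\<omega>. norm (x1 \<omega> - x2 \<omega>) \<partial>M))" .
  have "prw_dist b ?m1 ?m2 \<le> enn2real (ennreal (b * (\<integral>\<omega>. \<bar>w1 \<omega> - w2 \<omega>\<bar> \<partial>M)) + ennreal (B * (\<integral>\<omega>. norm (x1 \<omega> - x2 \<omega>) \<partial>M)))"
    unfolding prw_dist_def
  proof (rule enn2real_mono)
    show "(INF (n1, n2, p) \<in> prw_admissible ?m1 ?m2.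
      ennreal (b * total_mass (diff_measure ?m1 n1) + b * total_mass (diff_measure ?m2 n2)) +
      (\<integral>\<^sup>+z. ennreal (norm (fst z - snd z)) \<partial>p)) \<le> ennreal (b * (\<integral>\<omega>. \<bar>w1 \<omega> - w2 \<omega>\<bar> \<partial>M)) + ennreal (B * (\<integral>\<omega>. norm (x1 \<omega> - x2 \<omega>) \<partial>M))"
      by (rule INF_lower2[OF adm]) (use p in \<open>auto simp: dd intro: add_left_mono\<close>)
  qed simp
  also have "\<dots> = b * (\<integral>\<omega>. \<bar>w1 \<omega> - w2 \<omega>\<bar> \<partial>M) + B * (\<integral>\<omega>. norm (x1 \<omega> - x2 \<omega>) \<partial>M)"
    using b B by (simp add: ennreal_plus[symmetric] del: ennreal_plus)
  finally show ?thesis .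
qed

lemma prw_dist_self:
  assumes "b > 0" and m: "m \<in> finite_borel_measures"
  shows "prw_dist b m m = 0"
proof -
  note M = finite_borel_measuresD[OF m]
  have [measurable_cong]: "sets m = sets borel" by (rule M)
  have "weighted_push m (\<lambda>_. 1) (\<lambda>x. x) = m"
    unfolding weighted_push_def using M by (simp add: density_1 distr_id2)
  then show ?thesis
    using prw_dist_weighted_push[OF assms(1) M(3), of "\<lambda>x. x" "\<lambda>x. x" "\<lambda>_. 1" "\<lambda>_. 1" 1] prw_dist_nonneg[of b m m]
    by simp
qed

text \<open>Dominated convergence along the filters that occur in one-sided derivatives; the filter is
  countably generated, so sequences suffice.\<close>

lemma dominated_convergence_within:
  fixes f :: "real \<Rightarrow> 'b \<Rightarrow> 'c::{banach,second_countable_topology}"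
  assumes f: "\<And>s. s \<in> S - {t} \<Longrightarrow> f s \<in> borel_measurable M" and l: "l \<in> borel_measurable M"
    and w: "integrable M w"
    and lim: "AE \<omega> in M. ((\<lambda>s. f s \<omega>) \<longlongrightarrow> l \<omega>) (at t within S)"
    and le: "\<And>s. s \<in> S - {t} \<Longrightarrow> AE \<omega> in M. norm (f s \<omega>) \<le> w \<omega>"
  shows "((\<lambda>s. \<integral>\<omega>. f s \<omega> \<partial>M) \<longlongrightarrow> (\<integral>\<omega>. l \<omega> \<partial>M)) (at t within S)"
  unfolding tendsto_at_iff_sequentially comp_def
proof (intro allI impI)
  fix X :: "nat \<Rightarrow> real" assume X: "\<forall>i. X i \<in> S - {t}" "X \<longlonglongrightarrow> t"
  show "(\<lambda>i. \<integral>\<omega>. f (X i) \<omega> \<partial>M) \<longlonglongrightarrow> (\<integral>\<omega>. l \<omega> \<partial>M)"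
  proof (rule integral_dominated_convergence[OF l _ w])
    show "AE \<omega> in M. (\<lambda>i. f (X i) \<omega>) \<longlonglongrightarrow> l \<omega>"
      using lim
    proof eventually_elim
      case (elim \<omega>)
      then show ?case using X unfolding tendsto_at_iff_sequentially comp_def by blast
    qed
  qed (use X f le in auto)
qed

lemma prw_dist_weighted_push_tendsto:
  fixes x :: "real \<Rightarrow> 'b \<Rightarrow> 'a::euclidean_space"
  assumes b: "b > 0" and M: "finite_measure M" and t: "t \<in> S"
    and x: "\<And>s. s \<in> S \<Longrightarrow> x s \<in> borel_measurable M" and w: "\<And>s. s \<in> S \<Longrightarrow> w s \<in> borel_measurable M"
    and B: "\<And>s. s \<in> S \<Longrightarrow> AE \<omega> in M. 0 \<le> w s \<omega> \<and> w s \<omega> \<le> B" "0 \<le> B"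
    and D: "\<And>s. s \<in> S \<Longrightarrow> AE \<omega> in M. norm (x s \<omega> - x t \<omega>) \<le> D"
    and xl: "AE \<omega> in M. ((\<lambda>s. x s \<omega>) \<longlongrightarrow> x t \<omega>) (at t within S)"
    and wl: "AE \<omega> in M. ((\<lambda>s. w s \<omega>) \<longlongrightarrow> w t \<omega>) (at t within S)"
  shows "((\<lambda>s. prw_dist b (weighted_push M (w s) (x s)) (weighted_push M (w t) (x t))) \<longlongrightarrow> 0) (at t within S)"
proof (rule Lim_null_comparison)
  interpret finite_measure M by (rule M)
  note xt = x[OF t] and wt = w[OF t]
  have w': "((\<lambda>s. \<integral>\<omega>. \<bar>w s \<omega> - w t \<omega>\<bar> \<partial>M) \<longlongrightarrow> (\<integral>\<omega>. 0 \<partial>M)) (at t within S)"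
  proof (rule dominated_convergence_within[where w = "\<lambda>_. B"])
    show "AE \<omega> in M. ((\<lambda>s. \<bar>w s \<omega> - w t \<omega>\<bar>) \<longlongrightarrow> 0) (at t within S)"
      using wl by eventually_elim (rule tendsto_rabs_zero, simp add: LIM_zero)
    show "AE \<omega> in M. norm \<bar>w s \<omega> - w t \<omega>\<bar> \<le> B" if "s \<in> S - {t}" for s
      using B(1)[of s] B(1)[OF t] that by (auto elim!: eventually_elim2)
  qed (use w wt in auto)
  have x': "((\<lambda>s. \<integral>\<omega>. norm (x s \<omega> - x t \<omega>) \<partial>M) \<longlongrightarrow> (\<integral>\<omega>. 0 \<partial>M)) (at t within S)"
  proof (rule dominated_convergence_within[where w = "\<lambda>_. D"])
    show "AE \<omega> in M. ((\<lambda>s. norm (x s \<omega> - x t \<omega>)) \<longlongrightarrow> 0) (at t within S)"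
      using xl by eventually_elim (rule tendsto_norm_zero, simp add: LIM_zero)
  qed (use x xt D in auto)
  show "((\<lambda>s. b * (\<integral>\<omega>. \<bar>w s \<omega> - w t \<omega>\<bar> \<partial>M) + B * (\<integral>\<omega>. norm (x s \<omega> - x t \<omega>) \<partial>M)) \<longlongrightarrow> 0) (at t within S)"
    using tendsto_add[OF tendsto_mult_left[OF w', of b] tendsto_mult_left[OF x', of B]] by simp
  have "prw_dist b (weighted_push M (w s) (x s)) (weighted_push M (w t) (x t)) \<le>
      b * (\<integral>\<omega>. \<bar>w s \<omega> - w t \<omega>\<bar> \<partial>M) + B * (\<integral>\<omega>. norm (x s \<omega> - x t \<omega>) \<partial>M)" if s: "s \<in> S" for s
  proof (rule prw_dist_weighted_push[OF b M])
    show "integrable M (\<lambda>\<omega>. norm (x s \<omega> - x t \<omega>))"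
      using D[OF s] x[OF s] xt by (intro integrable_const_bound[where B = D]) auto
  qed (use x w s t B in auto)
  then show "\<forall>\<^sub>F s in at t within S. norm (prw_dist b (weighted_push M (w s) (x s)) (weighted_push M (w t) (x t)))
      \<le> b * (\<integral>\<omega>. \<bar>w s \<omega> - w t \<omega>\<bar> \<partial>M) + B * (\<integral>\<omega>. norm (x s \<omega> - x t \<omega>) \<partial>M)"
    by (simp add: eventually_at_filter)
qed

section \<open>Elementary estimates\<close>

lemma continuous_on_norm_lipschitz:
  fixes h :: "'a::real_normed_vector \<Rightarrow> 'b::real_normed_vector"
  assumes "\<And>x y. norm (h x - h y) \<le> c * norm (x - y)"
  shows "continuous_on UNIV h"
proof -
  have "norm (h x - h y) \<le> \<bar>c\<bar> * norm (x - y)" for x y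
    using assms[of x y] mult_right_mono[OF abs_ge_self[of c], of "norm (x - y)"] by simp
  then show ?thesis
    by (intro lipschitz_on_continuous_on[where L = "\<bar>c\<bar>"] lipschitz_onI) (auto simp: dist_norm)
qed

lemma vector_derivative_increment:
  fixes u :: "real \<Rightarrow> 'a::banach"
  assumes u: "\<And>r. r \<in> {a..c} \<Longrightarrow> (u has_vector_derivative u' r) (at r within {a..c})"
    and B: "\<And>r. r \<in> {a..c} \<Longrightarrow> norm (u' r) \<le> B" and t: "t \<in> {a..c}" "s \<in> {a..c}"
  shows "norm (u s - u t) \<le> B * \<bar>s - t\<bar>"
proof -
  have B0: "0 \<le> B" using B[OF t(1)] norm_ge_zero[of "u' t"] by linarith
  have *: "norm (u s - u t) \<le> B * \<bar>s - t\<bar>" if st: "t \<in> {a..c}" "s \<in> {a..c}" "t \<le> s" for s t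
  proof -
    have "(u' has_integral u s - u t) {t..s}"
      using st by (intro fundamental_theorem_of_calculus has_vector_derivative_within_subset[OF u]) auto
    from has_integral_bound_real[OF B0 _ this, of "{}"] B st show ?thesis by auto
  qed
  show ?thesis using *[of t s] *[of s t] t by (cases "t \<le> s") (auto simp: norm_minus_commute abs_minus_commute)
qed

lemma norm_fst_le_norm: "norm (fst p) \<le> norm p" and norm_snd_le_norm: "norm (snd p) \<le> norm p"
  using norm_fst_le[of "fst p" "snd p"] norm_snd_le[of "snd p" "fst p"] by simp_all

lemma abs_exp_diff_le:
  fixes a c k :: real
  assumes "a \<le> k" "c \<le> k"
  shows "\<bar>exp a - exp c\<bar> \<le> exp k * \<bar>a - c\<bar>"
proof -
  have *: "exp c - exp a \<le> exp k * (c - a)" if "a \<le> c" "c \<le> k" for a c :: real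
  proof -
    have "exp c - exp a = exp c * (1 - exp (a - c))" by (simp add: exp_diff field_simps)
    also have "1 - exp (a - c) \<le> c - a" using exp_ge_add_one_self[of "a - c"] by linarith
    then have "exp c * (1 - exp (a - c)) \<le> exp c * (c - a)" by (intro mult_left_mono) auto
    also have "\<dots> \<le> exp k * (c - a)" using that by (intro mult_right_mono) auto
    finally show ?thesis .
  qed
  show ?thesis using *[of a c] *[of c a] assms by (cases "a \<le> c") auto
qed

text \<open>Rescaling to the fixed interval \<open>{0..1}\<close> turns the upper limit into a parameter of the integrand.\<close>

lemma continuous_on_integral_param_upper:
  fixes V :: "real \<Rightarrow> 'a::topological_space \<Rightarrow> 'c::banach"
  assumes "continuous_on ({0..T} \<times> UNIV) (\<lambda>(t, x). V t x)"
  shows "continuous_on ({0..T} \<times> UNIV) (\<lambda>(t, x). integral {0..t} (\<lambda>\<tau>. V \<tau> x))"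
proof -
  have "continuous_on (({0..T} \<times> UNIV) \<times> cbox 0 1) (\<lambda>(p, u). V (fst p * u) (snd p))"
  proof -
    have "continuous_on (({0..T} \<times> UNIV) \<times> cbox (0::real) 1) (\<lambda>q. (\<lambda>(t, x). V t x) (fst (fst q) * snd q, snd (fst q :: real \<times> 'a)))"
      by (rule continuous_on_compose2[OF assms])
        (auto intro!: continuous_intros mult_nonneg_nonneg intro: order_trans[OF mult_right_le_one_le])
    then show ?thesis by (simp add: case_prod_beta)
  qed
  from integral_continuous_on_param[OF this]
  have "continuous_on ({0..T} \<times> UNIV) (\<lambda>p. fst p *\<^sub>R integral {0..1} (\<lambda>u. V (fst p * u) (snd p)))"
    by (intro continuous_intros) auto
  moreover have "integral {0..t} (\<lambda>\<tau>. V \<tau> x) = t *\<^sub>R integral {0..1} (\<lambda>u. V (t * u) x)" if "0 \<le> t" for t x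
  proof (cases "t = 0")
    case False
    then have "(\<lambda>x. x / t) ` {0..t} = {0..1}"
      using that by (simp add: image_divide_atLeastAtMost)
    then show ?thesis using integral_stretch_real[OF False, of 0 t "\<lambda>\<tau>. V \<tau> x"] that False by simp
  qed simp
  ultimately show ?thesis
    by (subst continuous_on_cong[OF refl, where g = "\<lambda>p. fst p *\<^sub>R integral {0..1} (\<lambda>u. V (fst p * u) (snd p))"]) auto
qed

section \<open>Coefficients along curves of measures\<close>

lemma coeff_bound:
  assumes "bounded_coeff T K H" "t \<in> {0..T}" "m \<in> finite_borel_measures"
  shows "norm (H t x m) \<le> K"
  using assms by (simp add: bounded_coeff_def)

text \<open>A curve of measures that is continuous in the PRW distance turns a coefficient into a jointly
  continuous vector field. At \<open>t\<close> itself the limit says nothing, which is why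
  \<open>prw_dist_self\<close> enters.\<close>

lemma continuous_coeff_along:
  assumes H: "continuous_coeff T b H"
    and m: "\<And>t. t \<in> {0..T} \<Longrightarrow> m t \<in> finite_borel_measures"
    and lim: "\<And>t. t \<in> {0..T} \<Longrightarrow> ((\<lambda>s. prw_dist b (m s) (m t)) \<longlongrightarrow> 0) (at t within {0..T})"
    and b: "b > 0"
  shows "continuous_on ({0..T} \<times> UNIV) (\<lambda>(t, x). H t x (m t))"
proof -
  have "\<exists>d>0. \<forall>p'\<in>{0..T} \<times> UNIV. dist p' (t, x) < d \<longrightarrow> dist (H (fst p') (snd p') (m (fst p'))) (H t x (m t)) < e"
    if t: "t \<in> {0..T}" and e: "e > 0" for t x e
  proof -
    obtain d where d: "d > 0" and
      D: "\<And>t' x' m'. t' \<in> {0..T} \<Longrightarrow> m' \<in> finite_borel_measures \<Longrightarrow> \<bar>t' - t\<bar> < d \<Longrightarrow> norm (x' - x) < d \<Longrightarrow>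
         prw_dist b m' (m t) < d \<Longrightarrow> norm (H t' x' m' - H t x (m t)) < e"
      using H[unfolded continuous_coeff_def, rule_format, OF t m[OF t] e, of x] by auto
    obtain d' where d': "d' > 0" "\<And>s. s \<in> {0..T} \<Longrightarrow> s \<noteq> t \<Longrightarrow> dist s t < d' \<Longrightarrow> prw_dist b (m s) (m t) < d"
      using lim[OF t] d unfolding tendsto_iff eventually_at by (force simp: dist_real_def)
    have "dist (H (fst p') (snd p') (m (fst p'))) (H t x (m t)) < e"
      if p': "p' \<in> {0..T} \<times> UNIV" "dist p' (t, x) < min d d'" for p'
    proof -
      have "dist (fst p') t \<le> dist p' (t, x)" "dist (snd p') x \<le> dist p' (t, x)"
        using dist_fst_le[of p' "(t,x)"] dist_snd_le[of p' "(t,x)"] by auto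
      then have "dist (fst p') t < min d d'" "dist (snd p') x < min d d'" using p' by linarith+
      moreover have "prw_dist b (m (fst p')) (m t) < d"
        using d'(2)[of "fst p'"] calculation p' prw_dist_self[OF b m[OF t]] d by (cases "fst p' = t") auto
      ultimately show ?thesis using D[of "fst p'" "m (fst p')" "snd p'"] m p'
        by (auto simp: dist_norm)
    qed
    with d d' show ?thesis by (intro exI[of _ "min d d'"]) auto
  qed
  then show ?thesis unfolding continuous_on_iff by (auto simp: case_prod_beta)
qed

definition transport :: "'a::euclidean_space measure \<Rightarrow> ('a \<Rightarrow> 'a \<times> real) \<Rightarrow> 'a measure" where
  "transport m0 z = weighted_push m0 (\<lambda>x. exp (snd (z x))) (\<lambda>x. fst (z x))"

text \<open>The closed system for the states \<open>(position, logarithm of the weight)\<close>. The bound on the displacement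
  is part of the notion: it keeps the transported measures finite, and without finiteness nothing is
  known about \<open>H\<close>.\<close>

definition characteristic_flow ::
    "real \<Rightarrow> (real \<Rightarrow> 'a::euclidean_space \<Rightarrow> 'a measure \<Rightarrow> 'a \<times> real) \<Rightarrow> 'a measure \<Rightarrow> (real \<Rightarrow> 'a \<Rightarrow> 'a \<times> real) \<Rightarrow> bool"
  where
  "characteristic_flow T H m0 Z \<longleftrightarrow>
     continuous_on ({0..T} \<times> UNIV) (\<lambda>(t, x). Z t x) \<and> (\<forall>x. Z 0 x = (x, 0)) \<and>
     (\<exists>R. \<forall>t\<in>{0..T}. \<forall>x. norm (Z t x - (x, 0)) \<le> R) \<and>
     (\<forall>t\<in>{0..T}. \<forall>x. ((\<lambda>s. Z s x) has_vector_derivative H t (fst (Z t x)) (transport m0 (Z t))) (at t within {0..T}))"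

text \<open>The values of \<open>H\<close> combine velocity and growth rate, because the logarithm of the weight is followed like a
  position.\<close>

locale mean_field =
  fixes T b K L :: real and H :: "real \<Rightarrow> 'a::euclidean_space \<Rightarrow> 'a measure \<Rightarrow> 'a \<times> real" and m0 :: "'a measure"
  assumes T: "T > 0" and b: "b > 0" and K: "K \<ge> 0" and L: "L \<ge> 0" and m0: "m0 \<in> finite_borel_measures"
    and continuous: "continuous_coeff T b H" and lipschitz: "lipschitz_coeff T b L H"
    and bounded: "bounded_coeff T K H"
begin

sublocale m0: finite_measure m0
  using finite_borel_measuresD(3)[OF m0] .

lemma sets_m0 [measurable_cong]: "sets m0 = sets borel"
  using finite_borel_measuresD(1)[OF m0] .

text \<open>States that stay at bounded distance from their initial positions transport \<open>m0\<close> along a curve that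
  is continuous in the PRW distance, by dominated convergence; hence the velocity that they generate
  is again jointly continuous.\<close>

lemma transport_curve:
  assumes Z: "continuous_on ({0..T} \<times> UNIV) (\<lambda>(t, x). Z t x)"
    and bd: "\<And>t x. t \<in> {0..T} \<Longrightarrow> norm (Z t x - (x, 0)) \<le> R" and B: "\<And>t x. t \<in> {0..T} \<Longrightarrow> snd (Z t x) \<le> B"
  shows "t \<in> {0..T} \<Longrightarrow> transport m0 (Z t) \<in> finite_borel_measures"
    and "t \<in> {0..T} \<Longrightarrow> ((\<lambda>s. prw_dist b (transport m0 (Z s)) (transport m0 (Z t))) \<longlongrightarrow> 0) (at t within {0..T})"
    and "continuous_on ({0..T} \<times> UNIV) (\<lambda>(t, x). H t (fst (Z t x)) (transport m0 (Z t)))"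
proof -
  have ct: "continuous_on UNIV (Z t)" if "t \<in> {0..T}" for t
  proof -
    have "continuous_on UNIV (\<lambda>x. (\<lambda>(t, x). Z t x) (t, x))"
      by (rule continuous_on_compose2[OF Z]) (use that in \<open>auto intro!: continuous_intros\<close>)
    then show ?thesis by simp
  qed
  have cx: "continuous_on {0..T} (\<lambda>t. Z t x)" for x
  proof -
    have "continuous_on {0..T} (\<lambda>t. (\<lambda>(t, x). Z t x) (t, x))"
      by (rule continuous_on_compose2[OF Z]) (auto intro!: continuous_intros)
    then show ?thesis by simp
  qed
  have m1: "(\<lambda>x. fst (Z t x)) \<in> borel_measurable m0" if "t \<in> {0..T}" for t
    using borel_measurable_continuous_onI[OF continuous_on_fst[OF ct[OF that]]] by (simp cong: measurable_cong_sets add: sets_m0)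
  have m2: "(\<lambda>x. exp (snd (Z t x))) \<in> borel_measurable m0" if "t \<in> {0..T}" for t
    using borel_measurable_continuous_onI[OF continuous_on_exp[OF continuous_on_snd[OF ct[OF that]]]]
    by (simp cong: measurable_cong_sets add: sets_m0)
  have in_fbm: "transport m0 (Z t) \<in> finite_borel_measures" if "t \<in> {0..T}" for t
    unfolding transport_def using B[OF that] m1[OF that] m2[OF that]
    by (intro weighted_push_in m0.integrable_const_bound[where B = "exp B"]) auto
  show "t \<in> {0..T} \<Longrightarrow> transport m0 (Z t) \<in> finite_borel_measures" by fact
  have lim: "((\<lambda>s. prw_dist b (transport m0 (Z s)) (transport m0 (Z t))) \<longlongrightarrow> 0) (at t within {0..T})"
    if t: "t \<in> {0..T}" for t
    unfolding transport_def
  proof (rule prw_dist_weighted_push_tendsto[OF b m0.finite_measure_axioms t, where B = "exp B" and D = "2 * R"])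
    fix s assume s: "s \<in> {0..T}"
    have "norm (fst (Z s x) - fst (Z t x)) \<le> 2 * R" for x
    proof -
      have "norm (fst (Z s x) - fst (Z t x)) \<le> norm (Z s x - Z t x)"
        using norm_fst_le_norm[of "Z s x - Z t x"] by simp
      also have "\<dots> \<le> norm (Z s x - (x, 0)) + norm (Z t x - (x, 0))"
        using norm_triangle_ineq4[of "Z s x - (x, 0)" "Z t x - (x, 0)"] by simp
      also have "\<dots> \<le> 2 * R" using bd[OF s, of x] bd[OF t, of x] by simp
      finally show ?thesis .
    qed
    then show "AE x in m0. norm (fst (Z s x) - fst (Z t x)) \<le> 2 * R" by simp
  next
    show "AE x in m0. ((\<lambda>s. fst (Z s x)) \<longlongrightarrow> fst (Z t x)) (at t within {0..T})"
      using continuous_on_fst[OF cx] t by (auto simp: continuous_on_def)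
    show "AE x in m0. ((\<lambda>s. exp (snd (Z s x))) \<longlongrightarrow> exp (snd (Z t x))) (at t within {0..T})"
      using continuous_on_exp[OF continuous_on_snd[OF cx]] t by (auto simp: continuous_on_def)
  qed (use m1 m2 B in auto)
  show "t \<in> {0..T} \<Longrightarrow> ((\<lambda>s. prw_dist b (transport m0 (Z s)) (transport m0 (Z t))) \<longlongrightarrow> 0) (at t within {0..T})"
    by (rule lim)
  have "continuous_on ({0..T} \<times> UNIV) (\<lambda>(t, x). H t x (transport m0 (Z t)))"
    by (rule continuous_coeff_along[OF continuous in_fbm lim b])
  then have "continuous_on ({0..T} \<times> UNIV) (\<lambda>p. (\<lambda>(t, x). H t x (transport m0 (Z t))) (fst p, fst (Z (fst p) (snd p))))"
    by (rule continuous_on_compose2)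
       (use Z in \<open>auto intro!: continuous_intros simp: case_prod_beta\<close>)
  then show "continuous_on ({0..T} \<times> UNIV) (\<lambda>(t, x). H t (fst (Z t x)) (transport m0 (Z t)))"
    by (simp add: case_prod_beta)
qed

text \<open>The estimate behind the contraction: the transported measure depends on the states in a Lipschitz way
  with respect to the uniform distance.\<close>

lemma prw_dist_transport:
  assumes "continuous_on UNIV z" "continuous_on UNIV z'" and B: "\<And>x. snd (z x) \<le> B" "\<And>x. snd (z' x) \<le> B"
    and d: "\<And>x. norm (z x - z' x) \<le> d"
  shows "prw_dist b (transport m0 z) (transport m0 z') \<le> (b + 1) * exp B * total_mass m0 * d"
proof -
  have [measurable]: "z \<in> borel_measurable m0" "z' \<in> borel_measurable m0"
    using assms(1,2)[THEN borel_measurable_continuous_onI] by (simp_all cong: measurable_cong_sets add: sets_m0)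
  have [measurable]: "(\<lambda>x. fst (z x)) \<in> borel_measurable m0" "(\<lambda>x. fst (z' x)) \<in> borel_measurable m0"
     "(\<lambda>x. snd (z x)) \<in> borel_measurable m0" "(\<lambda>x. snd (z' x)) \<in> borel_measurable m0"
    using assms(1,2)[THEN continuous_on_fst, THEN borel_measurable_continuous_onI]
      assms(1,2)[THEN continuous_on_snd, THEN borel_measurable_continuous_onI] by (simp_all cong: measurable_cong_sets add: sets_m0)
  have d1: "norm (fst (z x) - fst (z' x)) \<le> d" for x
    using d[of x] norm_fst_le_norm[of "z x - z' x"] by simp
  have d2: "\<bar>snd (z x) - snd (z' x)\<bar> \<le> d" for x
    using d[of x] norm_snd_le_norm[of "z x - z' x"] by simp
  have e: "\<bar>exp (snd (z x)) - exp (snd (z' x))\<bar> \<le> exp B * d" for x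
    by (rule order_trans[OF abs_exp_diff_le[OF B] mult_left_mono[OF d2]]) simp
  have i1: "integrable m0 (\<lambda>x. norm (fst (z x) - fst (z' x)))"
    using d1 by (intro m0.integrable_const_bound[where B = d]) auto
  have i2: "integrable m0 (\<lambda>x. \<bar>exp (snd (z x)) - exp (snd (z' x))\<bar>)"
    using e by (intro m0.integrable_const_bound[where B = "exp B * d"]) auto
  have "prw_dist b (transport m0 z) (transport m0 z') \<le>
    b * (\<integral>x. \<bar>exp (snd (z x)) - exp (snd (z' x))\<bar> \<partial>m0) + exp B * (\<integral>x. norm (fst (z x) - fst (z' x)) \<partial>m0)"
    unfolding transport_def using B i1
    by (intro prw_dist_weighted_push[OF b m0.finite_measure_axioms]) auto
  also have "\<dots> \<le> b * (\<integral>x. exp B * d \<partial>m0) + exp B * (\<integral>x. d \<partial>m0)"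
    using b e d1 i1 i2 by (intro add_mono mult_left_mono integral_mono) auto
  also have "\<dots> = (b + 1) * exp B * total_mass m0 * d"
    by (simp add: total_mass_def algebra_simps)
  finally show ?thesis .
qed

section \<open>The mean-field characteristic flow\<close>

definition clip :: "real \<Rightarrow> real" where "clip t = max 0 (min T t)"

lemma clip_in: "clip t \<in> {0..T}" and clip_bounds: "0 \<le> clip t" "clip t \<le> T" and clip_id: "t \<in> {0..T} \<Longrightarrow> clip t = t"
  and continuous_clip: "continuous_on A clip"
  using T by (auto simp: clip_def intro!: continuous_intros)

text \<open>A Lipschitz constant of the map from states to velocities in the uniform distance.\<close>

definition gain :: real where "gain = L * (1 + (b + 1) * exp (K * T) * total_mass m0)"

text \<open>The exponent of the weighted norm. Any number above \<open>gain\<close> would give a contraction; this choice makes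
  the factor at most \<open>1/2\<close> and stays positive if \<open>gain = 0\<close>.\<close>

definition rate :: real where "rate = 2 * gain + 1"

lemma gain_nonneg: "0 \<le> gain"
  unfolding gain_def using L b by (simp add: total_mass_def)

lemma exp_rate_le: "exp (- rate * clip t) \<le> 1"
proof -
  have "0 \<le> rate * clip t"
    using clip_bounds[of t] gain_nonneg by (intro mult_nonneg_nonneg) (auto simp: rate_def)
  then show ?thesis by simp
qed

text \<open>Instead of a weighted norm on bounded continuous functions the unknown itself is rescaled: \<open>\<xi>\<close> is the
  displacement divided by \<open>exp (rate * t)\<close>. The logarithm of the weight is cut off at \<open>K * T\<close>, so that the
  exponential is Lipschitz on its range; solutions never exceed this bound. Times outside
  \<open>[0, T]\<close> are clipped because \<open>\<xi>\<close> lives on the whole line.\<close>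

definition state :: "((real \<times> 'a) \<Rightarrow>\<^sub>C ('a \<times> real)) \<Rightarrow> real \<Rightarrow> 'a \<Rightarrow> 'a \<times> real" where
  "state \<xi> t x = (x + exp (rate * clip t) *\<^sub>R fst (\<xi> (t, x)), min (K * T) (exp (rate * clip t) * snd (\<xi> (t, x))))"

definition velocity :: "((real \<times> 'a) \<Rightarrow>\<^sub>C ('a \<times> real)) \<Rightarrow> real \<Rightarrow> 'a \<Rightarrow> 'a \<times> real" where
  "velocity \<xi> t x = H t (fst (state \<xi> t x)) (transport m0 (state \<xi> t))"

definition picard_map :: "((real \<times> 'a) \<Rightarrow>\<^sub>C ('a \<times> real)) \<Rightarrow> real \<times> 'a \<Rightarrow> 'a \<times> real" where
  "picard_map \<xi> = (\<lambda>(t, x). exp (- rate * clip t) *\<^sub>R integral {0..clip t} (\<lambda>\<tau>. velocity \<xi> \<tau> x))"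

lemma continuous_state: "continuous_on A (\<lambda>(t, x). state \<xi> t x)"
proof -
  have "continuous_on A (\<lambda>p. \<xi> (fst p, snd p))" by simp
  moreover have "continuous_on A (\<lambda>p. clip (fst p))"
    by (rule continuous_on_compose2[OF continuous_clip[of UNIV]]) (auto intro!: continuous_intros)
  ultimately show ?thesis
    unfolding state_def case_prod_beta by (intro continuous_intros) auto
qed

lemma state_bounds:
  shows "snd (state \<xi> t x) \<le> K * T"
    and "norm (state \<xi> t x - (x, 0)) \<le> 2 * exp (rate * T) * norm \<xi> + K * T"
proof -
  let ?e = "exp (rate * clip t)"
  have "rate * clip t \<le> rate * T"
    using clip_in[of t] gain_nonneg by (intro mult_left_mono) (auto simp: rate_def)
  then have e: "?e \<le> exp (rate * T)" by simp
  have n: "norm (\<xi> (t, x)) \<le> norm \<xi>" by (rule norm_bounded)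
  have n1: "?e * norm (fst (\<xi> (t, x))) \<le> exp (rate * T) * norm \<xi>"
    using norm_fst_le_norm[of "\<xi> (t,x)"] n e by (intro mult_mono) auto
  have n2: "?e * norm (snd (\<xi> (t, x))) \<le> exp (rate * T) * norm \<xi>"
    using norm_snd_le_norm[of "\<xi> (t,x)"] n e by (intro mult_mono) auto
  show "snd (state \<xi> t x) \<le> K * T" by (simp add: state_def)
  have KT: "0 \<le> K * T" using K T by simp
  have "\<bar>min (K * T) (?e * snd (\<xi> (t, x)))\<bar> \<le> K * T + ?e * norm (snd (\<xi> (t, x)))"
    using KT abs_mult[of ?e "snd (\<xi> (t, x))"] by (simp add: min_def)
  moreover have "norm (state \<xi> t x - (x, 0)) \<le> norm (?e *\<^sub>R fst (\<xi> (t, x))) + \<bar>min (K * T) (?e * snd (\<xi> (t, x)))\<bar>"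
    unfolding state_def using norm_Pair_le[of "?e *\<^sub>R fst (\<xi> (t, x))" "min (K * T) (?e * snd (\<xi> (t, x)))"] by simp
  ultimately show "norm (state \<xi> t x - (x, 0)) \<le> 2 * exp (rate * T) * norm \<xi> + K * T"
    using n1 n2 by simp
qed

lemma
  shows transport_state_in: "t \<in> {0..T} \<Longrightarrow> transport m0 (state \<xi> t) \<in> finite_borel_measures"
    and continuous_velocity: "continuous_on ({0..T} \<times> UNIV) (\<lambda>(t, x). velocity \<xi> t x)"
  unfolding velocity_def
  using transport_curve(1,3)[of "state \<xi>", OF continuous_state state_bounds(2) state_bounds(1)] by blast+

lemma velocity_bound: "t \<in> {0..T} \<Longrightarrow> norm (velocity \<xi> t x) \<le> K"
  unfolding velocity_def by (rule coeff_bound[OF bounded _ transport_state_in])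

lemma continuous_velocity_time: "A \<subseteq> {0..T} \<Longrightarrow> continuous_on A (\<lambda>t. velocity \<xi> t x)"
proof -
  assume A: "A \<subseteq> {0..T}"
  have "continuous_on A (\<lambda>t. (\<lambda>(t, x). velocity \<xi> t x) (t, x))"
    by (rule continuous_on_compose2[OF continuous_velocity]) (use A in \<open>auto intro!: continuous_intros\<close>)
  then show ?thesis by simp
qed

lemma norm_integral_velocity: "t \<in> {0..T} \<Longrightarrow> norm (integral {0..t} (\<lambda>\<tau>. velocity \<xi> \<tau> x)) \<le> K * t"
  using integral_bound[of 0 t "\<lambda>\<tau>. velocity \<xi> \<tau> x" K] continuous_velocity_time[of "{0..t}" \<xi> x] velocity_bound
  by auto

lemma picard_map_bcontfun: "picard_map \<xi> \<in> bcontfun"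
proof (rule bcontfun_normI)
  have "continuous_on UNIV (\<lambda>p. (\<lambda>(t, x). integral {0..t} (\<lambda>\<tau>. velocity \<xi> \<tau> x)) (clip (fst p), snd p))"
    by (rule continuous_on_compose2[OF continuous_on_integral_param_upper[OF continuous_velocity]])
       (auto simp: clip_bounds intro!: continuous_intros continuous_on_compose2[OF continuous_clip[of UNIV]])
  moreover have "continuous_on UNIV (\<lambda>p. clip (fst p))" for p :: "real \<times> 'a"
    by (auto intro!: continuous_intros continuous_on_compose2[OF continuous_clip[of UNIV]])
  ultimately show "continuous_on UNIV (picard_map \<xi>)"
    unfolding picard_map_def case_prod_beta
    by (auto intro!: continuous_intros continuous_on_compose2[OF continuous_clip[of UNIV]])
  show "norm (picard_map \<xi> p) \<le> K * T" for p
  proof -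
    have "norm (integral {0..clip t} (\<lambda>\<tau>. velocity \<xi> \<tau> x)) \<le> K * T" for t x
      using norm_integral_velocity[OF clip_in[of t], of \<xi> x] mult_left_mono[of "clip t" T K] clip_in[of t] K by auto
    then have "exp (- rate * clip (fst p)) * norm (integral {0..clip (fst p)} (\<lambda>\<tau>. velocity \<xi> \<tau> (snd p))) \<le> 1 * (K * T)"
      by (intro mult_mono exp_rate_le) auto
    then show ?thesis by (simp add: picard_map_def case_prod_beta)
  qed
qed

lemma dist_velocity:
  assumes t: "t \<in> {0..T}"
  shows "norm (velocity \<xi> t x - velocity \<xi>' t x) \<le> gain * (exp (rate * t) * dist \<xi> \<xi>')"
proof -
  define d where "d = exp (rate * t) * dist \<xi> \<xi>'"
  have st: "norm (state \<xi> t x - state \<xi>' t x) \<le> d" for x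
  proof -
    have m: "\<bar>min k u - min k v\<bar> \<le> \<bar>u - v\<bar>" for k u v :: real by linarith
    have "norm (state \<xi> t x - state \<xi>' t x) \<le> norm (exp (rate * t) *\<^sub>R (\<xi> (t, x) - \<xi>' (t, x)))"
      unfolding norm_prod_def
      using m[of "K*T" "exp (rate * clip t) * snd (\<xi> (t, x))" "exp (rate * clip t) * snd (\<xi>' (t, x))"]
      by (intro real_sqrt_le_mono add_mono power_mono)
         (auto simp: state_def clip_id[OF t] algebra_simps)
    also have "\<dots> \<le> d" unfolding d_def using dist_bounded[of \<xi> "(t,x)" \<xi>']
      by (simp add: dist_norm)
    finally show ?thesis .
  qed
  have cs: "continuous_on UNIV (state \<xi> t)" for \<xi>
  proof -
    have "continuous_on UNIV (\<lambda>x. (\<lambda>(t, x). state \<xi> t x) (t, x))"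
      by (rule continuous_on_compose2[OF continuous_state[of UNIV]]) (auto intro!: continuous_intros)
    then show ?thesis by simp
  qed
  have p: "prw_dist b (transport m0 (state \<xi> t)) (transport m0 (state \<xi>' t)) \<le> (b + 1) * exp (K * T) * total_mass m0 * d"
    by (rule prw_dist_transport[OF cs cs state_bounds(1) state_bounds(1) st])
  have "norm (velocity \<xi> t x - velocity \<xi>' t x) \<le>
      L * (norm (fst (state \<xi> t x) - fst (state \<xi>' t x)) + prw_dist b (transport m0 (state \<xi> t)) (transport m0 (state \<xi>' t)))"
    unfolding velocity_def using lipschitz t transport_state_in[OF t] by (simp add: lipschitz_coeff_def)
  also have "\<dots> \<le> L * (d + (b + 1) * exp (K * T) * total_mass m0 * d)"
    using p order_trans[OF norm_fst_le_norm[of "state \<xi> t x - state \<xi>' t x"] st] L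
    by (intro mult_left_mono add_mono) auto
  also have "\<dots> = gain * d" by (simp add: gain_def algebra_simps)
  finally show ?thesis by (simp add: d_def)
qed

text \<open>Integrating the bound \<open>gain * exp (rate * t)\<close> of the velocities produces the factor
  \<open>gain / rate\<close>, and the exponential cancels against the rescaling.\<close>

lemma picard_map_contraction:
  "dist (Bcontfun (picard_map \<xi>)) (Bcontfun (picard_map \<xi>')) \<le> 1/2 * dist \<xi> \<xi>'"
proof (rule dist_bound)
  fix p :: "real \<times> 'a"
  obtain t x where p: "p = (t, x)" by fastforce
  let ?c = "clip t" and ?d = "dist \<xi> \<xi>'"
  have c: "0 \<le> ?c" "?c \<le> T" using clip_in[of t] by auto
  have r: "rate > 0" using gain_nonneg by (simp add: rate_def)
  have int: "(\<lambda>\<tau>. velocity \<xi> \<tau> x) integrable_on {0..?c}" for \<xi>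
    using c by (intro integrable_continuous_real continuous_velocity_time) auto
  have hi: "((\<lambda>\<tau>. gain * (exp (rate * \<tau>) * ?d)) has_integral (gain * ?d / rate * exp (rate * ?c) - gain * ?d / rate * exp (rate * 0))) {0..?c}"
    using r c by (intro fundamental_theorem_of_calculus)
      (auto intro!: derivative_eq_intros simp flip: has_real_derivative_iff_has_vector_derivative)
  have "norm (integral {0..?c} (\<lambda>\<tau>. velocity \<xi> \<tau> x) - integral {0..?c} (\<lambda>\<tau>. velocity \<xi>' \<tau> x)) =
     norm (integral {0..?c} (\<lambda>\<tau>. velocity \<xi> \<tau> x - velocity \<xi>' \<tau> x))"
    by (simp add: Henstock_Kurzweil_Integration.integral_diff[OF int int])
  also have "\<dots> \<le> integral {0..?c} (\<lambda>\<tau>. gain * (exp (rate * \<tau>) * ?d))"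
    using hi int c by (intro Henstock_Kurzweil_Integration.integral_norm_bound_integral integrable_diff dist_velocity) auto
  also have "\<dots> \<le> gain * ?d / rate * exp (rate * ?c)"
    using integral_unique[OF hi] gain_nonneg r by simp
  also have "\<dots> \<le> 1/2 * ?d * exp (rate * ?c)"
  proof -
    have "gain / rate \<le> 1/2" using gain_nonneg r by (simp add: rate_def field_simps)
    then have "gain / rate * ?d \<le> 1/2 * ?d" by (intro mult_right_mono) auto
    then show ?thesis by (intro mult_right_mono) auto
  qed
  finally have *: "norm (integral {0..?c} (\<lambda>\<tau>. velocity \<xi> \<tau> x) - integral {0..?c} (\<lambda>\<tau>. velocity \<xi>' \<tau> x)) \<le> 1/2 * ?d * exp (rate * ?c)" .
  have "dist (picard_map \<xi> p) (picard_map \<xi>' p) =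
     exp (- rate * ?c) * norm (integral {0..?c} (\<lambda>\<tau>. velocity \<xi> \<tau> x) - integral {0..?c} (\<lambda>\<tau>. velocity \<xi>' \<tau> x))"
    by (simp add: p picard_map_def dist_norm flip: scaleR_diff_right)
  also have "\<dots> \<le> exp (- rate * ?c) * (1/2 * ?d * exp (rate * ?c))"
    using * by (intro mult_left_mono) auto
  also have "\<dots> = 1/2 * ?d" by (simp add: exp_minus field_simps)
  finally show "dist (Bcontfun (picard_map \<xi>) p) (Bcontfun (picard_map \<xi>') p) \<le> 1/2 * ?d"
    by (simp add: Bcontfun_inverse picard_map_bcontfun)
qed

lemma picard_fixed_point: "\<exists>!\<xi>. Bcontfun (picard_map \<xi>) = \<xi>"
  by (rule banach_fix_type[of "1/2"]) (use picard_map_contraction in auto)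

text \<open>The cut-off of the logarithmic weight is inactive at a fixed point, since velocities are bounded by \<open>K\<close>.\<close>

lemma fixed_point_state:
  assumes fp: "Bcontfun (picard_map \<xi>) = \<xi>" and t: "t \<in> {0..T}"
  shows "state \<xi> t x = (x, 0) + integral {0..t} (\<lambda>\<tau>. velocity \<xi> \<tau> x)"
proof -
  define I where "I = integral {0..t} (\<lambda>\<tau>. velocity \<xi> \<tau> x)"
  have "\<xi> (t, x) = picard_map \<xi> (t, x)"
    using Bcontfun_inverse[OF picard_map_bcontfun, of \<xi>] fp by simp
  then have "\<xi> (t, x) = exp (- rate * t) *\<^sub>R I"
    by (simp add: picard_map_def I_def clip_id[OF t])
  then have *: "exp (rate * t) *\<^sub>R \<xi> (t, x) = I" by (simp add: exp_minus)
  have "norm I \<le> K * t" unfolding I_def by (rule norm_integral_velocity[OF t])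
  also have "\<dots> \<le> K * T" using t K by (intro mult_left_mono) auto
  finally have "snd I \<le> K * T" using norm_snd_le_norm[of I] by simp
  then show ?thesis
    unfolding I_def[symmetric] using *[symmetric]
    by (simp add: state_def clip_id[OF t] prod_eq_iff min_def)
qed

theorem characteristic_flow_exists: "\<exists>Z. characteristic_flow T H m0 Z"
proof -
  obtain \<xi> where fp: "Bcontfun (picard_map \<xi>) = \<xi>" using picard_fixed_point by blast
  note st = fixed_point_state[OF fp]
  have "((\<lambda>s. state \<xi> s x) has_vector_derivative velocity \<xi> t x) (at t within {0..T})" if t: "t \<in> {0..T}" for t x
  proof -
    have "((\<lambda>s. (x, 0) + integral {0..s} (\<lambda>\<tau>. velocity \<xi> \<tau> x)) has_vector_derivative velocity \<xi> t x) (at t within {0..T})"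
      using integral_has_vector_derivative[OF continuous_velocity_time[OF order_refl] t, of \<xi> x]
      by (auto intro!: derivative_eq_intros)
    then show ?thesis
      by (rule has_vector_derivative_transform[OF t, rotated]) (simp add: st)
  qed
  moreover have "\<exists>R. \<forall>t\<in>{0..T}. \<forall>x. norm (state \<xi> t x - (x, 0)) \<le> R"
    using state_bounds(2)[of \<xi>] by blast
  moreover have "state \<xi> 0 x = (x, 0)" for x using st[of 0 x] T by simp
  ultimately show ?thesis
    unfolding characteristic_flow_def
    by (intro exI[of _ "state \<xi>"] conjI)
       (auto simp: continuous_state velocity_def)
qed

lemma characteristic_flow_bounds:
  assumes Z: "characteristic_flow T H m0 Z" and t: "t \<in> {0..T}"
  shows "transport m0 (Z t) \<in> finite_borel_measures"
    and "((\<lambda>s. prw_dist b (transport m0 (Z s)) (transport m0 (Z t))) \<longlongrightarrow> 0) (at t within {0..T})"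
    and "continuous_on ({0..T} \<times> UNIV) (\<lambda>(t, x). H t (fst (Z t x)) (transport m0 (Z t)))"
    and "((\<lambda>\<tau>. H \<tau> (fst (Z \<tau> x)) (transport m0 (Z \<tau>))) has_integral Z t x - (x, 0)) {0..t}"
    and "norm (Z t x - (x, 0)) \<le> K * t"
proof -
  obtain R where R: "\<And>t x. t \<in> {0..T} \<Longrightarrow> norm (Z t x - (x, 0)) \<le> R"
    using Z unfolding characteristic_flow_def by blast
  have "snd (Z t x) \<le> R" if "t \<in> {0..T}" for t x
    using norm_snd_le_norm[of "Z t x - (x, 0)"] R[OF that, of x] by simp
  note tc = transport_curve[of Z, OF _ R this]
  have c: "continuous_on ({0..T} \<times> UNIV) (\<lambda>(t, x). Z t x)" using Z unfolding characteristic_flow_def by blast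
  show in_fbm: "transport m0 (Z t) \<in> finite_borel_measures"
    and "((\<lambda>s. prw_dist b (transport m0 (Z s)) (transport m0 (Z t))) \<longlongrightarrow> 0) (at t within {0..T})"
    and cH: "continuous_on ({0..T} \<times> UNIV) (\<lambda>(t, x). H t (fst (Z t x)) (transport m0 (Z t)))"
    using tc[OF c] t by blast+
  have Z0: "Z 0 x = (x, 0)" using Z unfolding characteristic_flow_def by blast
  have "((\<lambda>\<tau>. H \<tau> (fst (Z \<tau> x)) (transport m0 (Z \<tau>))) has_integral Z t x - Z 0 x) {0..t}"
  proof (rule fundamental_theorem_of_calculus)
    show "0 \<le> t" using t by simp
    fix s assume s: "s \<in> {0..t}"
    then have "((\<lambda>s. Z s x) has_vector_derivative H s (fst (Z s x)) (transport m0 (Z s))) (at s within {0..T})"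
      using Z t unfolding characteristic_flow_def by auto
    then show "((\<lambda>s. Z s x) has_vector_derivative H s (fst (Z s x)) (transport m0 (Z s))) (at s within {0..t})"
      by (rule has_vector_derivative_within_subset) (use t in auto)
  qed
  then show hi: "((\<lambda>\<tau>. H \<tau> (fst (Z \<tau> x)) (transport m0 (Z \<tau>))) has_integral Z t x - (x, 0)) {0..t}"
    by (simp add: Z0)
  have "norm (H \<tau> (fst (Z \<tau> x)) (transport m0 (Z \<tau>))) \<le> K" if "\<tau> \<in> {0..t}" for \<tau>
    using that t tc(1)[OF c, of \<tau>] by (intro coeff_bound[OF bounded]) auto
  then show "norm (Z t x - (x, 0)) \<le> K * t"
    using has_integral_bound_real[OF K _ hi, of "{}"] t by auto
qed

text \<open>Every flow, suitably rescaled, is a fixed point of Picard's map, so uniqueness is part of Banach's theorem.\<close>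

theorem characteristic_flow_unique:
  assumes Z: "characteristic_flow T H m0 Z" and Z': "characteristic_flow T H m0 Z'" and t: "t \<in> {0..T}"
  shows "Z t x = Z' t x"
proof -
  have "\<exists>\<xi>. Bcontfun (picard_map \<xi>) = \<xi> \<and> (\<forall>t\<in>{0..T}. \<forall>x. state \<xi> t x = Z t x)"
    if Z: "characteristic_flow T H m0 Z" for Z
  proof -
    define h where "h = (\<lambda>(t, x). exp (- rate * clip t) *\<^sub>R (Z (clip t) x - (x, 0)))"
    have bd: "norm (Z t x - (x, 0)) \<le> K * T" if "t \<in> {0..T}" for t x
      using characteristic_flow_bounds(5)[OF Z that, of x] mult_left_mono[of t T K] K that by auto
    have c: "continuous_on ({0..T} \<times> UNIV) (\<lambda>(t, x). Z t x)" using Z unfolding characteristic_flow_def by blast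
    have hb: "h \<in> bcontfun"
    proof (rule bcontfun_normI)
      have "continuous_on UNIV (\<lambda>p. (\<lambda>(t, x). Z t x) (clip (fst p), snd p))"
        by (rule continuous_on_compose2[OF c])
           (auto simp: clip_bounds intro!: continuous_intros continuous_on_compose2[OF continuous_clip[of UNIV]])
      then show "continuous_on UNIV h"
        unfolding h_def case_prod_beta
        by (auto intro!: continuous_intros continuous_on_compose2[OF continuous_clip[of UNIV]])
      show "norm (h p) \<le> K * T" for p
      proof -
        have "exp (- rate * clip (fst p)) * norm (Z (clip (fst p)) (snd p) - (snd p, 0)) \<le> 1 * (K * T)"
          using bd[OF clip_in] by (intro mult_mono exp_rate_le) auto
        then show ?thesis by (simp add: h_def case_prod_beta)
      qed
    qed
    have st: "state (Bcontfun h) t x = Z t x" if t: "t \<in> {0..T}" for t x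
    proof -
      have "snd (Z t x) \<le> K * T" using norm_snd_le_norm[of "Z t x - (x, 0)"] bd[OF t, of x] by simp
      moreover have "exp (rate * t) *\<^sub>R Bcontfun h (t, x) = Z t x - (x, 0)"
        unfolding Bcontfun_inverse[OF hb] by (simp add: h_def clip_id[OF t] exp_minus)
      then have "exp (rate * t) *\<^sub>R fst (Bcontfun h (t, x)) = fst (Z t x) - x" "exp (rate * t) * snd (Bcontfun h (t, x)) = snd (Z t x)"
        by (simp_all add: prod_eq_iff)
      ultimately show ?thesis by (simp add: state_def clip_id[OF t] prod_eq_iff)
    qed
    have "picard_map (Bcontfun h) = h"
    proof
      fix p :: "real \<times> 'a"
      obtain t x where p: "p = (t, x)" by fastforce
      have "transport m0 (state (Bcontfun h) \<tau>) = transport m0 (Z \<tau>)" if "\<tau> \<in> {0..T}" for \<tau>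
        using st[OF that] by (simp add: transport_def)
      then have "integral {0..clip t} (\<lambda>\<tau>. velocity (Bcontfun h) \<tau> x) =
        integral {0..clip t} (\<lambda>\<tau>. H \<tau> (fst (Z \<tau> x)) (transport m0 (Z \<tau>)))"
        using clip_bounds(2)[of t] by (intro Henstock_Kurzweil_Integration.integral_cong) (auto simp: velocity_def st)
      then show "picard_map (Bcontfun h) p = h p"
        using integral_unique[OF characteristic_flow_bounds(4)[OF Z clip_in[of t], of x]]
        by (simp add: p picard_map_def h_def)
    qed
    then show ?thesis using st by (intro exI[of _ "Bcontfun h"]) simp
  qed
  from this[OF Z] this[OF Z'] picard_fixed_point t show ?thesis by metis
qed

end

section \<open>Flows of linear fields\<close>

text \<open>The equation with the measure frozen along a given curve: a field that depends on time and
  position only.\<close>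

locale linear_field =
  fixes T K L :: real and V :: "real \<Rightarrow> 'a::euclidean_space \<Rightarrow> 'a \<times> real"
  assumes T: "T > 0" and K: "K \<ge> 0" and L: "L \<ge> 0"
    and continuous: "continuous_on ({0..T} \<times> UNIV) (\<lambda>(t, x). V t x)"
    and lipschitz: "\<And>t x y. t \<in> {0..T} \<Longrightarrow> norm (V t x - V t y) \<le> L * norm (x - y)"
    and bounded: "\<And>t x. t \<in> {0..T} \<Longrightarrow> norm (V t x) \<le> K"
begin

definition solves :: "real \<Rightarrow> real \<Rightarrow> (real \<Rightarrow> 'a \<times> real) \<Rightarrow> bool" where
  "solves a c u \<longleftrightarrow> (\<forall>s\<in>{a..c}. (u has_vector_derivative V s (fst (u s))) (at s within {a..c}))"

text \<open>The square of the distance, multiplied by \<open>exp (- 2 L t)\<close>, has a nonpositive derivative. The field sees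
  only the positions, but the distance of the positions is dominated by that of the states.\<close>

lemma gronwall:
  assumes u: "solves a c u" and v: "solves a c v" and ac: "0 \<le> a" "c \<le> T" and s: "s \<in> {a..c}"
  shows "norm (u s - v s) \<le> exp (L * (s - a)) * norm (u a - v a)"
proof (cases "a = s")
  case False
  then have as: "a < s" using s by simp
  define F where "F = (\<lambda>s. exp (- (2 * L) * s) * ((u s - v s) \<bullet> (u s - v s)))"
  have der: "(F has_vector_derivative exp (- (2 * L) * r) * (2 * ((V r (fst (u r)) - V r (fst (v r))) \<bullet> (u r - v r)) - 2 * L * ((u r - v r) \<bullet> (u r - v r)))) (at r within {a..c})"
    if r: "r \<in> {a..c}" for r
  proof -
    have d: "((\<lambda>s. u s - v s) has_vector_derivative V r (fst (u r)) - V r (fst (v r))) (at r within {a..c})"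
      using u v r by (auto simp: solves_def intro!: has_vector_derivative_diff)
    have e: "((\<lambda>s. exp (- (2 * L) * s)) has_vector_derivative exp (- (2 * L) * r) * (- (2 * L))) (at r within {a..c})"
      unfolding has_real_derivative_iff_has_vector_derivative[symmetric]
      by (auto intro!: derivative_eq_intros)
    show ?thesis unfolding F_def
      using has_vector_derivative_mult[OF e bounded_bilinear.has_vector_derivative[OF bounded_bilinear_inner d d]]
      by (rule has_vector_derivative_eq_rhs) (simp add: inner_commute algebra_simps)
  qed
  have neg: "(V r (fst (u r)) - V r (fst (v r))) \<bullet> (u r - v r) \<le> L * ((u r - v r) \<bullet> (u r - v r))" if r: "r \<in> {a..c}" for r
  proof -
    have "(V r (fst (u r)) - V r (fst (v r))) \<bullet> (u r - v r) \<le> norm (V r (fst (u r)) - V r (fst (v r))) * norm (u r - v r)"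
      by (rule norm_cauchy_schwarz)
    also have "\<dots> \<le> (L * norm (u r - v r)) * norm (u r - v r)"
    proof (intro mult_right_mono)
      have "norm (V r (fst (u r)) - V r (fst (v r))) \<le> L * norm (fst (u r - v r))"
        using lipschitz[of r] r ac by auto
      also have "\<dots> \<le> L * norm (u r - v r)" by (rule mult_left_mono[OF norm_fst_le_norm L])
      finally show "norm (V r (fst (u r)) - V r (fst (v r))) \<le> L * norm (u r - v r)" .
    qed auto
    finally show ?thesis by (simp add: dot_square_norm power2_eq_square)
  qed
  have "F s \<le> F a"
  proof (rule DERIV_nonpos_imp_decreasing_open[OF less_imp_le[OF as]])
    fix r assume r: "a < r" "r < s"
    then have "at r within {a..c} = at r" using s by (intro at_within_Icc_at) auto
    then have "DERIV F r :> exp (- (2 * L) * r) * (2 * ((V r (fst (u r)) - V r (fst (v r))) \<bullet> (u r - v r)) - 2 * L * ((u r - v r) \<bullet> (u r - v r)))"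
      using der[of r] r s by (simp add: has_real_derivative_iff_has_vector_derivative)
    moreover have "exp (- (2 * L) * r) * (2 * ((V r (fst (u r)) - V r (fst (v r))) \<bullet> (u r - v r)) - 2 * L * ((u r - v r) \<bullet> (u r - v r))) \<le> 0"
      using neg[of r] r s by (intro mult_nonneg_nonpos) auto
    ultimately show "\<exists>y. DERIV F r :> y \<and> y \<le> 0" by blast
  next
    have "continuous_on {a..c} F" 
      unfolding continuous_on_eq_continuous_within using has_vector_derivative_continuous[OF der] by blast
    then show "continuous_on {a..s} F" by (rule continuous_on_subset) (use s in auto)
  qed
  then have "exp (- (2 * L) * s) * (norm (u s - v s))\<^sup>2 \<le> exp (- (2 * L) * a) * (norm (u a - v a))\<^sup>2"
    by (simp add: F_def dot_square_norm)
  then have "exp (2 * L * s) * (exp (- (2 * L) * s) * (norm (u s - v s))\<^sup>2) \<le> exp (2 * L * s) * (exp (- (2 * L) * a) * (norm (u a - v a))\<^sup>2)"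
    by (intro mult_left_mono) auto
  also have "exp (2 * L * s) * (exp (- (2 * L) * s) * (norm (u s - v s))\<^sup>2) = (norm (u s - v s))\<^sup>2"
    by (simp add: exp_minus)
  also have "exp (2 * L * s) * (exp (- (2 * L) * a) * (norm (u a - v a))\<^sup>2) = (exp (L * (s - a)) * norm (u a - v a))\<^sup>2"
  proof -
    have "exp (2 * L * s) * exp (- (2 * L) * a) = (exp (L * (s - a)))\<^sup>2"
      by (simp only: power2_eq_square mult_exp_exp) (simp add: algebra_simps)
    then show ?thesis by (simp add: power_mult_distrib)
  qed
  finally show ?thesis by (rule power2_le_imp_le) auto
qed simp

text \<open>Starting at time \<open>t\<close> is starting at time \<open>0\<close> with a shifted field. Times beyond \<open>T\<close> are clipped to keep the
  same time horizon.\<close>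

definition shifted :: "real \<Rightarrow> real \<Rightarrow> 'a \<Rightarrow> 'a measure \<Rightarrow> 'a \<times> real" where
  "shifted t \<tau> x m = V (min T (t + \<tau>)) x"

text \<open>The shifted field ignores the measure, so any initial measure will do; the null measure is the simplest.
  This makes existence for linear fields a special case of the mean-field theorem.\<close>

lemma mean_field_shifted:
  assumes t: "t \<in> {0..T}"
  shows "mean_field T 1 K L (shifted t) (null_measure borel)"
proof
  show "(null_measure borel :: 'a measure) \<in> finite_borel_measures"
    by (auto simp: finite_borel_measures_def intro!: finite_measureI)
  show "lipschitz_coeff T 1 L (shifted t)"
    unfolding lipschitz_coeff_def shifted_def
  proof (intro ballI allI)
    fix \<tau> x1 x2 and m1 m2 :: "'a measure" assume "\<tau> \<in> {0..T}"
    then have "norm (V (min T (t + \<tau>)) x1 - V (min T (t + \<tau>)) x2) \<le> L * norm (x1 - x2)"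
      using t by (intro lipschitz) auto
    also have "\<dots> \<le> L * (norm (x1 - x2) + prw_dist 1 m1 m2)" using L by (intro mult_left_mono) auto
    finally show "norm (V (min T (t + \<tau>)) x1 - V (min T (t + \<tau>)) x2) \<le> L * (norm (x1 - x2) + prw_dist 1 m1 m2)" .
  qed
  show "bounded_coeff T K (shifted t)"
    using t bounded by (auto simp: bounded_coeff_def shifted_def)
  have "continuous_on ({0..T} \<times> UNIV) (\<lambda>p. (\<lambda>(t, x). V t x) (min T (t + fst p), snd p))"
    by (rule continuous_on_compose2[OF continuous]) (use t in \<open>auto intro!: continuous_intros\<close>)
  then have c: "continuous_on ({0..T} \<times> UNIV) (\<lambda>p. V (min T (t + fst p)) (snd p))" by simp
  show "continuous_coeff T 1 (shifted t)"
    unfolding continuous_coeff_def shifted_def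
  proof (intro ballI allI impI)
    fix \<tau> x and e :: real assume \<tau>: "\<tau> \<in> {0..T}" and e: "e > 0"
    obtain d where d: "d > 0" "\<And>p. p \<in> {0..T} \<times> UNIV \<Longrightarrow> dist p (\<tau>, x) < d \<Longrightarrow>
        dist (V (min T (t + fst p)) (snd p)) (V (min T (t + \<tau>)) x) < e"
      using c[unfolded continuous_on_iff, rule_format, of "(\<tau>, x)" e] \<tau> e by auto
    have "norm (V (min T (t + \<tau>')) x' - V (min T (t + \<tau>)) x) < e"
      if "\<tau>' \<in> {0..T}" "\<bar>\<tau>' - \<tau>\<bar> < d / 2" "norm (x' - x) < d / 2" for \<tau>' x'
    proof -
      have "dist (\<tau>', x') (\<tau>, x) \<le> \<bar>\<tau>' - \<tau>\<bar> + norm (x' - x)"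
        unfolding dist_norm using norm_Pair_le[of "\<tau>' - \<tau>" "x' - x"] by simp
      then show ?thesis using d(2)[of "(\<tau>', x')"] that by (auto simp: dist_norm)
    qed
    then show "\<exists>d>0. \<forall>t'\<in>{0..T}. \<forall>x'. \<forall>m'\<in>finite_borel_measures.
         \<bar>t' - \<tau>\<bar> < d \<and> norm (x' - x) < d \<and> prw_dist 1 m' m < d \<longrightarrow>
         norm (V (min T (t + t')) x' - V (min T (t + \<tau>)) x) < e" for m :: "'a measure"
      using d(1) by (intro exI[of _ "d / 2"]) auto
  qed
qed (use T K L in auto)

definition flow :: "real \<Rightarrow> real \<Rightarrow> 'a \<Rightarrow> 'a \<times> real" where
  "flow t s z = (SOME Z. characteristic_flow T (shifted t) (null_measure borel) Z) (s - t) z"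

lemma flow_start [simp]: "t \<in> {0..T} \<Longrightarrow> flow t t z = (z, 0)"
  and flow_solves: "t \<in> {0..T} \<Longrightarrow> solves t T (\<lambda>s. flow t s z)"
proof -
  assume t: "t \<in> {0..T}"
  define Z where "Z = (SOME Z. characteristic_flow T (shifted t) (null_measure borel) Z)"
  have Z: "characteristic_flow T (shifted t) (null_measure borel) Z"
    unfolding Z_def using mean_field.characteristic_flow_exists[OF mean_field_shifted[OF t]] by (rule someI_ex)
  show "flow t t z = (z, 0)" unfolding flow_def Z_def[symmetric] using Z by (simp add: characteristic_flow_def)
  have "((\<lambda>s. Z (s - t) z) has_vector_derivative V s (fst (Z (s - t) z))) (at s within {t..T})" if s: "s \<in> {t..T}" for s
  proof -
    have "((\<lambda>s. Z s z) has_vector_derivative shifted t (s - t) (fst (Z (s - t) z)) (transport (null_measure borel) (Z (s - t)))) (at (s - t) within {0..T})"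
      using Z s t by (auto simp: characteristic_flow_def)
    then have "((\<lambda>s. Z s z) has_vector_derivative V s (fst (Z (s - t) z))) (at (s - t) within {0..T})"
      using s by (simp add: shifted_def)
    then have "((\<lambda>s. Z s z) has_vector_derivative V s (fst (Z (s - t) z))) (at (s - t) within ((\<lambda>s. s - t) ` {t..T}))"
      by (rule has_vector_derivative_within_subset) (use t in auto)
    moreover have "((\<lambda>s. s - t) has_vector_derivative 1) (at s within {t..T})"
      by (auto intro!: derivative_eq_intros)
    ultimately show ?thesis
      using vector_diff_chain_within[of "\<lambda>s. s - t" 1 s "{t..T}" "\<lambda>s. Z s z"] by (simp add: comp_def)
  qed
  then show "solves t T (\<lambda>s. flow t s z)" unfolding solves_def flow_def Z_def[symmetric] by simp
qed

lemma solves_subset: "solves a c u \<Longrightarrow> a \<le> a' \<Longrightarrow> c' \<le> c \<Longrightarrow> solves a' c' u"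
  unfolding solves_def by (force intro: has_vector_derivative_within_subset)

lemma flow_lipschitz:
  assumes "t \<in> {0..T}" "s \<in> {t..T}"
  shows "norm (flow t s x - flow t s y) \<le> exp (L * T) * norm (x - y)"
proof -
  have "norm (flow t s x - flow t s y) \<le> exp (L * (s - t)) * norm (flow t t x - flow t t y)"
    using assms by (intro gronwall[OF flow_solves flow_solves]) auto
  also have "\<dots> \<le> exp (L * T) * norm (x - y)"
    using assms L by (intro mult_mono) (auto simp: norm_Pair intro: mult_left_mono)
  finally show ?thesis .
qed

lemma continuous_flow: "t \<in> {0..T} \<Longrightarrow> s \<in> {t..T} \<Longrightarrow> continuous_on UNIV (flow t s)"
  by (rule continuous_on_norm_lipschitz[OF flow_lipschitz])

lemma continuous_flow_joint: "continuous_on ({0..T} \<times> UNIV) (\<lambda>(t, x). flow 0 t x)"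
proof -
  have T0: "0 \<in> {0..T}" using T by simp
  have "characteristic_flow T (shifted 0) (null_measure borel) (SOME Z. characteristic_flow T (shifted 0) (null_measure borel) Z)"
    using mean_field.characteristic_flow_exists[OF mean_field_shifted[OF T0]] by (rule someI_ex)
  then show ?thesis unfolding flow_def characteristic_flow_def by simp
qed

text \<open>The logarithmic weight does not enter the field, so restarting the flow with zero logarithmic weight only
  shifts the second component.\<close>

lemma flow_semigroup:
  assumes t: "t \<in> {0..T}" and r: "r \<in> {t..T}" and s: "s \<in> {r..T}"
  shows "flow t s z = (0, snd (flow t r z)) + flow r s (fst (flow t r z))"
proof -
  let ?v = "\<lambda>s. (0, snd (flow t r z)) + flow r s (fst (flow t r z))"
  have 1: "solves r T (\<lambda>s. flow t s z)"
    by (rule solves_subset[OF flow_solves[OF t]]) (use r in auto)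
  have "r \<in> {0..T}" using t r by auto
  note fr = flow_solves[OF this, of "fst (flow t r z)"] flow_start[OF this]
  have 2: "solves r T ?v"
    using fr(1) by (auto simp: solves_def intro!: derivative_eq_intros)
  have "norm (flow t s z - ?v s) \<le> exp (L * (s - r)) * norm (flow t r z - ?v r)"
    by (rule gronwall[OF 1 2]) (use t r s in auto)
  also have "flow t r z - ?v r = 0" by (simp add: fr(2) prod_eq_iff)
  finally show ?thesis by simp
qed

lemma flow_increment:
  assumes t: "t \<in> {0..T}" and s: "s \<in> {t..T}"
    and near: "\<And>r. r \<in> {t..s} \<Longrightarrow> norm (V r (fst (flow t r z)) - w) \<le> B" and B: "0 \<le> B"
  shows "norm (flow t s z - (z, 0) - (s - t) *\<^sub>R w) \<le> B * (s - t)"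
proof -
  have "((\<lambda>r. V r (fst (flow t r z))) has_integral flow t s z - flow t t z) {t..s}"
    using solves_subset[OF flow_solves[OF t, of z] order_refl, of s] s
    by (intro fundamental_theorem_of_calculus) (auto simp: solves_def)
  then have "((\<lambda>r. V r (fst (flow t r z)) - w) has_integral flow t s z - (z, 0) - (s - t) *\<^sub>R w) {t..s}"
    using has_integral_const_real[of w t s] s t by (auto intro!: has_integral_diff)
  from has_integral_bound_real[OF B _ this, of "{}"] show ?thesis using near s by auto
qed

lemma flow_displacement:
  assumes t: "t \<in> {0..T}" and s: "s \<in> {t..T}"
  shows "norm (flow t s z - (z, 0)) \<le> K * (s - t)"
  using flow_increment[OF t s, of z 0 K] bounded K s t by auto

text \<open>First order expansion of the flow from \<open>z\<close>, but with the velocity taken at a nearby point \<open>x\<close>: the price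
  is \<open>L * \<epsilon>\<close> per unit of time. The commutator estimate rests on this.\<close>

lemma flow_local:
  assumes t: "t \<in> {0..T}" and s: "s \<in> {t..T}"
    and osc: "\<And>r. r \<in> {t..s} \<Longrightarrow> norm (V r x - V t x) \<le> \<omega>" and \<omega>: "0 \<le> \<omega>"
    and z: "norm (z - x) \<le> \<epsilon>"
  shows "norm (flow t s z - (z, 0) - (s - t) *\<^sub>R V t x) \<le> (L * (\<epsilon> + K * (s - t)) + \<omega>) * (s - t)"
proof (rule flow_increment[OF t s])
  have \<epsilon>: "0 \<le> \<epsilon>" using z norm_ge_zero[of "z - x"] by linarith
  show "0 \<le> L * (\<epsilon> + K * (s - t)) + \<omega>" using L K s \<epsilon> \<omega> by (intro add_nonneg_nonneg mult_nonneg_nonneg) auto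
  fix r assume r: "r \<in> {t..s}"
  have "norm (fst (flow t r z) - x) \<le> norm (fst (flow t r z - (z, 0))) + norm (z - x)"
    using norm_triangle_ineq[of "fst (flow t r z) - z" "z - x"] by simp
  also have "\<dots> \<le> K * (s - t) + \<epsilon>"
    using order_trans[OF norm_fst_le_norm flow_displacement[OF t, of r z]] r s z mult_left_mono[of "r - t" "s - t" K] K by auto
  finally have 1: "norm (fst (flow t r z) - x) \<le> \<epsilon> + K * (s - t)" by simp
  have "norm (V r (fst (flow t r z)) - V t x) \<le> norm (V r (fst (flow t r z)) - V r x) + norm (V r x - V t x)"
    using norm_triangle_ineq[of "V r (fst (flow t r z)) - V r x" "V r x - V t x"] by simp
  also have "\<dots> \<le> L * (\<epsilon> + K * (s - t)) + \<omega>"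
    using order_trans[OF lipschitz mult_left_mono[OF 1 L]] osc r t s by (intro add_mono) auto
  finally show "norm (V r (fst (flow t r z)) - V t x) \<le> L * (\<epsilon> + K * (s - t)) + \<omega>" .
qed

end

section \<open>Mollification\<close>

text \<open>A kernel \<open>k\<close> of mass one supported in the ball of radius \<open>\<epsilon>\<close>, with gradient \<open>dk\<close>. The quadratic Taylor
  bound replaces second derivatives; the indicator of a fixed ball makes it integrable.\<close>

locale mollifier =
  fixes \<epsilon> P :: real and k :: "'a::euclidean_space \<Rightarrow> real" and dk :: "'a \<Rightarrow> 'a"
  assumes eps: "0 < \<epsilon>" "\<epsilon> \<le> 1" and P: "0 \<le> P"
    and k_nonneg: "0 \<le> k y" and k_borel [measurable]: "k \<in> borel_measurable borel"
    and dk_borel [measurable]: "dk \<in> borel_measurable borel"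
    and k_integrable: "integrable lborel k" and k_mass: "(\<integral>y. k y \<partial>lborel) = 1"
    and k_support: "\<epsilon> < norm y \<Longrightarrow> k y = 0"
    and dk_bound: "norm (dk y) \<le> P * indicator (cball 0 2) y"
    and taylor: "norm v \<le> 1 \<Longrightarrow> \<bar>k (y + v) - k y - dk y \<bullet> v\<bar> \<le> P * (norm v)\<^sup>2 * indicator (cball 0 2) y"

text \<open>The square of the positive part is the simplest compactly supported profile with Lipschitz derivative.\<close>

lemma positive_part_square_taylor:
  fixes r s :: real
  shows "\<bar>(max 0 s)\<^sup>2 - (max 0 r)\<^sup>2 - 2 * max 0 r * (s - r)\<bar> \<le> (s - r)\<^sup>2"
proof -
  consider "r \<le> 0" "s \<le> 0" | "r \<le> 0" "0 \<le> s" | "0 \<le> r" "0 \<le> s" | "0 \<le> r" "s \<le> 0" by linarith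
  then show ?thesis
  proof cases
    case 2
    then have "\<bar>s\<bar> \<le> \<bar>s - r\<bar>" by simp
    then have "s\<^sup>2 \<le> (s - r)\<^sup>2" by (simp add: abs_le_square_iff)
    then show ?thesis using 2 by (simp add: max_def)
  next
    case 3
    then have "(max 0 s)\<^sup>2 - (max 0 r)\<^sup>2 - 2 * max 0 r * (s - r) = (s - r)\<^sup>2"
      by (simp add: max_def power2_eq_square algebra_simps)
    then show ?thesis by simp
  next
    case 4
    have "(max 0 s)\<^sup>2 - (max 0 r)\<^sup>2 - 2 * max 0 r * (s - r) = r\<^sup>2 - 2 * r * s"
      using 4 by (auto simp: max_def power2_eq_square algebra_simps)
    moreover have "0 \<le> r\<^sup>2 - 2 * r * s" 
      unfolding mult.assoc using 4 mult_nonneg_nonpos[of r s] zero_le_power2[of r] by linarith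
    moreover have "(s - r)\<^sup>2 = r\<^sup>2 - 2 * r * s + s\<^sup>2" by (simp add: power2_eq_square algebra_simps)
    ultimately show ?thesis by simp
  qed (auto simp: max_def)
qed

text \<open>Take \<open>(max 0 (\<epsilon>\<^sup>2 - |y|\<^sup>2))\<^sup>2\<close>, divided by its integral.\<close>

lemma mollifier_exists:
  fixes \<epsilon> :: real
  assumes e: "0 < \<epsilon>" "\<epsilon> \<le> 1"
  shows "\<exists>P k dk. mollifier \<epsilon> P (k :: 'a::euclidean_space \<Rightarrow> real) dk"
proof -
  define h :: "'a \<Rightarrow> real" where "h y = (max 0 (\<epsilon>\<^sup>2 - y \<bullet> y))\<^sup>2" for y
  define dh :: "'a \<Rightarrow> 'a" where "dh y = - (4 * max 0 (\<epsilon>\<^sup>2 - y \<bullet> y)) *\<^sub>R y" for y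
  have e2: "\<epsilon>\<^sup>2 \<le> 1" using e by (simp add: power_le_one)
  have ch: "continuous_on UNIV h" unfolding h_def by (intro continuous_intros)
  have cdh: "continuous_on UNIV dh" unfolding dh_def by (intro continuous_intros)
  have out: "max 0 (\<epsilon>\<^sup>2 - y \<bullet> y) = 0" if "\<epsilon> \<le> norm y" for y :: 'a
    using power_mono[OF that, of 2] e by (simp add: dot_square_norm)
  have rb: "max 0 (\<epsilon>\<^sup>2 - y \<bullet> y) \<le> 1" for y :: 'a using e2 inner_ge_zero[of y] by (simp only: max_def split: if_split) linarith
  \<comment> \<open>With \<open>r = \<epsilon>\<^sup>2 - |y|\<^sup>2\<close> the increment of \<open>r\<close> is at most \<open>5 |v|\<close> in absolute value,
  which contributes \<open>25 |v|\<^sup>2\<close>; its quadratic part contributes another \<open>2 |v|\<^sup>2\<close>.\<close>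
  have T: "\<bar>h (y + v) - h y - dh y \<bullet> v\<bar> \<le> 27 * (norm v)\<^sup>2 * indicator (cball 0 2) y" if v: "norm v \<le> 1" for y v
  proof (cases "norm y \<le> 2")
    case True
    let ?r = "\<epsilon>\<^sup>2 - y \<bullet> y" and ?s = "\<epsilon>\<^sup>2 - (y + v) \<bullet> (y + v)"
    have sr: "?s - ?r = - (2 * (y \<bullet> v) + (norm v)\<^sup>2)"
      by (simp only: power2_norm_eq_inner inner_add_left inner_add_right inner_commute[of v y])
    have "\<bar>2 * (y \<bullet> v) + (norm v)\<^sup>2\<bar> \<le> 5 * norm v"
    proof -
      have "\<bar>y \<bullet> v\<bar> \<le> 2 * norm v"
        using Cauchy_Schwarz_ineq2[of y v] mult_right_mono[OF True, of "norm v"] by simp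
      moreover have "(norm v)\<^sup>2 \<le> norm v" using v by (simp add: power2_eq_square mult_left_le)
      ultimately show ?thesis using zero_le_power2[of "norm v"] by linarith
    qed
    then have "(2 * (y \<bullet> v) + (norm v)\<^sup>2)\<^sup>2 \<le> (5 * norm v)\<^sup>2"
      by (subst power2_le_iff_abs_le) auto
    then have "(?s - ?r)\<^sup>2 \<le> (5 * norm v)\<^sup>2" unfolding sr power2_minus .
    then have 1: "\<bar>(max 0 ?s)\<^sup>2 - (max 0 ?r)\<^sup>2 - 2 * max 0 ?r * (?s - ?r)\<bar> \<le> 25 * (norm v)\<^sup>2"
      using positive_part_square_taylor[of ?s ?r] by (simp add: power_mult_distrib)
    have "h (y + v) - h y - dh y \<bullet> v = ((max 0 ?s)\<^sup>2 - (max 0 ?r)\<^sup>2 - 2 * max 0 ?r * (?s - ?r)) - 2 * max 0 ?r * (norm v)\<^sup>2"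
      unfolding sr h_def dh_def by (simp add: algebra_simps)
    moreover have "0 \<le> 2 * max 0 ?r * (norm v)\<^sup>2" "2 * max 0 ?r * (norm v)\<^sup>2 \<le> 2 * (norm v)\<^sup>2"
      using mult_right_mono[OF rb[of y], of "2 * (norm v)\<^sup>2"] by (simp_all add: ac_simps)
    ultimately have "\<bar>h (y + v) - h y - dh y \<bullet> v\<bar> \<le> 27 * (norm v)\<^sup>2" using 1 by linarith
    then show ?thesis using True by simp
  next
    case False
    then have "norm (y + v) \<ge> 1" "norm y \<ge> 1" using v norm_diff_ineq[of y v] by linarith+
    then have "max 0 (\<epsilon>\<^sup>2 - y \<bullet> y) = 0" "max 0 (\<epsilon>\<^sup>2 - (y + v) \<bullet> (y + v)) = 0" using out e by force+
    then have "h (y + v) = 0" "h y = 0" "dh y = 0" unfolding h_def dh_def by simp_all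
    then show ?thesis by simp
  qed
  have hle: "h y \<le> 1 * indicator (cball 0 1) y" for y
  proof (cases "norm y \<le> 1")
    case True
    then show ?thesis unfolding h_def using rb[of y] by (simp add: power_le_one)
  next
    case False
    then have "max 0 (\<epsilon>\<^sup>2 - y \<bullet> y) = 0" using out e by force
    then show ?thesis unfolding h_def by (simp only: ) simp
  qed
  have h0: "0 \<le> h y" for y by (simp add: h_def)
  have fin: "emeasure lborel (cball (0::'a) r) < \<infinity>" for r by (rule emeasure_bounded_finite) simp
  have ih: "integrable lborel h"
  proof (rule Bochner_Integration.integrable_bound)
    show "integrable lborel (indicat_real (cball (0::'a) 1))" using fin by simp
    show "h \<in> borel_measurable lborel" using borel_measurable_continuous_onI[OF ch] by simp
    show "AE y in lborel. norm (h y) \<le> norm (indicat_real (cball 0 1) y)" using hle h0 by simp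
  qed
  define c where "c = (\<integral>y. h y \<partial>lborel)"
  have c: "c > 0"
  proof -
    have "c \<noteq> 0"
    proof
      assume "c = 0"
      then have "AE y in lborel. h y = 0"
        using integral_nonneg_eq_0_iff_AE[OF ih] h0 by (simp add: c_def)
      then have "emeasure lborel {y. h y \<noteq> 0} = 0"
        using borel_measurable_continuous_onI[OF ch] by (subst (asm) AE_iff_measurable[OF _ refl]) auto
      \<comment> \<open>The profile is positive on a ball, which is not a null set.\<close>
      moreover have "ball 0 \<epsilon> \<subseteq> {y. h y \<noteq> 0}"
      proof
        fix y :: 'a assume "y \<in> ball 0 \<epsilon>"
        then have "(norm y)\<^sup>2 < \<epsilon>\<^sup>2" by (intro power_strict_mono) auto
        then show "y \<in> {y. h y \<noteq> 0}" by (simp add: h_def dot_square_norm)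
      qed
      then have "emeasure lborel (ball (0::'a) \<epsilon>) \<le> emeasure lborel {y. h y \<noteq> 0}"
        using borel_measurable_continuous_onI[OF ch] by (intro emeasure_mono) auto
      ultimately have "emeasure lborel (ball (0::'a) \<epsilon>) = 0" by simp
      then show False using e content_ball_pos[of \<epsilon> "0::'a"] by (simp add: measure_def)
    qed
    moreover have "c \<ge> 0" unfolding c_def using h0 by simp
    ultimately show ?thesis by simp
  qed
  have "mollifier \<epsilon> (27 / c) (\<lambda>y. h y / c) (\<lambda>y. (1 / c) *\<^sub>R dh y)"
  proof
    show "(\<lambda>y. h y / c) \<in> borel_measurable borel" "(\<lambda>y. (1 / c) *\<^sub>R dh y) \<in> borel_measurable borel"
      using borel_measurable_continuous_onI[OF ch] borel_measurable_continuous_onI[OF cdh] by measurable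
    show "integrable lborel (\<lambda>y. h y / c)" using ih by simp
    show "(\<integral>y. h y / c \<partial>lborel) = 1" using c by (simp add: c_def)
    fix y :: 'a
    show "h y / c = 0" if "\<epsilon> < norm y" using out[of y] that unfolding h_def by simp
    have "norm (dh y) \<le> 27 * indicator (cball 0 2) y"
    proof (cases "norm y \<le> 1")
      case True
      have "norm (dh y) = 4 * max 0 (\<epsilon>\<^sup>2 - y \<bullet> y) * norm y" by (simp add: dh_def abs_mult)
      also have "\<dots> \<le> 4 * 1 * 1" using rb[of y] True by (intro mult_mono) auto
      finally show ?thesis using True by simp
    next
      case False
      then have "max 0 (\<epsilon>\<^sup>2 - y \<bullet> y) = 0" using out e by force
      then show ?thesis unfolding dh_def by simp
    qed
    then show "norm ((1 / c) *\<^sub>R dh y) \<le> 27 / c * indicator (cball 0 2) y"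
      using c by (simp add: field_simps)
    fix v :: 'a assume "norm v \<le> 1"
    then have "\<bar>h (y + v) - h y - dh y \<bullet> v\<bar> / c \<le> 27 * (norm v)\<^sup>2 * indicator (cball 0 2) y / c"
      using T c by (intro divide_right_mono) auto
    moreover have "\<bar>h (y + v) / c - h y / c - ((1 / c) *\<^sub>R dh y) \<bullet> v\<bar> = \<bar>h (y + v) - h y - dh y \<bullet> v\<bar> / c"
      using c by (simp add: abs_divide diff_divide_distrib[symmetric] flip: abs_of_pos)
    ultimately show "\<bar>h (y + v) / c - h y / c - ((1 / c) *\<^sub>R dh y) \<bullet> v\<bar> \<le> 27 / c * (norm v)\<^sup>2 * indicator (cball 0 2) y"
      by simp
  qed (use e c h0 in auto)
  then show ?thesis by blast
qed

context mollifier
begin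

lemma k_average:
  assumes [measurable]: "a \<in> borel_measurable borel" and A: "\<And>y. norm y \<le> \<epsilon> \<Longrightarrow> \<bar>a y\<bar> \<le> A"
  shows "integrable lborel (\<lambda>y. k y * a y)" and "\<bar>\<integral>y. k y * a y \<partial>lborel\<bar> \<le> A"
proof -
  have le: "\<bar>k y * a y\<bar> \<le> k y * A" for y
    using A[of y] k_support[of y] k_nonneg[of y] by (cases "norm y \<le> \<epsilon>") (auto simp: abs_mult intro!: mult_left_mono)
  show i: "integrable lborel (\<lambda>y. k y * a y)"
    by (rule Bochner_Integration.integrable_bound[where f = "\<lambda>y. k y * A"])
       (use k_integrable le order_trans[OF le abs_ge_self] in auto)
  have "\<bar>\<integral>y. k y * a y \<partial>lborel\<bar> \<le> (\<integral>y. \<bar>k y * a y\<bar> \<partial>lborel)" by (rule integral_abs_bound)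
  also have "\<dots> \<le> (\<integral>y. k y * A \<partial>lborel)" using i le k_integrable by (intro integral_mono) auto
  finally show "\<bar>\<integral>y. k y * a y \<partial>lborel\<bar> \<le> A" by (simp add: k_mass)
qed

text \<open>A bound for the integral of \<open>|dk|\<close>. No bound is uniform in \<open>\<epsilon>\<close>, so it may multiply only
  quantities that vanish faster than the time step.\<close>

definition Q :: real where "Q = P * measure lborel (cball (0::'a) 2)"

lemma Q_nonneg: "0 \<le> Q" using P by (simp add: Q_def)

lemma integrable_ball2: "integrable lborel (\<lambda>y. c * indicat_real (cball (0::'a) 2) y)"
  using emeasure_bounded_finite[of "cball (0::'a) 2"] by simp

lemma dk_average:
  assumes [measurable]: "a \<in> borel_measurable borel" and A: "\<And>y. \<bar>a y\<bar> \<le> A"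
  shows "integrable lborel (\<lambda>y. a y *\<^sub>R dk y)" and "norm (\<integral>y. a y *\<^sub>R dk y \<partial>lborel) \<le> A * Q"
proof -
  have A0: "0 \<le> A" using A[of 0] by linarith
  have le: "norm (a y *\<^sub>R dk y) \<le> (A * P) * indicator (cball 0 2) y" for y
    using mult_mono[OF A[of y] dk_bound[of y] A0] by (simp add: mult.assoc)
  show i: "integrable lborel (\<lambda>y. a y *\<^sub>R dk y)"
  proof (rule Bochner_Integration.integrable_bound[OF integrable_ball2[of "A * P"]])
    show "AE y in lborel. norm (a y *\<^sub>R dk y) \<le> norm ((A * P) * indicat_real (cball (0::'a) 2) y)"
      unfolding real_norm_def by (intro AE_I2 order_trans[OF le abs_ge_self])
  qed simp
  have "norm (\<integral>y. a y *\<^sub>R dk y \<partial>lborel) \<le> (\<integral>y. norm (a y *\<^sub>R dk y) \<partial>lborel)" by (rule integral_norm_bound)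
  also have "\<dots> \<le> (\<integral>y. (A * P) * indicat_real (cball (0::'a) 2) y \<partial>lborel)"
  proof (rule Bochner_Integration.integral_mono)
    show "integrable lborel (\<lambda>y. norm (a y *\<^sub>R dk y))" using i by (rule integrable_norm)
    show "integrable lborel (\<lambda>y. (A * P) * indicat_real (cball (0::'a) 2) y)" by (rule integrable_ball2)
    show "norm (a y *\<^sub>R dk y) \<le> (A * P) * indicat_real (cball (0::'a) 2) y" for y by (rule le)
  qed
  finally show "norm (\<integral>y. a y *\<^sub>R dk y \<partial>lborel) \<le> A * Q" by (simp add: Q_def mult.assoc)
qed

definition mollify :: "('a \<Rightarrow> real) \<Rightarrow> 'a \<Rightarrow> real" where
  "mollify u x = (\<integral>y. k y * u (x + y) \<partial>lborel)"

definition mollify_grad :: "('a \<Rightarrow> real) \<Rightarrow> 'a \<Rightarrow> 'a" where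
  "mollify_grad u x = - (\<integral>y. u (x + y) *\<^sub>R dk y \<partial>lborel)"

lemma shift_borel: "u \<in> borel_measurable borel \<Longrightarrow> (\<lambda>y. u (x + y :: 'a)) \<in> borel_measurable borel"
  using measurable_compose[of "\<lambda>y. x + y" borel borel u borel] by simp

lemma mollify_bound:
  assumes "u \<in> borel_measurable borel" "\<And>x. \<bar>u x\<bar> \<le> U"
  shows "\<bar>mollify u x\<bar> \<le> U" and "norm (mollify_grad u x) \<le> U * Q"
  unfolding mollify_def mollify_grad_def norm_minus_cancel
  using k_average(2)[OF shift_borel[OF assms(1)], of x U] dk_average(2)[OF shift_borel[OF assms(1)], of x U] assms(2) by auto

lemma mollify_diff:
  assumes u: "u \<in> borel_measurable borel" "\<And>x. \<bar>u x\<bar> \<le> U" and v: "v \<in> borel_measurable borel" "\<And>x. \<bar>v x\<bar> \<le> U"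
  shows "mollify u x - mollify v x' = (\<integral>y. k y * (u (x + y) - v (x' + y)) \<partial>lborel)"
    and "mollify_grad u x - mollify_grad v x' = - (\<integral>y. (u (x + y) - v (x' + y)) *\<^sub>R dk y \<partial>lborel)"
  unfolding mollify_def mollify_grad_def
  using k_average(1)[OF shift_borel[OF u(1)], of x U] k_average(1)[OF shift_borel[OF v(1)], of x' U]
    dk_average(1)[OF shift_borel[OF u(1)], of x U] dk_average(1)[OF shift_borel[OF v(1)], of x' U] u v
  by (simp_all add: right_diff_distrib scaleR_diff_left)

lemma mollify_lipschitz:
  assumes u: "u \<in> borel_measurable borel" "\<And>x. \<bar>u x\<bar> \<le> U" and lip: "\<And>x y. \<bar>u x - u y\<bar> \<le> \<Lambda> * norm (x - y)"
  shows "\<bar>mollify u x - mollify u x'\<bar> \<le> \<Lambda> * norm (x - x')"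
    and "norm (mollify_grad u x - mollify_grad u x') \<le> \<Lambda> * Q * norm (x - x')"
proof -
  have l: "\<bar>u (x + y) - u (x' + y)\<bar> \<le> \<Lambda> * norm (x - x')" for y
    using lip[of "x + y" "x' + y"] by simp
  have m: "(\<lambda>y. u (x + y) - u (x' + y)) \<in> borel_measurable borel" using u(1) by measurable
  show "\<bar>mollify u x - mollify u x'\<bar> \<le> \<Lambda> * norm (x - x')"
    unfolding mollify_diff(1)[OF u u] by (rule k_average(2)[OF m l])
  show "norm (mollify_grad u x - mollify_grad u x') \<le> \<Lambda> * Q * norm (x - x')"
    unfolding mollify_diff(2)[OF u u] norm_minus_cancel using dk_average(2)[OF m l] by (simp add: ac_simps)
qed

lemma mollify_close:
  assumes u: "u \<in> borel_measurable borel" "\<And>x. \<bar>u x\<bar> \<le> U" and lip: "\<And>x y. \<bar>u x - u y\<bar> \<le> \<Lambda> * norm (x - y)" and "0 \<le> \<Lambda>"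
  shows "\<bar>mollify u x - u x\<bar> \<le> \<Lambda> * \<epsilon>"
proof -
  have "mollify u x - u x = (\<integral>y. k y * (u (x + y) - u x) \<partial>lborel)"
    unfolding mollify_def right_diff_distrib
    using k_average(1)[OF shift_borel[OF u(1)], of x U] u(2) k_integrable k_mass by simp
  moreover have "\<bar>u (x + y) - u x\<bar> \<le> \<Lambda> * \<epsilon>" if "norm y \<le> \<epsilon>" for y
    using lip[of "x + y" x] mult_left_mono[OF that \<open>0 \<le> \<Lambda>\<close>] by simp
  moreover have "(\<lambda>y. u (x + y) - u x) \<in> borel_measurable borel" using u(1) by measurable
  ultimately show ?thesis using k_average(2)[of "\<lambda>y. u (x + y) - u x" "\<Lambda> * \<epsilon>"] by simp
qed

text \<open>The derivative falls on the kernel after the translation \<open>z = x + y\<close>.\<close>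

lemma mollify_taylor:
  assumes u[measurable]: "u \<in> borel_measurable borel" and U: "\<And>x. \<bar>u x\<bar> \<le> U" and v: "norm v \<le> 1"
  shows "\<bar>mollify u (x + v) - mollify u x - mollify_grad u x \<bullet> v\<bar> \<le> U * Q * (norm v)\<^sup>2"
proof -
  have U0: "0 \<le> U" using U[of 0] by linarith
  have shift: "(\<integral>y. g (c + y) \<partial>lborel) = (\<integral>y. g y \<partial>lborel)" "integrable lborel (\<lambda>y. g (c + y)) \<longleftrightarrow> integrable lborel g"
    if [measurable]: "g \<in> borel_measurable borel" for g :: "'a \<Rightarrow> real" and c
  proof -
    have c: "(+) c \<in> lborel \<rightarrow>\<^sub>M borel" by simp
    show "(\<integral>y. g (c + y) \<partial>lborel) = (\<integral>y. g y \<partial>lborel)"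
      using integral_distr[OF c that] unfolding lborel_distr_plus by (rule sym)
    show "integrable lborel (\<lambda>y. g (c + y)) \<longleftrightarrow> integrable lborel g"
      using integrable_distr_eq[OF c that] unfolding lborel_distr_plus by (rule sym)
  qed
  have iu: "integrable lborel (\<lambda>y. k y * u (x + y))" for x
    by (rule k_average(1)[where A = U]) (use U in auto)
  have "mollify u (x + v) = (\<integral>y. k (y - v) * u (x + y) \<partial>lborel)"
    unfolding mollify_def using shift(1)[of "\<lambda>y. k (y - v) * u (x + y)" v] by (simp add: ac_simps)
  moreover have "integrable lborel (\<lambda>y. k (y - v) * u (x + y))"
    using iu[of "x + v"] shift(2)[of "\<lambda>y. k (y - v) * u (x + y)" v] by (simp add: ac_simps)
  moreover have idk: "integrable lborel (\<lambda>y. (u (x + y) *\<^sub>R dk y) \<bullet> v)"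
    by (rule integrable_inner_left, rule dk_average(1)[where A = U]) (use U in auto)
  moreover have "mollify_grad u x \<bullet> v = - (\<integral>y. (u (x + y) *\<^sub>R dk y) \<bullet> v \<partial>lborel)"
  proof -
    have "(\<integral>y. (u (x + y) *\<^sub>R dk y) \<bullet> v \<partial>lborel) = (\<integral>y. u (x + y) *\<^sub>R dk y \<partial>lborel) \<bullet> v"
      by (rule integral_inner_left, rule dk_average(1)[where A = U]) (use U in auto)
    then show ?thesis by (simp add: mollify_grad_def)
  qed
  moreover define R where "R y = k (y - v) * u (x + y) - k y * u (x + y) + (u (x + y) *\<^sub>R dk y) \<bullet> v" for y
  ultimately have i: "integrable lborel R"
    and eq: "mollify u (x + v) - mollify u x - mollify_grad u x \<bullet> v = (\<integral>y. R y \<partial>lborel)"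
    unfolding R_def using iu[of x] by (simp_all only: mollify_def[of u x] Bochner_Integration.integral_diff Bochner_Integration.integral_add
        Bochner_Integration.integrable_diff Bochner_Integration.integrable_add)
  have "\<bar>mollify u (x + v) - mollify u x - mollify_grad u x \<bullet> v\<bar> \<le> (\<integral>y. \<bar>R y\<bar> \<partial>lborel)"
    unfolding eq by (rule integral_abs_bound)
  also have "\<dots> \<le> (\<integral>y. U * (P * (norm v)\<^sup>2) * indicat_real (cball (0::'a) 2) y \<partial>lborel)"
  proof (rule Bochner_Integration.integral_mono)
    show "integrable lborel (\<lambda>y. \<bar>R y\<bar>)" using i by (rule integrable_abs)
    show "integrable lborel (\<lambda>y. U * (P * (norm v)\<^sup>2) * indicator (cball (0::'a) 2) y)"
      by (rule integrable_ball2)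
    fix y
    have "R y = u (x + y) * (k (y + - v) - k y - dk y \<bullet> (- v))"
      by (simp add: R_def algebra_simps)
    then have "\<bar>R y\<bar> = \<bar>u (x + y)\<bar> * \<bar>k (y + - v) - k y - dk y \<bullet> (- v)\<bar>" by (simp only: abs_mult)
    also have "\<dots> \<le> U * (P * (norm (- v))\<^sup>2 * indicator (cball 0 2) y)"
      by (rule mult_mono[OF U taylor U0]) (use v in simp_all)
    finally show "\<bar>R y\<bar> \<le> U * (P * (norm v)\<^sup>2) * indicator (cball 0 2) y"
      by (simp add: mult.assoc)
  qed
  also have "\<dots> = U * Q * (norm v)\<^sup>2" by (simp add: Q_def)
  finally show ?thesis .
qed

lemma mollify_has_derivative:
  assumes u: "u \<in> borel_measurable borel" "\<And>x. \<bar>u x\<bar> \<le> U"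
  shows "(mollify u has_derivative (\<lambda>v. mollify_grad u x \<bullet> v)) (at x)"
proof (rule has_derivativeI)
  show "bounded_linear ((\<bullet>) (mollify_grad u x))" by (rule bounded_linear_inner_right)
  have U0: "0 \<le> U" using u(2)[of 0] by linarith
  show "((\<lambda>y. (mollify u y - mollify u x - mollify_grad u x \<bullet> (y - x)) /\<^sub>R norm (y - x)) \<longlongrightarrow> 0) (at x)"
  proof (rule Lim_null_comparison)
    show "((\<lambda>y. U * Q * norm (y - x)) \<longlongrightarrow> 0) (at x)"
      by (intro tendsto_eq_intros) auto
    have "\<forall>\<^sub>F y in at x. dist y x < 1" by (simp add: eventually_at) (metis zero_less_one)
    then show "\<forall>\<^sub>F y in at x. norm ((mollify u y - mollify u x - mollify_grad u x \<bullet> (y - x)) /\<^sub>R norm (y - x)) \<le> U * Q * norm (y - x)"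
    proof eventually_elim
      case (elim y)
      then have "\<bar>mollify u y - mollify u x - mollify_grad u x \<bullet> (y - x)\<bar> \<le> U * Q * (norm (y - x))\<^sup>2"
        using mollify_taylor[OF u, of "y - x" x] by (simp add: dist_norm)
      then show ?case
        by (cases "y = x") (auto simp: field_simps power2_eq_square)
    qed
  qed
qed

lemma mollify_support:
  assumes "\<And>z. R \<le> norm z \<Longrightarrow> u z = 0" and x: "R + 2 \<le> norm x"
  shows "mollify u x = 0" and "mollify_grad u x = 0"
proof -
  have z: "u (x + y) = 0" if "norm y \<le> 2" for y
    using that x norm_diff_ineq[of x y] by (intro assms(1)) linarith
  have 1: "k y * u (x + y) = 0" for y using k_support[of y] eps z[of y] by (cases "norm y \<le> 2") auto
  have 2: "u (x + y) *\<^sub>R dk y = 0" for y using dk_bound[of y] z[of y] by (cases "norm y \<le> 2") auto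
  show "mollify u x = 0" "mollify_grad u x = 0" by (simp_all add: mollify_def mollify_grad_def 1 2)
qed

end

section \<open>The backward evolution of a terminal value\<close>

text \<open>For negative \<open>a\<close> the upper bound follows from \<open>exp a * (1 - a) \<le> 1\<close>.\<close>

lemma abs_exp_minus_linear_le:
  fixes a :: real
  assumes "\<bar>a\<bar> \<le> 1"
  shows "\<bar>exp a - 1 - a\<bar> \<le> a\<^sup>2"
proof -
  have "exp a \<le> 1 + a + a\<^sup>2"
  proof (cases "0 \<le> a")
    case True
    then show ?thesis using exp_bound[of a] assms by simp
  next
    case False
    have "1 - a \<le> exp (- a)" using exp_ge_add_one_self[of "- a"] by simp
    then have "exp a * (1 - a) \<le> exp a * exp (- a)" by (intro mult_left_mono) auto
    then have "exp a * (1 - a) \<le> 1" by (simp add: exp_minus)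
    also have "1 \<le> (1 + a + a\<^sup>2) * (1 - a)"
    proof -
      have "(1 + a + a\<^sup>2) * (1 - a) = 1 - a * a\<^sup>2" by (simp add: algebra_simps power2_eq_square)
      moreover have "a * a\<^sup>2 \<le> 0" using False by (intro mult_nonpos_nonneg) auto
      ultimately show ?thesis by linarith
    qed
    finally show ?thesis using False by (simp add: mult_le_cancel_right)
  qed
  then show ?thesis using exp_ge_add_one_self[of a] by linarith
qed

text \<open>A continuous function whose right difference quotients have upper limits at most \<open>c\<close> grows at most with slope \<open>c\<close>.
  The pairing of a weak solution with its mollified dual function is not known to be differentiable,
  but its right increments can be controlled. If the bound failed for the slope \<open>c + e\<close>, one could step
  beyond the last time at which it holds.\<close>

lemma right_increment_bound:
  fixes A :: "real \<Rightarrow> real"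
  assumes A: "continuous_on {0..s} A" and s: "0 \<le> s"
    and inc: "\<And>t e. 0 \<le> t \<Longrightarrow> t < s \<Longrightarrow> e > 0 \<Longrightarrow> \<exists>d>0. \<forall>r. t < r \<longrightarrow> r < t + d \<longrightarrow> r \<le> s \<longrightarrow> A r - A t \<le> (c + e) * (r - t)"
  shows "A s - A 0 \<le> c * s"
proof -
  have main: "A s - A 0 \<le> (c + e) * s" if e: "e > 0" for e
  proof (rule ccontr)
    define B where "B t = A t - (c + e) * t" for t
    assume "\<not> A s - A 0 \<le> (c + e) * s"
    then have Bs: "B s > B 0" by (simp add: B_def)
    have cB: "continuous_on {0..s} B" unfolding B_def by (intro continuous_intros A)
    define X where "X = {t \<in> {0..s}. B t \<le> B 0}"
    have "closed X" unfolding X_def by (intro continuous_on_closed_Collect_le cB) auto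
    moreover have "X \<noteq> {}" "bdd_above X" using s by (auto simp: X_def intro!: exI[of _ 0])
    ultimately have SX: "Sup X \<in> X" by (intro closed_contains_Sup)
    define t where "t = Sup X"
    have t: "0 \<le> t" "t \<le> s" "B t \<le> B 0" using SX by (auto simp: X_def t_def)
    with Bs have ts: "t < s" by (cases "t = s") auto
    obtain d where d: "d > 0" and D: "\<And>r. t < r \<Longrightarrow> r < t + d \<Longrightarrow> r \<le> s \<Longrightarrow> A r - A t \<le> (c + e) * (r - t)"
      using inc[OF t(1) ts e] by blast
    \<comment> \<open>a time after the last good time \<open>t\<close> that is good as well\<close>
    define r where "r = min s (t + d / 2)"
    have r: "t < r" "r < t + d" "r \<le> s" using ts d by (auto simp: r_def)
    have "B r \<le> B t" using D[OF r] by (simp add: B_def algebra_simps)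
    then have "r \<in> X" using r t by (auto simp: X_def)
    then have "r \<le> t" unfolding t_def using \<open>bdd_above X\<close> by (intro cSup_upper)
    with r show False by simp
  qed
  show ?thesis
  proof (rule field_le_epsilon)
    fix e :: real assume e: "e > 0"
    have "A s - A 0 \<le> (c + e / (s + 1)) * s" using e s by (intro main) auto
    also have "\<dots> = c * s + e * (s / (s + 1))" by (simp add: distrib_right)
    also have "\<dots> \<le> c * s + e" using e s by (intro add_left_mono mult_left_le) auto
    finally show "A s - A 0 \<le> c * s + e" .
  qed
qed

text \<open>Lipschitz functions with compact support determine finite measures, so it is enough to evaluate a
  weak solution at time \<open>s\<close> against such a function \<open>\<psi>\<close>.\<close>

locale terminal_value = linear_field T K L V for T K L :: real and V :: "real \<Rightarrow> 'a::euclidean_space \<Rightarrow> 'a \<times> real" +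
  fixes s U0 \<Lambda>0 R0 :: real and \<psi> :: "'a \<Rightarrow> real"
  assumes s: "s \<in> {0..T}" and nn: "0 \<le> U0" "0 \<le> \<Lambda>0"
    and \<psi>_bound: "\<bar>\<psi> x\<bar> \<le> U0" and \<psi>_lipschitz: "\<bar>\<psi> x - \<psi> y\<bar> \<le> \<Lambda>0 * norm (x - y)"
    and \<psi>_support: "R0 \<le> norm x \<Longrightarrow> \<psi> x = 0"
begin

text \<open>The backward evolution of \<open>\<psi>\<close>: formally the solution of
  \<open>\<partial>\<^sub>t\<phi> + F \<bullet> \<nabla>\<phi> + G \<phi> = 0\<close> with \<open>\<phi> s = \<psi>\<close>, where \<open>F\<close> and \<open>G\<close> are the components of \<open>V\<close>.\<close>

definition \<phi> :: "real \<Rightarrow> 'a \<Rightarrow> real" where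
  "\<phi> t z = exp (snd (flow t s z)) * \<psi> (fst (flow t s z))"

text \<open>Bounds for \<open>\<phi> t\<close>, its Lipschitz constant and the radius of its support that are uniform in \<open>t\<close>.\<close>

definition U where "U = exp (K * T) * U0"
definition \<Lambda> where "\<Lambda> = exp (K * T) * (\<Lambda>0 + U0) * exp (L * T)"
definition R where "R = R0 + K * T"

lemma U_nonneg: "0 \<le> U" and \<Lambda>_nonneg: "0 \<le> \<Lambda>"
  using nn by (simp_all add: U_def \<Lambda>_def)

lemma snd_flow_le: "t \<in> {0..T} \<Longrightarrow> r \<in> {t..T} \<Longrightarrow> \<bar>snd (flow t r z)\<bar> \<le> K * (r - t)"
  using order_trans[OF norm_snd_le_norm flow_displacement[of t r z]] by auto

lemma fst_flow_le: "t \<in> {0..T} \<Longrightarrow> r \<in> {t..T} \<Longrightarrow> norm (fst (flow t r z) - z) \<le> K * (r - t)"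
  using order_trans[OF norm_fst_le_norm flow_displacement[of t r z]] by auto

lemma snd_flow_le': "t \<in> {0..T} \<Longrightarrow> r \<in> {t..T} \<Longrightarrow> snd (flow t r z) \<le> K * T"
  using snd_flow_le[of t r z] mult_left_mono[of "r - t" T K] K by auto

lemma \<phi>_bound: "t \<in> {0..s} \<Longrightarrow> \<bar>\<phi> t z\<bar> \<le> U"
  unfolding \<phi>_def U_def abs_mult using snd_flow_le'[of t s z] s \<psi>_bound nn by (intro mult_mono) auto

lemma \<phi>_lipschitz:
  assumes t: "t \<in> {0..s}"
  shows "\<bar>\<phi> t z - \<phi> t z'\<bar> \<le> \<Lambda> * norm (z - z')"
proof -
  have ts: "t \<in> {0..T}" "s \<in> {t..T}" using t s by auto
  define d where "d = exp (L * T) * norm (z - z')"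
  have fl: "norm (flow t s z - flow t s z') \<le> d" unfolding d_def by (rule flow_lipschitz[OF ts])
  have d1: "norm (fst (flow t s z) - fst (flow t s z')) \<le> d"
    using order_trans[OF norm_fst_le_norm fl] by simp
  have d2: "\<bar>snd (flow t s z) - snd (flow t s z')\<bar> \<le> d"
    using order_trans[OF norm_snd_le_norm fl] by simp
  have "\<phi> t z - \<phi> t z' = exp (snd (flow t s z)) * (\<psi> (fst (flow t s z)) - \<psi> (fst (flow t s z'))) +
     (exp (snd (flow t s z)) - exp (snd (flow t s z'))) * \<psi> (fst (flow t s z'))"
    by (simp add: \<phi>_def algebra_simps)
  also have "\<bar>\<dots>\<bar> \<le> exp (K * T) * (\<Lambda>0 * d) + (exp (K * T) * d) * U0"
  proof (rule order_trans[OF abs_triangle_ineq], unfold abs_mult, intro add_mono mult_mono)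
    show "\<bar>\<psi> (fst (flow t s z)) - \<psi> (fst (flow t s z'))\<bar> \<le> \<Lambda>0 * d"
      using order_trans[OF \<psi>_lipschitz mult_left_mono[OF d1]] nn by simp
    show "\<bar>exp (snd (flow t s z)) - exp (snd (flow t s z'))\<bar> \<le> exp (K * T) * d"
      by (rule order_trans[OF abs_exp_diff_le[OF snd_flow_le'[OF ts] snd_flow_le'[OF ts]] mult_left_mono[OF d2]]) simp
  qed (use snd_flow_le'[OF ts] \<psi>_bound nn in \<open>auto simp: d_def\<close>)
  also have "\<dots> = \<Lambda> * norm (z - z')" by (simp add: \<Lambda>_def d_def algebra_simps)
  finally show ?thesis .
qed

lemma \<phi>_support: 
  assumes t: "t \<in> {0..s}" and z: "R \<le> norm z"
  shows "\<phi> t z = 0"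
proof -
  have ts: "t \<in> {0..T}" "s \<in> {t..T}" using t s by auto
  have "norm z - norm (fst (flow t s z)) \<le> K * (s - t)"
    using order_trans[OF norm_triangle_ineq2 fst_flow_le[OF ts, of z, unfolded norm_minus_commute[of _ z]]] .
  also have "\<dots> \<le> K * T" using ts K by (intro mult_left_mono) auto
  finally show ?thesis using z \<psi>_support[of "fst (flow t s z)"] by (simp add: \<phi>_def R_def)
qed

lemma \<phi>_borel [measurable]:
  assumes t: "t \<in> {0..s}"
  shows "\<phi> t \<in> borel_measurable borel"
  using \<phi>_lipschitz[OF t] by (intro borel_measurable_continuous_onI continuous_on_norm_lipschitz[where c = \<Lambda>]) simp

lemma \<phi>_semigroup:
  assumes t: "t \<in> {0..s}" and r: "r \<in> {t..s}"
  shows "\<phi> t z = exp (snd (flow t r z)) * \<phi> r (fst (flow t r z))"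
proof -
  have "flow t s z = (0, snd (flow t r z)) + flow r s (fst (flow t r z))"
    using t r s by (intro flow_semigroup) auto
  then show ?thesis by (simp add: \<phi>_def exp_add)
qed

lemma \<phi>_time:
  assumes t: "t \<in> {0..s}" and r: "r \<in> {0..s}"
  shows "\<bar>\<phi> t z - \<phi> r z\<bar> \<le> (exp (K * T) * U + \<Lambda>) * K * \<bar>t - r\<bar>"
proof -
  have *: "\<bar>\<phi> t z - \<phi> r z\<bar> \<le> (exp (K * T) * U + \<Lambda>) * K * \<bar>t - r\<bar>" if t: "t \<in> {0..s}" and r: "r \<in> {t..s}" for t r
  proof -
    have tr: "t \<in> {0..T}" "r \<in> {t..T}" and r': "r \<in> {0..s}" using t r s by auto
    let ?a = "snd (flow t r z)" and ?x = "fst (flow t r z)"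
    have "\<phi> t z - \<phi> r z = (exp ?a - exp 0) * \<phi> r ?x + (\<phi> r ?x - \<phi> r z)"
      unfolding \<phi>_semigroup[OF t r] by (simp add: algebra_simps)
    also have "\<bar>\<dots>\<bar> \<le> (exp (K * T) * (K * (r - t))) * U + \<Lambda> * (K * (r - t))"
    proof (rule order_trans[OF abs_triangle_ineq], unfold abs_mult, intro add_mono mult_mono)
      have "\<bar>exp ?a - exp 0\<bar> \<le> exp (K * T) * \<bar>?a - 0\<bar>"
        using snd_flow_le'[OF tr] K T by (intro abs_exp_diff_le) auto
      also have "\<dots> \<le> exp (K * T) * (K * (r - t))" using snd_flow_le[OF tr, of z] by (intro mult_left_mono) auto
      finally show "\<bar>exp ?a - exp 0\<bar> \<le> exp (K * T) * (K * (r - t))" .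
      show "\<bar>\<phi> r ?x - \<phi> r z\<bar> \<le> \<Lambda> * (K * (r - t))"
        by (rule order_trans[OF \<phi>_lipschitz[OF r'] mult_left_mono[OF fst_flow_le[OF tr] \<Lambda>_nonneg]])
    qed (use \<phi>_bound[OF r'] K r in auto)
    also have "\<dots> = (exp (K * T) * U + \<Lambda>) * K * \<bar>t - r\<bar>" using r by (simp add: algebra_simps)
    finally show ?thesis .
  qed
  show ?thesis using *[of t r] *[of r t] t r by (cases "t \<le> r") (auto simp: abs_minus_commute)
qed

end

section \<open>Uniqueness for the linear equation by duality\<close>

text \<open>A weak solution of the linear equation. Only time-independent test functions occur, because the
  dependence of the dual function on time need not be differentiable and is handled by increments.\<close>

locale weak_curve = linear_field T K L V for T K L :: real and V :: "real \<Rightarrow> 'a::euclidean_space \<Rightarrow> 'a \<times> real" +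
  fixes b M :: real and m :: "real \<Rightarrow> 'a measure"
  assumes b: "b > 0" and M: "0 \<le> M"
    and m_in: "t \<in> {0..T} \<Longrightarrow> m t \<in> finite_borel_measures"
    and mass: "t \<in> {0..T} \<Longrightarrow> total_mass (m t) \<le> M"
    and m_continuous: "t \<in> {0..T} \<Longrightarrow> ((\<lambda>r. prw_dist b (m r) (m t)) \<longlongrightarrow> 0) (at t within {0..T})"
    and weak: "\<lbrakk>\<And>x. (u has_derivative (\<lambda>v. du x \<bullet> v)) (at x); continuous_on UNIV du; \<And>x. \<rho> \<le> norm x \<Longrightarrow> u x = 0; r \<in> {0..T}\<rbrakk> \<Longrightarrow>
      (\<integral>x. u x \<partial>m r) - (\<integral>x. u x \<partial>m 0) =
      (LINT \<tau>:{0..r}|lborel. (\<integral>x. du x \<bullet> fst (V \<tau> x) + u x * snd (V \<tau> x) \<partial>m \<tau>))"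
begin

lemma integral_curve_bound:
  assumes t: "t \<in> {0..T}" and h: "h \<in> borel_measurable borel" and B: "\<And>x. \<bar>h x\<bar> \<le> B"
  shows "integrable (m t) h" and "\<bar>\<integral>x. h x \<partial>m t\<bar> \<le> B * M"
proof -
  show i: "integrable (m t) h"
    using integrable_bounded_finite_borel[OF m_in[OF t] h, of B] B by simp
  interpret mt: finite_measure "m t" using finite_borel_measuresD[OF m_in[OF t]] by simp
  have B0: "0 \<le> B" using B[of 0] by linarith
  have "\<bar>\<integral>x. h x \<partial>m t\<bar> \<le> (\<integral>x. \<bar>h x\<bar> \<partial>m t)" by (rule integral_abs_bound)
  also have "\<dots> \<le> (\<integral>x. B \<partial>m t)" using i B by (intro Bochner_Integration.integral_mono) auto
  also have "\<dots> = B * total_mass (m t)" by (simp add: total_mass_def)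
  also have "\<dots> \<le> B * M" using mass[OF t] B0 by (intro mult_left_mono)
  finally show "\<bar>\<integral>x. h x \<partial>m t\<bar> \<le> B * M" .
qed

end

locale duality = terminal_value T K L V s U0 \<Lambda>0 R0 \<psi> + weak_curve T K L V b M m + mollifier \<epsilon> P k dk
  for T K L :: real and V :: "real \<Rightarrow> 'a::euclidean_space \<Rightarrow> 'a \<times> real"
    and s U0 \<Lambda>0 R0 :: real and \<psi> :: "'a \<Rightarrow> real" and b M :: real and m :: "real \<Rightarrow> 'a measure"
    and \<epsilon> P :: real and k :: "'a \<Rightarrow> real" and dk :: "'a \<Rightarrow> 'a"
begin

text \<open>The class of functions to which all \<open>\<phi> t\<close> belong. The moduli of continuity below must be uniform over it,
  because the test function at time \<open>t\<close> is the mollification of \<open>\<phi> r\<close> for a later time \<open>r\<close>.\<close>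

definition admissible :: "('a \<Rightarrow> real) \<Rightarrow> bool" where
  "admissible u \<longleftrightarrow> u \<in> borel_measurable borel \<and> (\<forall>x. \<bar>u x\<bar> \<le> U) \<and>
     (\<forall>x y. \<bar>u x - u y\<bar> \<le> \<Lambda> * norm (x - y)) \<and> (\<forall>x. R \<le> norm x \<longrightarrow> u x = 0)"

lemma admissible_\<phi>: "t \<in> {0..s} \<Longrightarrow> admissible (\<phi> t)"
  unfolding admissible_def using \<phi>_borel \<phi>_bound \<phi>_lipschitz \<phi>_support by blast

text \<open>The integrand of the weak formulation for the test function \<open>mollify u\<close>.\<close>

definition flux :: "('a \<Rightarrow> real) \<Rightarrow> real \<Rightarrow> 'a \<Rightarrow> real" where
  "flux u \<tau> x = mollify_grad u x \<bullet> fst (V \<tau> x) + mollify u x * snd (V \<tau> x)"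

lemma
  assumes u: "admissible u"
  shows admissible_mollify: "\<bar>mollify u x\<bar> \<le> U" "norm (mollify_grad u x) \<le> U * Q"
    "\<bar>mollify u x - mollify u y\<bar> \<le> \<Lambda> * norm (x - y)" "norm (mollify_grad u x - mollify_grad u y) \<le> \<Lambda> * Q * norm (x - y)"
    and admissible_taylor: "norm v \<le> 1 \<Longrightarrow> \<bar>mollify u (x + v) - mollify u x - mollify_grad u x \<bullet> v\<bar> \<le> U * Q * (norm v)\<^sup>2"
    and admissible_derivative: "(mollify u has_derivative (\<lambda>v. mollify_grad u x \<bullet> v)) (at x)"
    and admissible_support: "R + 2 \<le> norm x \<Longrightarrow> mollify u x = 0" "R + 2 \<le> norm x \<Longrightarrow> mollify_grad u x = 0"
    and admissible_close: "\<bar>mollify u x - u x\<bar> \<le> \<Lambda> * \<epsilon>"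
proof -
  have 1: "u \<in> borel_measurable borel" and 2: "\<And>x. \<bar>u x\<bar> \<le> U" and 3: "\<And>x y. \<bar>u x - u y\<bar> \<le> \<Lambda> * norm (x - y)"
    and 4: "\<And>x. R \<le> norm x \<Longrightarrow> u x = 0"
    using u by (auto simp: admissible_def)
  show "\<bar>mollify u x\<bar> \<le> U" "norm (mollify_grad u x) \<le> U * Q" by (rule mollify_bound[OF 1 2])+
  show "\<bar>mollify u x - mollify u y\<bar> \<le> \<Lambda> * norm (x - y)" "norm (mollify_grad u x - mollify_grad u y) \<le> \<Lambda> * Q * norm (x - y)"
    by (rule mollify_lipschitz[OF 1 2 3])+
  show "norm v \<le> 1 \<Longrightarrow> \<bar>mollify u (x + v) - mollify u x - mollify_grad u x \<bullet> v\<bar> \<le> U * Q * (norm v)\<^sup>2"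
    by (rule mollify_taylor[OF 1 2])
  show "(mollify u has_derivative (\<lambda>v. mollify_grad u x \<bullet> v)) (at x)" by (rule mollify_has_derivative[OF 1 2])
  show "R + 2 \<le> norm x \<Longrightarrow> mollify u x = 0" "R + 2 \<le> norm x \<Longrightarrow> mollify_grad u x = 0" by (rule mollify_support[OF 4]; simp)+
  show "\<bar>mollify u x - u x\<bar> \<le> \<Lambda> * \<epsilon>" by (rule mollify_close[OF 1 2 3 \<Lambda>_nonneg])
qed

lemma mollify_borel: "admissible u \<Longrightarrow> mollify u \<in> borel_measurable borel"
  using admissible_mollify(3)[of u] by (intro borel_measurable_continuous_onI continuous_on_norm_lipschitz[where c = \<Lambda>]) auto

lemma flux_bound: "admissible u \<Longrightarrow> \<tau> \<in> {0..T} \<Longrightarrow> \<bar>flux u \<tau> x\<bar> \<le> U * (Q + 1) * K"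
proof -
  assume u: "admissible u" and t: "\<tau> \<in> {0..T}"
  have "norm (fst (V \<tau> x)) \<le> K" "\<bar>snd (V \<tau> x)\<bar> \<le> K"
    using order_trans[OF norm_fst_le_norm bounded[OF t]] order_trans[OF norm_snd_le_norm bounded[OF t]] by auto
  then have "norm (mollify_grad u x) * norm (fst (V \<tau> x)) \<le> U * Q * K" "\<bar>mollify u x\<bar> * \<bar>snd (V \<tau> x)\<bar> \<le> U * K"
    using admissible_mollify(1,2)[OF u, of x] U_nonneg Q_nonneg by (auto intro!: mult_mono)
  then show ?thesis
    using Cauchy_Schwarz_ineq2[of "mollify_grad u x" "fst (V \<tau> x)"]
    unfolding flux_def by (simp add: abs_mult[symmetric] algebra_simps)
qed

lemma flux_diff:
  assumes u: "admissible u" and t: "\<tau> \<in> {0..T}"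
  shows "\<bar>flux u \<tau> x - flux u \<tau>' y\<bar> \<le> \<Lambda> * (Q + 1) * K * norm (x - y) + U * (Q + 1) * norm (V \<tau> x - V \<tau>' y)"
proof -
  have b1: "norm (fst (V \<tau> x)) \<le> K" "\<bar>snd (V \<tau> x)\<bar> \<le> K"
    using order_trans[OF norm_fst_le_norm bounded[OF t]] order_trans[OF norm_snd_le_norm bounded[OF t]] by auto
  have b2: "norm (fst (V \<tau> x) - fst (V \<tau>' y)) \<le> norm (V \<tau> x - V \<tau>' y)" "\<bar>snd (V \<tau> x) - snd (V \<tau>' y)\<bar> \<le> norm (V \<tau> x - V \<tau>' y)"
    using norm_fst_le_norm[of "V \<tau> x - V \<tau>' y"] norm_snd_le_norm[of "V \<tau> x - V \<tau>' y"] by auto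
  note a = admissible_mollify[OF u]
  let ?d = "norm (V \<tau> x - V \<tau>' y)"
  have 1: "\<bar>(mollify_grad u x - mollify_grad u y) \<bullet> fst (V \<tau> x)\<bar> \<le> \<Lambda> * Q * norm (x - y) * K"
    using \<Lambda>_nonneg Q_nonneg by (intro order_trans[OF Cauchy_Schwarz_ineq2] mult_mono a b1) auto
  have 2: "\<bar>mollify_grad u y \<bullet> (fst (V \<tau> x) - fst (V \<tau>' y))\<bar> \<le> U * Q * ?d"
    using U_nonneg Q_nonneg by (intro order_trans[OF Cauchy_Schwarz_ineq2] mult_mono a b2) auto
  have 3: "\<bar>(mollify u x - mollify u y) * snd (V \<tau> x)\<bar> \<le> \<Lambda> * norm (x - y) * K"
    unfolding abs_mult using \<Lambda>_nonneg by (intro mult_mono a b1) auto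
  have 4: "\<bar>mollify u y * (snd (V \<tau> x) - snd (V \<tau>' y))\<bar> \<le> U * ?d"
    unfolding abs_mult using U_nonneg by (intro mult_mono a b2) auto
  have "flux u \<tau> x - flux u \<tau>' y = (mollify_grad u x - mollify_grad u y) \<bullet> fst (V \<tau> x) + mollify_grad u y \<bullet> (fst (V \<tau> x) - fst (V \<tau>' y))
     + (mollify u x - mollify u y) * snd (V \<tau> x) + mollify u y * (snd (V \<tau> x) - snd (V \<tau>' y))"
    by (simp add: flux_def inner_diff_left inner_diff_right algebra_simps)
  then have "\<bar>flux u \<tau> x - flux u \<tau>' y\<bar> \<le> \<Lambda> * Q * norm (x - y) * K + U * Q * ?d + \<Lambda> * norm (x - y) * K + U * ?d"
    using 1 2 3 4 by linarith
  then show ?thesis by (simp add: algebra_simps)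
qed

definition flux_lip where "flux_lip = \<Lambda> * (Q + 1) * K + U * (Q + 1) * L"

lemma flux_lip_nonneg: "0 \<le> flux_lip"
  unfolding flux_lip_def using U_nonneg \<Lambda>_nonneg Q_nonneg K L by simp

lemma flux_lipschitz:
  assumes u: "admissible u" and t: "\<tau> \<in> {0..T}"
  shows "\<bar>flux u \<tau> x - flux u \<tau> y\<bar> \<le> flux_lip * norm (x - y)"
proof -
  have "U * (Q + 1) * norm (V \<tau> x - V \<tau> y) \<le> U * (Q + 1) * (L * norm (x - y))"
    using lipschitz[OF t] U_nonneg Q_nonneg by (intro mult_left_mono) auto
  then show ?thesis using flux_diff[OF u t, of x \<tau> y] by (simp add: flux_lip_def algebra_simps)
qed

lemma flux_borel: "admissible u \<Longrightarrow> \<tau> \<in> {0..T} \<Longrightarrow> flux u \<tau> \<in> borel_measurable borel"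
  using flux_lipschitz[of u \<tau>] by (intro borel_measurable_continuous_onI continuous_on_norm_lipschitz[where c = flux_lip]) auto

lemma flux_support: "admissible u \<Longrightarrow> R + 2 \<le> norm x \<Longrightarrow> flux u \<tau> x = 0"
  by (simp add: flux_def admissible_support)

text \<open>Joint continuity of the field is uniform on compact sets only; this is why compactly supported terminal
  values are used.\<close>

lemma field_modulus:
  assumes t: "t \<in> {0..T}" and e: "e > 0"
  shows "\<exists>d>0. \<forall>\<tau>\<in>{0..T}. \<bar>\<tau> - t\<bar> < d \<longrightarrow> (\<forall>x. norm x \<le> R + 2 \<longrightarrow> norm (V \<tau> x - V t x) \<le> e)"
proof -
  have "uniformly_continuous_on ({0..T} \<times> cball 0 (R + 2)) (\<lambda>(t, x). V t x)"
    by (intro compact_uniformly_continuous continuous_on_subset[OF continuous] compact_Times) auto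
  then obtain d where d: "d > 0" and D: "\<And>p q. p \<in> {0..T} \<times> cball 0 (R + 2) \<Longrightarrow> q \<in> {0..T} \<times> cball 0 (R + 2) \<Longrightarrow>
      dist q p < d \<Longrightarrow> dist (case q of (t, x) \<Rightarrow> V t x) (case p of (t, x) \<Rightarrow> V t x) < e"
    unfolding uniformly_continuous_on_def using e by metis
  have "norm (V \<tau> x - V t x) \<le> e" if "\<tau> \<in> {0..T}" "\<bar>\<tau> - t\<bar> < d" "norm x \<le> R + 2" for \<tau> x
    using D[of "(t, x)" "(\<tau>, x)"] that t by (auto simp: dist_Pair_Pair dist_norm)
  with d show ?thesis by blast
qed

text \<open>Two effects are separated: the change of the measure, which the PRW distance controls because the flux
  is a bounded Lipschitz function, and the change of the field, which is uniformly small on the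
  support of the flux.\<close>

lemma flux_integral_modulus:
  assumes t: "t \<in> {0..T}" and e: "e > 0"
  shows "\<exists>d>0. \<forall>u \<tau>. admissible u \<longrightarrow> \<tau> \<in> {0..T} \<longrightarrow> \<bar>\<tau> - t\<bar> < d \<longrightarrow>
           \<bar>(\<integral>x. flux u \<tau> x \<partial>m \<tau>) - (\<integral>x. flux u t x \<partial>m t)\<bar> \<le> e"
proof -
  \<comment> \<open>\<open>c\<close> multiplies the PRW distance of the measures and \<open>D\<close> the modulus of the field.\<close>
  define c where "c = U * (Q + 1) * K / b + flux_lip"
  define D where "D = U * (Q + 1) * M"
  have c: "0 \<le> c" unfolding c_def using U_nonneg Q_nonneg K b flux_lip_nonneg by simp
  have D: "0 \<le> D" unfolding D_def using U_nonneg Q_nonneg M by simp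
  obtain d1 where d1: "d1 > 0" "\<And>\<tau> x. \<tau> \<in> {0..T} \<Longrightarrow> \<bar>\<tau> - t\<bar> < d1 \<Longrightarrow> norm x \<le> R + 2 \<Longrightarrow> norm (V \<tau> x - V t x) \<le> e / 2 / (D + 1)"
    using field_modulus[OF t, of "e / 2 / (D + 1)"] e D by auto
  have "\<forall>\<^sub>F r in at t within {0..T}. dist (prw_dist b (m r) (m t)) 0 < e / 2 / (c + 1)"
    using m_continuous[OF t] e c by (intro tendstoD) auto
  then obtain d2 where d2: "d2 > 0" and d2': "\<And>\<tau>. \<tau> \<in> {0..T} \<Longrightarrow> \<tau> \<noteq> t \<Longrightarrow> dist \<tau> t < d2 \<Longrightarrow> dist (prw_dist b (m \<tau>) (m t)) 0 < e / 2 / (c + 1)"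
    unfolding eventually_at by blast
  have prw: "prw_dist b (m \<tau>) (m t) \<le> e / 2 / (c + 1)" if "\<tau> \<in> {0..T}" "\<bar>\<tau> - t\<bar> < d2" for \<tau>
    using d2'[OF that(1)] that prw_dist_self[OF b m_in[OF t]] e c by (cases "\<tau> = t") (auto simp: dist_real_def)
  have "\<bar>(\<integral>x. flux u \<tau> x \<partial>m \<tau>) - (\<integral>x. flux u t x \<partial>m t)\<bar> \<le> e"
    if u: "admissible u" and \<tau>: "\<tau> \<in> {0..T}" "\<bar>\<tau> - t\<bar> < min d1 d2" for u \<tau>
  proof -
    note fb = flux_bound[OF u \<tau>(1)] flux_bound[OF u t] and fm = flux_borel[OF u \<tau>(1)] flux_borel[OF u t]
    have "\<bar>(\<integral>x. flux u \<tau> x \<partial>m \<tau>) - (\<integral>x. flux u \<tau> x \<partial>m t)\<bar> \<le> c * prw_dist b (m \<tau>) (m t)"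
      unfolding c_def by (rule prw_dist_test_function[OF b m_in[OF \<tau>(1)] m_in[OF t] fb(1) flux_lipschitz[OF u \<tau>(1)] flux_lip_nonneg fm(1)])
    also have "\<dots> \<le> c * (e / 2 / (c + 1))" using prw \<tau> c by (intro mult_left_mono) auto
    also have "\<dots> = e / 2 * (c / (c + 1))" by simp
    also have "\<dots> \<le> e / 2" using c e by (intro mult_left_le) auto
    finally have 1: "\<bar>(\<integral>x. flux u \<tau> x \<partial>m \<tau>) - (\<integral>x. flux u \<tau> x \<partial>m t)\<bar> \<le> e / 2" .
    have "\<bar>flux u \<tau> x - flux u t x\<bar> \<le> U * (Q + 1) * (e / 2 / (D + 1))" for x
    proof (cases "norm x \<le> R + 2")
      case True
      have "U * (Q + 1) * norm (V \<tau> x - V t x) \<le> U * (Q + 1) * (e / 2 / (D + 1))"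
        using d1(2)[OF \<tau>(1) _ True] \<tau> U_nonneg Q_nonneg by (intro mult_left_mono) auto
      then show ?thesis using flux_diff[OF u \<tau>(1), of x t x] by simp
    next
      case False
      then have "flux u \<tau> x = 0" "flux u t x = 0" by (simp_all add: flux_support[OF u])
      moreover have "0 \<le> U * (Q + 1) * (e / 2 / (D + 1))" using U_nonneg Q_nonneg e D by simp
      ultimately show ?thesis by simp
    qed
    from integral_curve_bound(2)[OF t _ this]
    have "\<bar>\<integral>x. flux u \<tau> x - flux u t x \<partial>m t\<bar> \<le> U * (Q + 1) * (e / 2 / (D + 1)) * M"
      using fm by measurable
    also have "(\<integral>x. flux u \<tau> x - flux u t x \<partial>m t) = (\<integral>x. flux u \<tau> x \<partial>m t) - (\<integral>x. flux u t x \<partial>m t)"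
      by (rule Bochner_Integration.integral_diff; rule integral_curve_bound(1)[OF t]; fact)
    also have "U * (Q + 1) * (e / 2 / (D + 1)) * M = e / 2 * (D / (D + 1))" by (simp add: D_def)
    also have "\<dots> \<le> e / 2" using D e by (intro mult_left_le) auto
    finally show ?thesis using 1 by linarith
  qed
  with d1 d2 show ?thesis by (intro exI[of _ "min d1 d2"]) auto
qed

lemma flux_integral_continuous:
  assumes u: "admissible u"
  shows "continuous_on {0..T} (\<lambda>\<tau>. \<integral>x. flux u \<tau> x \<partial>m \<tau>)"
  unfolding continuous_on_iff
proof (intro ballI allI impI)
  fix t e :: real assume t: "t \<in> {0..T}" and e: "e > 0"
  show "\<exists>d>0. \<forall>\<tau>\<in>{0..T}. dist \<tau> t < d \<longrightarrow> dist (\<integral>x. flux u \<tau> x \<partial>m \<tau>) (\<integral>x. flux u t x \<partial>m t) < e"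
    using flux_integral_modulus[OF t, of "e / 2"] u e by (fastforce simp: dist_real_def)
qed

text \<open>The integral in the weak formulation is a Lebesgue integral over \<open>{0..r}\<close>; since its integrand
  is continuous in time, it can be split as a Henstock--Kurzweil integral.\<close>

lemma mollify_increment:
  assumes u: "admissible u" and t: "0 \<le> t" "t \<le> r" "r \<le> T"
  shows "(\<integral>x. mollify u x \<partial>m r) - (\<integral>x. mollify u x \<partial>m t) = integral {t..r} (\<lambda>\<tau>. \<integral>x. flux u \<tau> x \<partial>m \<tau>)"
proof -
  let ?c = "\<lambda>\<tau>. \<integral>x. flux u \<tau> x \<partial>m \<tau>"
  have w: "(\<integral>x. mollify u x \<partial>m r) - (\<integral>x. mollify u x \<partial>m 0) = integral {0..r} ?c" if r: "r \<in> {0..T}" for r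
  proof -
    have "continuous_on UNIV (mollify_grad u)"
      using admissible_mollify(4)[OF u] by (rule continuous_on_norm_lipschitz)
    then have "(\<integral>x. mollify u x \<partial>m r) - (\<integral>x. mollify u x \<partial>m 0) = (LINT \<tau>:{0..r}|lborel. ?c \<tau>)"
      unfolding flux_def by (intro weak[OF admissible_derivative[OF u] _ admissible_support(1)[OF u] r])
    also have "\<dots> = integral {0..r} ?c"
    proof (rule set_borel_integral_eq_integral(2))
      have "continuous_on {0..r} ?c" using r by (intro continuous_on_subset[OF flux_integral_continuous[OF u]]) auto
      then show "set_integrable lborel {0..r} ?c" unfolding set_integrable_def by (intro borel_integrable_compact) auto
    qed
    finally show ?thesis .
  qed
  have "?c integrable_on {0..r}"
    using t by (intro integrable_continuous_real continuous_on_subset[OF flux_integral_continuous[OF u]]) auto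
  then have "integral {0..t} ?c + integral {t..r} ?c = integral {0..r} ?c"
    using t by (intro Henstock_Kurzweil_Integration.integral_combine) auto
  then show ?thesis using w[of r] w[of t] t by simp
qed

text \<open>The generator cancels the backward evolution up to the commutator of the mollification
  with the Lipschitz field, which costs \<open>L * \<epsilon>\<close> per unit of time.\<close>

lemma mollify_step:
  assumes t: "t \<in> {0..s}" and r: "r \<in> {t..s}" and h: "h = r - t" and Kh: "K * h \<le> 1" and \<omega>: "0 \<le> \<omega>"
    and osc: "\<And>\<sigma> x. \<sigma> \<in> {t..r} \<Longrightarrow> norm x \<le> R + 2 \<Longrightarrow> norm (V \<sigma> x - V t x) \<le> \<omega>"
  shows "\<bar>h * flux (\<phi> r) t x + mollify (\<phi> r) x - mollify (\<phi> t) x\<bar> \<le>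
    h * ((\<Lambda> + U) * (L * (\<epsilon> + K * h) + \<omega>) + (\<Lambda> + U + U * Q) * (K\<^sup>2 * h))"
proof (cases "norm x \<le> R + 2")
  case False
  then have "flux (\<phi> r) t x = 0" "mollify (\<phi> r) x = 0" "mollify (\<phi> t) x = 0"
    using t r by (simp_all add: flux_support admissible_support(1) admissible_\<phi>)
  moreover have "0 \<le> h * ((\<Lambda> + U) * (L * (\<epsilon> + K * h) + \<omega>) + (\<Lambda> + U + U * Q) * (K\<^sup>2 * h))"
    using U_nonneg \<Lambda>_nonneg Q_nonneg L K \<omega> eps h r
    by (intro mult_nonneg_nonneg add_nonneg_nonneg) auto
  ultimately show ?thesis by simp
next
  case x: True
  have tr: "t \<in> {0..T}" "r \<in> {t..T}" and r': "r \<in> {0..s}" and h0: "0 \<le> h" using t r s h by auto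
  let ?u = "\<phi> r"
  define w F G where "w = V t x" and "F = fst w" and "G = snd w"
  define B where "B = L * (\<epsilon> + K * h) + \<omega>"
  have B0: "0 \<le> B" unfolding B_def using L K \<omega> eps h0 by simp
  have FG: "norm F \<le> K" "\<bar>G\<bar> \<le> K"
    unfolding F_def G_def w_def
    using order_trans[OF norm_fst_le_norm bounded[OF tr(1)]] order_trans[OF norm_snd_le_norm bounded[OF tr(1)]] by auto
  \<comment> \<open>The quantity to be estimated is, up to a Taylor remainder, the average of \<open>D\<close> over the kernel.\<close>
  define D where "D y = h * G * ?u (x + y) + ?u (x + h *\<^sub>R F + y) - \<phi> t (x + y)" for y
  have Dbound: "\<bar>D y\<bar> \<le> h * ((\<Lambda> + U) * B + (\<Lambda> + U) * (K\<^sup>2 * h))" if y: "norm y \<le> \<epsilon>" for y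
  proof -
    define z where "z = x + y"
    define X where "X = fst (flow t r z)"
    define a where "a = snd (flow t r z)"
    have loc: "norm (flow t r z - (z, 0) - h *\<^sub>R w) \<le> B * h"
      unfolding B_def h w_def using osc[OF _ x] y \<omega> by (intro flow_local[OF tr]) (auto simp: z_def)
    have lX: "norm (X - z - h *\<^sub>R F) \<le> B * h"
      using order_trans[OF norm_fst_le_norm loc] by (simp add: X_def F_def)
    have la: "\<bar>a - h * G\<bar> \<le> B * h"
      using order_trans[OF norm_snd_le_norm loc] by (simp add: a_def G_def)
    have aK: "\<bar>a\<bar> \<le> K * h" unfolding a_def h by (rule snd_flow_le[OF tr])
    have XK: "norm (X - z) \<le> K * h" unfolding X_def h by (rule fst_flow_le[OF tr])
    have "\<bar>exp a - 1 - a\<bar> \<le> a\<^sup>2" using aK Kh by (intro abs_exp_minus_linear_le) auto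
    also have "a\<^sup>2 \<le> (K * h)\<^sup>2" using aK K h0 by (subst power2_le_iff_abs_le) auto
    finally have ea: "\<bar>1 + h * G - exp a\<bar> \<le> B * h + (K * h)\<^sup>2" using la by linarith
    have 1: "\<bar>?u (z + h *\<^sub>R F) - ?u X\<bar> \<le> \<Lambda> * (B * h)"
      using order_trans[OF \<phi>_lipschitz[OF r'] mult_left_mono[OF _ \<Lambda>_nonneg]] lX
      by (metis (no_types, lifting) add_diff_eq diff_diff_eq diff_diff_eq2 norm_minus_commute)
    have 2: "\<bar>(1 + h * G - exp a) * ?u X\<bar> \<le> (B * h + (K * h)\<^sup>2) * U"
      unfolding abs_mult using ea \<phi>_bound[OF r'] B0 h0 by (intro mult_mono) auto
    have "\<bar>h * G\<bar> * \<bar>?u z - ?u X\<bar> \<le> (h * K) * (\<Lambda> * (K * h))"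
    proof (intro mult_mono)
      show "\<bar>h * G\<bar> \<le> h * K" unfolding abs_mult using FG h0 by (intro mult_mono) auto
      show "\<bar>?u z - ?u X\<bar> \<le> \<Lambda> * (K * h)"
        using order_trans[OF \<phi>_lipschitz[OF r'] mult_left_mono[OF XK \<Lambda>_nonneg]] by (subst abs_minus_commute)
    qed (use h0 K in auto)
    then have 3: "\<bar>h * G * (?u z - ?u X)\<bar> \<le> (h * K) * (\<Lambda> * (K * h))" by (simp only: abs_mult)
    \<comment> \<open>Compare the end point \<open>X\<close> of the characteristic with the Euler step \<open>z + h F\<close>, and the weight
    \<open>exp a\<close> with \<open>1 + h G\<close>; the last term is of second order in \<open>h\<close>.\<close>
    have "D y = (?u (z + h *\<^sub>R F) - ?u X) + (1 + h * G - exp a) * ?u X + h * G * (?u z - ?u X)"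
    proof -
      have "\<phi> t (x + y) = exp a * ?u X" unfolding a_def X_def z_def by (rule \<phi>_semigroup[OF t r])
      then show ?thesis by (simp add: D_def z_def algebra_simps)
    qed
    then have "\<bar>D y\<bar> \<le> \<Lambda> * (B * h) + (B * h + (K * h)\<^sup>2) * U + (h * K) * (\<Lambda> * (K * h))"
      using 1 2 3 by linarith
    then show ?thesis by (simp add: algebra_simps power2_eq_square)
  qed
  have um: "?u \<in> borel_measurable borel" "\<phi> t \<in> borel_measurable borel" using \<phi>_borel r' t by auto
  have iu: "integrable lborel (\<lambda>y. k y * ?u (x' + y))" for x'
    by (rule k_average(1)[OF shift_borel[OF um(1)], where A = U]) (rule \<phi>_bound[OF r'])
  have it: "integrable lborel (\<lambda>y. k y * \<phi> t (x + y))"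
    by (rule k_average(1)[OF shift_borel[OF um(2)], where A = U]) (rule \<phi>_bound[OF t])
  have "h * G * mollify ?u x + mollify ?u (x + h *\<^sub>R F) - mollify (\<phi> t) x =
     (\<integral>y. h * G * (k y * ?u (x + y)) + k y * ?u (x + h *\<^sub>R F + y) - k y * \<phi> t (x + y) \<partial>lborel)"
    using iu[of x] iu[of "x + h *\<^sub>R F"] it by (simp add: mollify_def)
  also have "\<dots> = (\<integral>y. k y * D y \<partial>lborel)"
    by (rule Bochner_Integration.integral_cong) (simp_all add: D_def algebra_simps)
  finally have eq: "h * G * mollify ?u x + mollify ?u (x + h *\<^sub>R F) - mollify (\<phi> t) x = (\<integral>y. k y * D y \<partial>lborel)" .
  have "D \<in> borel_measurable borel"
    unfolding D_def
    by (intro borel_measurable_add borel_measurable_diff borel_measurable_times borel_measurable_const shift_borel um)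
  from k_average(2)[OF this Dbound]
  have 1: "\<bar>h * G * mollify ?u x + mollify ?u (x + h *\<^sub>R F) - mollify (\<phi> t) x\<bar> \<le> h * ((\<Lambda> + U) * B + (\<Lambda> + U) * (K\<^sup>2 * h))"
    unfolding eq .
  have hF: "norm (h *\<^sub>R F) \<le> K * h" using mult_left_mono[OF FG(1) h0] h0 by (simp add: mult.commute)
  have "\<bar>mollify ?u (x + h *\<^sub>R F) - mollify ?u x - mollify_grad ?u x \<bullet> (h *\<^sub>R F)\<bar> \<le> U * Q * (norm (h *\<^sub>R F))\<^sup>2"
    using hF Kh by (intro admissible_taylor[OF admissible_\<phi>[OF r']]) auto
  also have "\<dots> \<le> U * Q * (K * h)\<^sup>2"
    using hF U_nonneg Q_nonneg by (intro mult_left_mono power_mono) auto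
  finally have 2: "\<bar>mollify ?u (x + h *\<^sub>R F) - mollify ?u x - mollify_grad ?u x \<bullet> (h *\<^sub>R F)\<bar> \<le> U * Q * (K * h)\<^sup>2" .
  have "h * flux ?u t x + mollify ?u x - mollify (\<phi> t) x =
    (h * G * mollify ?u x + mollify ?u (x + h *\<^sub>R F) - mollify (\<phi> t) x) -
    (mollify ?u (x + h *\<^sub>R F) - mollify ?u x - mollify_grad ?u x \<bullet> (h *\<^sub>R F))"
    by (simp add: flux_def F_def G_def w_def algebra_simps)
  then have "\<bar>h * flux ?u t x + mollify ?u x - mollify (\<phi> t) x\<bar> \<le> h * ((\<Lambda> + U) * B + (\<Lambda> + U) * (K\<^sup>2 * h)) + U * Q * (K * h)\<^sup>2"
    using 1 2 by linarith
  then show ?thesis unfolding B_def by (simp add: algebra_simps power2_eq_square)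
qed

text \<open>Formally constant in \<open>t\<close> for the exact dual function; with the mollified one it drifts slowly.\<close>

definition pairing :: "real \<Rightarrow> real" where
  "pairing t = (\<integral>x. mollify (\<phi> t) x \<partial>m t)"

lemma mollify_\<phi>_integrable: "r \<in> {0..s} \<Longrightarrow> t \<in> {0..T} \<Longrightarrow> integrable (m t) (mollify (\<phi> r))"
  using integral_curve_bound(1)[of t "mollify (\<phi> r)" U] admissible_mollify(1)[OF admissible_\<phi>] mollify_borel[OF admissible_\<phi>] by auto

text \<open>The increment is split into the effect of moving the measure with the test function of time \<open>r\<close> fixed,
  given by the weak formulation, and the effect of moving the test function with the measure of time \<open>t\<close>
  fixed. Up to \<open>o(r - t)\<close> their sum is the integral of the commutator of \<open>mollify_step\<close>.\<close>

lemma pairing_increment: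
  assumes t: "0 \<le> t" "t < s" and e: "e > 0"
  shows "\<exists>d>0. \<forall>r. t < r \<longrightarrow> r < t + d \<longrightarrow> r \<le> s \<longrightarrow> \<bar>pairing r - pairing t\<bar> \<le> (M * (\<Lambda> + U) * L * \<epsilon> + e) * (r - t)"
proof -
  have tT: "t \<in> {0..T}" and ts: "t \<in> {0..s}" using t s by auto
  define E where "E = M * ((\<Lambda> + U) * L * K + (\<Lambda> + U + U * Q) * K\<^sup>2)"
  define N where "N = M * (\<Lambda> + U)"
  have E0: "0 \<le> E" unfolding E_def using U_nonneg \<Lambda>_nonneg Q_nonneg L K M by simp
  have N0: "0 \<le> N" unfolding N_def using U_nonneg \<Lambda>_nonneg M by simp
  define \<omega> where "\<omega> = e / 4 / (N + 1)"
  have \<omega>: "\<omega> > 0" using e N0 by (simp add: \<omega>_def)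
  obtain d1 where d1: "d1 > 0" "\<And>u \<tau>. admissible u \<Longrightarrow> \<tau> \<in> {0..T} \<Longrightarrow> \<bar>\<tau> - t\<bar> < d1 \<Longrightarrow>
      \<bar>(\<integral>x. flux u \<tau> x \<partial>m \<tau>) - (\<integral>x. flux u t x \<partial>m t)\<bar> \<le> e / 2"
    using flux_integral_modulus[OF tT, of "e / 2"] e by auto
  obtain d2 where d2: "d2 > 0" "\<And>\<tau> x. \<tau> \<in> {0..T} \<Longrightarrow> \<bar>\<tau> - t\<bar> < d2 \<Longrightarrow> norm x \<le> R + 2 \<Longrightarrow> norm (V \<tau> x - V t x) \<le> \<omega>"
    using field_modulus[OF tT \<omega>] by auto
  \<comment> \<open>The last two terms ensure \<open>K * h \<le> 1\<close> and \<open>E * h \<le> e / 4\<close> for steps \<open>h < d\<close>.\<close>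
  define d where "d = min (min d1 d2) (min (1 / (K + 1)) (e / 4 / (E + 1)))"
  have d: "d > 0" unfolding d_def using d1 d2 K E0 e by simp
  have "\<bar>pairing r - pairing t\<bar> \<le> (M * (\<Lambda> + U) * L * \<epsilon> + e) * (r - t)"
    if r: "t < r" "r < t + d" "r \<le> s" for r
  proof -
    define h where "h = r - t"
    have h: "0 < h" "h < d1" "h < d2" "h < 1 / (K + 1)" "h < e / 4 / (E + 1)"
      using r by (auto simp: h_def d_def)
    have rs: "r \<in> {0..s}" "r \<in> {t..s}" and rT: "r \<in> {0..T}" "r \<le> T" using r t s by auto
    have "K * h \<le> K * (1 / (K + 1))" using h K by (intro mult_left_mono) auto
    also have "\<dots> \<le> 1" using K by (simp add: field_simps)
    finally have Kh: "K * h \<le> 1" .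
    have Eh: "E * h \<le> e / 4"
    proof -
      have "E * h \<le> E * (e / 4 / (E + 1))" using h E0 by (intro mult_left_mono) auto
      also have "\<dots> = e / 4 * (E / (E + 1))" by simp
      also have "\<dots> \<le> e / 4" using E0 e by (intro mult_left_le) auto
      finally show ?thesis .
    qed
    have N\<omega>: "N * \<omega> \<le> e / 4"
    proof -
      have "N * \<omega> = e / 4 * (N / (N + 1))" by (simp add: \<omega>_def)
      also have "\<dots> \<le> e / 4" using N0 e by (intro mult_left_le) auto
      finally show ?thesis .
    qed
    let ?u = "\<phi> r"
    note u = admissible_\<phi>[OF rs(1)]
    let ?c = "\<lambda>\<tau>. \<integral>x. flux ?u \<tau> x \<partial>m \<tau>"
    have cc: "continuous_on {t..r} ?c" using t rT by (intro continuous_on_subset[OF flux_integral_continuous[OF u]]) auto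
    have "norm (integral {t..r} (\<lambda>\<tau>. ?c \<tau> - ?c t)) \<le> e / 2 * (r - t)"
    proof (rule integral_bound)
      show "continuous_on {t..r} (\<lambda>\<tau>. ?c \<tau> - ?c t)" by (intro continuous_intros cc)
      show "norm (?c \<tau> - ?c t) \<le> e / 2" if "\<tau> \<in> {t..r}" for \<tau>
        using d1(2)[OF u, of \<tau>] that h rT t unfolding real_norm_def h_def by auto
    qed (use r in auto)
    moreover have "integral {t..r} (\<lambda>\<tau>. ?c \<tau> - ?c t) = integral {t..r} ?c - h * ?c t"
      using Henstock_Kurzweil_Integration.integral_diff[OF integrable_continuous_real[OF cc] integrable_const_ivl[of "?c t" t r]] r
      by (simp add: h_def)
    ultimately have 1: "\<bar>(\<integral>x. mollify ?u x \<partial>m r) - (\<integral>x. mollify ?u x \<partial>m t) - h * ?c t\<bar> \<le> e / 2 * h"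
      using mollify_increment[OF u, of t r] t r rT by (simp add: h_def)
    define W where "W x = h * flux ?u t x + mollify ?u x - mollify (\<phi> t) x" for x
    have Wb: "\<bar>W x\<bar> \<le> h * ((\<Lambda> + U) * (L * (\<epsilon> + K * h) + \<omega>) + (\<Lambda> + U + U * Q) * (K\<^sup>2 * h))" for x
      unfolding W_def
    proof (rule mollify_step[OF ts rs(2) h_def Kh])
      show "norm (V \<sigma> x - V t x) \<le> \<omega>" if "\<sigma> \<in> {t..r}" "norm x \<le> R + 2" for \<sigma> x
        using that h t rT by (intro d2(2)) (auto simp: h_def)
    qed (use \<omega> in auto)
    have Wm: "W \<in> borel_measurable borel"
      unfolding W_def using flux_borel[OF u tT] mollify_borel[OF u] mollify_borel[OF admissible_\<phi>[OF ts]] by measurable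
    have "\<bar>\<integral>x. W x \<partial>m t\<bar> \<le> h * ((\<Lambda> + U) * (L * (\<epsilon> + K * h) + \<omega>) + (\<Lambda> + U + U * Q) * (K\<^sup>2 * h)) * M"
      by (rule integral_curve_bound(2)[OF tT Wm Wb])
    also have "\<dots> = h * (M * (\<Lambda> + U) * L * \<epsilon> + N * \<omega> + E * h)"
      by (simp add: E_def N_def algebra_simps)
    also have "\<dots> \<le> h * (M * (\<Lambda> + U) * L * \<epsilon> + e / 4 + e / 4)"
      using N\<omega> Eh h by (intro mult_left_mono) linarith+
    finally have 2: "\<bar>\<integral>x. W x \<partial>m t\<bar> \<le> h * (M * (\<Lambda> + U) * L * \<epsilon> + e / 2)" by (simp add: algebra_simps)
    have "integrable (m t) (flux ?u t)"
      by (rule integral_curve_bound(1)[OF tT flux_borel[OF u tT] flux_bound[OF u tT]])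
    then have "(\<integral>x. W x \<partial>m t) = h * ?c t + (\<integral>x. mollify ?u x \<partial>m t) - pairing t"
      unfolding W_def pairing_def using mollify_\<phi>_integrable[OF rs(1) tT] mollify_\<phi>_integrable[OF ts tT] by simp
    then have "pairing r - pairing t = ((\<integral>x. mollify ?u x \<partial>m r) - (\<integral>x. mollify ?u x \<partial>m t) - h * ?c t) + (\<integral>x. W x \<partial>m t)"
      by (simp add: pairing_def)
    then have "\<bar>pairing r - pairing t\<bar> \<le> e / 2 * h + h * (M * (\<Lambda> + U) * L * \<epsilon> + e / 2)"
      using 1 2 by linarith
    then show ?thesis by (simp add: h_def algebra_simps)
  qed
  with d show ?thesis by blast
qed

lemma mollify_\<phi>_lipschitz: "r \<in> {0..s} \<Longrightarrow> \<bar>mollify (\<phi> r) x - mollify (\<phi> r) y\<bar> \<le> \<Lambda> * norm (x - y)"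
  by (rule admissible_mollify(3)[OF admissible_\<phi>])

lemma pairing_continuous: "continuous_on {0..s} pairing"
  unfolding continuous_on_def
proof
  fix t assume t: "t \<in> {0..s}"
  have tT: "t \<in> {0..T}" using t s by auto
  define c1 where "c1 = U / b + \<Lambda>"
  define c2 where "c2 = (exp (K * T) * U + \<Lambda>) * K * M"
  have le: "\<bar>pairing r - pairing t\<bar> \<le> c1 * prw_dist b (m r) (m t) + c2 * \<bar>r - t\<bar>" if r: "r \<in> {0..s}" for r
  proof -
    have rT: "r \<in> {0..T}" using r s by auto
    have 1: "\<bar>(\<integral>x. mollify (\<phi> r) x \<partial>m r) - (\<integral>x. mollify (\<phi> r) x \<partial>m t)\<bar> \<le> c1 * prw_dist b (m r) (m t)"
      unfolding c1_def using admissible_mollify(1)[OF admissible_\<phi>[OF r]]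
      by (intro prw_dist_test_function[OF b m_in[OF rT] m_in[OF tT]] mollify_\<phi>_lipschitz[OF r] \<Lambda>_nonneg mollify_borel[OF admissible_\<phi>[OF r]])
    have d: "\<bar>mollify (\<phi> r) x - mollify (\<phi> t) x\<bar> \<le> (exp (K * T) * U + \<Lambda>) * K * \<bar>r - t\<bar>" for x
      unfolding mollify_diff(1)[OF \<phi>_borel[OF r] \<phi>_bound[OF r] \<phi>_borel[OF t] \<phi>_bound[OF t]]
      by (intro k_average(2) \<phi>_time r t borel_measurable_diff shift_borel \<phi>_borel)
    have "(\<lambda>x. mollify (\<phi> r) x - mollify (\<phi> t) x) \<in> borel_measurable borel"
      using mollify_borel[OF admissible_\<phi>[OF r]] mollify_borel[OF admissible_\<phi>[OF t]] by measurable
    from integral_curve_bound(2)[OF tT this d]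
    have 2: "\<bar>(\<integral>x. mollify (\<phi> r) x \<partial>m t) - pairing t\<bar> \<le> c2 * \<bar>r - t\<bar>"
      unfolding pairing_def c2_def using mollify_\<phi>_integrable[OF r tT] mollify_\<phi>_integrable[OF t tT] by (simp add: ac_simps)
    show ?thesis using 1 2 unfolding pairing_def by linarith
  qed
  show "(pairing \<longlongrightarrow> pairing t) (at t within {0..s})"
  proof (rule LIM_zero_cancel, rule Lim_null_comparison)
    have "((\<lambda>r. prw_dist b (m r) (m t)) \<longlongrightarrow> 0) (at t within {0..s})"
      by (rule tendsto_within_subset[OF m_continuous[OF tT]]) (use s in auto)
    moreover have "((\<lambda>r. \<bar>r - t\<bar>) \<longlongrightarrow> 0) (at t within {0..s})"
      by (rule tendsto_rabs_zero, rule LIM_zero, rule tendsto_ident_at)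
    ultimately show "((\<lambda>r. c1 * prw_dist b (m r) (m t) + c2 * \<bar>r - t\<bar>) \<longlongrightarrow> 0) (at t within {0..s})"
      using tendsto_add[OF tendsto_mult_left[of _ 0 _ c1] tendsto_mult_left[of _ 0 _ c2]] by fastforce
    show "\<forall>\<^sub>F r in at t within {0..s}. norm (pairing r - pairing t) \<le> c1 * prw_dist b (m r) (m t) + c2 * \<bar>r - t\<bar>"
      using le by (auto simp: eventually_at_filter)
  qed
qed

lemma pairing_terminal: "\<bar>pairing s - pairing 0\<bar> \<le> M * (\<Lambda> + U) * L * \<epsilon> * s"
proof -
  have s0: "0 \<le> s" using s by simp
  have "pairing s - pairing 0 \<le> M * (\<Lambda> + U) * L * \<epsilon> * s"
    by (rule right_increment_bound[OF pairing_continuous s0]) (use pairing_increment in \<open>fastforce simp: abs_le_iff\<close>)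
  moreover have "- pairing s - (- pairing 0) \<le> M * (\<Lambda> + U) * L * \<epsilon> * s"
    by (rule right_increment_bound[OF continuous_on_minus[OF pairing_continuous] s0]) (use pairing_increment in \<open>fastforce simp: abs_le_iff\<close>)
  ultimately show ?thesis by linarith
qed

lemma terminal_defect:
  "\<bar>(\<integral>x. \<phi> s x \<partial>m s) - (\<integral>x. \<phi> 0 x \<partial>m 0)\<bar> \<le> (M * (\<Lambda> + U) * L * s + 2 * \<Lambda> * M) * \<epsilon>"
proof -
  have "\<bar>pairing t - (\<integral>x. \<phi> t x \<partial>m t)\<bar> \<le> \<Lambda> * \<epsilon> * M" if t: "t \<in> {0..s}" for t
  proof -
    have tT: "t \<in> {0..T}" using t s by auto
    have "(\<lambda>x. mollify (\<phi> t) x - \<phi> t x) \<in> borel_measurable borel"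
      using mollify_borel[OF admissible_\<phi>[OF t]] \<phi>_borel[OF t] by measurable
    from integral_curve_bound(2)[OF tT this admissible_close[OF admissible_\<phi>[OF t]]]
    show ?thesis
      unfolding pairing_def
      using mollify_\<phi>_integrable[OF t tT] integral_curve_bound(1)[OF tT \<phi>_borel[OF t] \<phi>_bound[OF t]] by simp
  qed
  from this[of s] this[of 0] pairing_terminal s show ?thesis by (simp add: algebra_simps abs_le_iff)
qed

end

text \<open>The difference of the two sides is at most a multiple of the mollification scale by
  \<open>terminal_defect\<close>; it does not depend on that scale, so it vanishes.\<close>

theorem weak_curve_representation:
  fixes V :: "real \<Rightarrow> 'a::euclidean_space \<Rightarrow> 'a \<times> real"
  assumes "weak_curve T K L V b M m" and "terminal_value T K L V s U0 \<Lambda>0 R0 \<psi>"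
  shows "(\<integral>x. \<psi> x \<partial>m s) = (\<integral>x. exp (snd (linear_field.flow T V 0 s x)) * \<psi> (fst (linear_field.flow T V 0 s x)) \<partial>m 0)"
proof -
  interpret w: weak_curve T K L V b M m by fact
  interpret v: terminal_value T K L V s U0 \<Lambda>0 R0 \<psi> by fact
  define c where "c = M * (v.\<Lambda> + v.U) * L * s + 2 * v.\<Lambda> * M"
  define d where "d = \<bar>(\<integral>x. v.\<phi> s x \<partial>m s) - (\<integral>x. v.\<phi> 0 x \<partial>m 0)\<bar>"
  have c0: "0 \<le> c" unfolding c_def using w.M v.U_nonneg v.\<Lambda>_nonneg w.L v.s by simp
  have le: "d \<le> c * \<epsilon>" if \<epsilon>: "0 < \<epsilon>" "\<epsilon> \<le> 1" for \<epsilon> :: real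
  proof -
    obtain P and k :: "'a \<Rightarrow> real" and dk where "mollifier \<epsilon> P k dk" using mollifier_exists[OF \<epsilon>] by blast
    then interpret mo: mollifier \<epsilon> P k dk .
    interpret duality T K L V s U0 \<Lambda>0 R0 \<psi> b M m \<epsilon> P k dk ..
    show ?thesis using terminal_defect by (simp add: c_def d_def)
  qed
  have "d \<le> 0 + e" if e: "e > 0" for e
  proof -
    have "d \<le> c * min 1 (e / (c + 1))" using e c0 by (intro le) auto
    also have "\<dots> \<le> c * (e / (c + 1))" using c0 by (intro mult_left_mono) auto
    also have "\<dots> = e * (c / (c + 1))" by simp
    also have "\<dots> \<le> e" using c0 e by (intro mult_left_le) auto
    finally show ?thesis by simp
  qed
  then have "d \<le> 0" by (rule field_le_epsilon)
  then have "(\<integral>x. v.\<phi> s x \<partial>m s) = (\<integral>x. v.\<phi> 0 x \<partial>m 0)" by (simp add: d_def)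
  then show ?thesis using v.s by (simp add: v.\<phi>_def)
qed

section \<open>Lifting a flow to the space of weighted curves\<close>

text \<open>The \<open>\<sigma>\<close>-algebra on the space of curves is generated by the open sets of an abstract metric, so Borel
  measurability of maps into it has to be derived from the metric.\<close>

lemma measurable_lipschitz_metric_borel:
  fixes c :: "'a::metric_space \<Rightarrow> 'b"
  assumes c: "\<And>x. c x \<in> mspace X" and lip: "\<And>x y. mdist X (c x) (c y) \<le> L * dist x y" and L: "0 \<le> L"
  shows "c \<in> borel \<rightarrow>\<^sub>M borel_of (mtopology_of X)"
  unfolding borel_of_def
proof (rule measurable_measure_of)
  interpret X: Metric_space "mspace X" "mdist X" by (rule Metric_space_mspace_mdist)
  show "{U. openin (mtopology_of X) U} \<subseteq> Pow (topspace (mtopology_of X))" using openin_subset by blast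
  show "c \<in> space borel \<rightarrow> topspace (mtopology_of X)" using c by simp
  fix W assume "W \<in> {U. openin (mtopology_of X) U}"
  then have W: "openin X.mtopology W" by (simp add: mtopology_of_def)
  have "open (c -` W)"
    unfolding open_dist
  proof
    fix x assume "x \<in> c -` W"
    then obtain e where e: "e > 0" "X.mball (c x) e \<subseteq> W" using W unfolding X.openin_mtopology by auto
    have "c y \<in> W" if y: "dist y x < e / (L + 1)" for y
    proof -
      have "mdist X (c x) (c y) \<le> L * dist x y" by (rule lip)
      also have "\<dots> \<le> L * (e / (L + 1))" using y L by (intro mult_left_mono) (auto simp: dist_commute)
      also have "\<dots> < e" using e L by (simp add: field_simps)
      finally show ?thesis using e c by auto
    qed
    then show "\<exists>d>0. \<forall>y. dist y x < d \<longrightarrow> y \<in> c -` W"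
      using e L by (intro exI[of _ "e / (L + 1)"]) auto
  qed
  then show "c -` W \<inter> space borel \<in> sets borel" by simp
qed

lemma weighted_curves_iff:
  fixes \<gamma> :: "real \<Rightarrow> 'a::euclidean_space \<times> real"
  shows "\<gamma> \<in> mspace (weighted_curves T C) \<longleftrightarrow>
    \<gamma> \<in> extensional {0..T} \<and> continuous_on {0..T} \<gamma> \<and> (\<forall>t\<in>{0..T}. 0 \<le> snd (\<gamma> t) \<and> snd (\<gamma> t) \<le> C)"
proof -
  have c: "compactin (top_of_set {0..T}) (topspace (top_of_set {0..T}))" by (simp add: compactin_subtopology)
  show ?thesis
    unfolding weighted_curves_def compactin_mspace_cfunspace[OF c]
    by (auto simp: mtopology_of_submetric continuous_map_in_subtopology mem_Times_iff)
qed

lemma weighted_curves_mdist_le: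
  assumes "\<And>t. t \<in> {0..T} \<Longrightarrow> dist (\<gamma> t) (\<gamma>' t) \<le> B" "0 \<le> B"
  shows "mdist (weighted_curves T C) \<gamma> \<gamma>' \<le> B"
  unfolding weighted_curves_def using assms by (intro mdist_cfunspace_le) auto

text \<open>Weighted curves indexed by their initial position. The second component of \<open>Z\<close> is the logarithm of
  the weight relative to the initial weight \<open>r\<close>, which will be the mass of \<open>m0\<close>.\<close>

locale curve_family =
  fixes T C r B \<Lambda> :: real and Z :: "real \<Rightarrow> 'a::euclidean_space \<Rightarrow> 'a \<times> real"
  assumes T: "T > 0" and r: "0 \<le> r" and \<Lambda>: "0 \<le> \<Lambda>"
    and start: "Z 0 x = (x, 0)" and continuous: "continuous_on {0..T} (\<lambda>t. Z t x)"
    and lipschitz: "t \<in> {0..T} \<Longrightarrow> norm (Z t x - Z t y) \<le> \<Lambda> * norm (x - y)"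
    and growth: "t \<in> {0..T} \<Longrightarrow> snd (Z t x) \<le> B" and C: "r * exp B \<le> C"
begin

definition curve :: "'a \<Rightarrow> real \<Rightarrow> 'a \<times> real" where
  "curve x = restrict (\<lambda>t. (fst (Z t x), r * exp (snd (Z t x)))) {0..T}"

lemma curve_eq: "t \<in> {0..T} \<Longrightarrow> curve x t = (fst (Z t x), r * exp (snd (Z t x)))"
  by (simp add: curve_def)

lemma curve_in: "curve x \<in> mspace (weighted_curves T C)"
  unfolding weighted_curves_iff
proof (intro conjI ballI)
  show "curve x \<in> extensional {0..T}" by (simp add: curve_def)
  have "continuous_on {0..T} (\<lambda>t. (fst (Z t x), r * exp (snd (Z t x))))"
    by (intro continuous_intros continuous)
  then show "continuous_on {0..T} (curve x)" by (rule continuous_on_cong[THEN iffD1, rotated -1]) (auto simp: curve_eq)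
  fix t assume t: "t \<in> {0..T}"
  show "0 \<le> snd (curve x t)" using t r by (simp add: curve_eq)
  have "r * exp (snd (Z t x)) \<le> r * exp B" using growth[OF t] r by (intro mult_left_mono) auto
  then show "snd (curve x t) \<le> C" using C t by (simp add: curve_eq)
qed

definition curve_lip where "curve_lip = \<Lambda> + r * exp B * \<Lambda>"

lemma curve_lip_nonneg: "0 \<le> curve_lip" using \<Lambda> r by (simp add: curve_lip_def)

lemma curve_lipschitz: "mdist (weighted_curves T C) (curve x) (curve y) \<le> curve_lip * dist x y"
proof (rule weighted_curves_mdist_le)
  fix t assume t: "t \<in> {0..T}"
  note l = lipschitz[OF t, of x y]
  have d1: "norm (fst (Z t x) - fst (Z t y)) \<le> \<Lambda> * norm (x - y)"
    using order_trans[OF norm_fst_le_norm l] by simp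
  have d2: "\<bar>snd (Z t x) - snd (Z t y)\<bar> \<le> \<Lambda> * norm (x - y)"
    using order_trans[OF norm_snd_le_norm l] by simp
  have "\<bar>r * exp (snd (Z t x)) - r * exp (snd (Z t y))\<bar> = r * \<bar>exp (snd (Z t x)) - exp (snd (Z t y))\<bar>"
    using r by (simp add: abs_mult flip: right_diff_distrib)
  also have "\<dots> \<le> r * (exp B * (\<Lambda> * norm (x - y)))"
    by (rule mult_left_mono[OF order_trans[OF abs_exp_diff_le[OF growth[OF t] growth[OF t]] mult_left_mono[OF d2]] r]) simp
  finally have e: "\<bar>r * exp (snd (Z t x)) - r * exp (snd (Z t y))\<bar> \<le> r * exp B * \<Lambda> * norm (x - y)" by (simp add: ac_simps)
  have "dist (curve x t) (curve y t) \<le> norm (fst (Z t x) - fst (Z t y)) + \<bar>r * exp (snd (Z t x)) - r * exp (snd (Z t y))\<bar>"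
    unfolding dist_norm using norm_Pair_le[of "fst (Z t x) - fst (Z t y)" "r * exp (snd (Z t x)) - r * exp (snd (Z t y))"] t
    by (simp add: curve_eq)
  then show "dist (curve x t) (curve y t) \<le> curve_lip * dist x y"
    using d1 e by (simp add: curve_lip_def dist_norm algebra_simps)
qed (simp add: curve_lip_nonneg)

lemma curve_measurable: "curve \<in> borel \<rightarrow>\<^sub>M borel_of (mtopology_of (weighted_curves T C))"
  by (rule measurable_lipschitz_metric_borel[OF curve_in curve_lipschitz curve_lip_nonneg])

lemma mdist_measurable: "mdist (weighted_curves T C) (curve 0) \<in> borel_measurable (borel_of (mtopology_of (weighted_curves T C)))"
  unfolding borel_measurable_iff_less
proof
  fix a
  interpret X: Metric_space "mspace (weighted_curves T C) :: (real \<Rightarrow> 'a \<times> real) set" "mdist (weighted_curves T C)"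
    by (rule Metric_space_mspace_mdist)
  have "openin (mtopology_of (weighted_curves T C)) (X.mball (curve 0) a)"
    unfolding mtopology_of_def by (rule X.openin_mball)
  then have "X.mball (curve 0) a \<in> sets (borel_of (mtopology_of (weighted_curves T C)))"
    unfolding borel_of_def by (subst sets_measure_of) (use openin_subset in blast, blast intro: sigma_sets.Basic)
  also have "X.mball (curve 0) a = {\<gamma> \<in> space (borel_of (mtopology_of (weighted_curves T C))). mdist (weighted_curves T C) (curve 0) \<gamma> < a}"
    using curve_in[of 0] by (auto simp: borel_of_def space_measure_of_conv)
  finally show "{\<gamma> \<in> space (borel_of (mtopology_of (weighted_curves T C))). mdist (weighted_curves T C) (curve 0) \<gamma> < a}
      \<in> sets (borel_of (mtopology_of (weighted_curves T C)))" .
qed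

lemma Z_borel: "t \<in> {0..T} \<Longrightarrow> Z t \<in> borel_measurable borel"
  by (intro borel_measurable_continuous_onI continuous_on_norm_lipschitz[OF lipschitz])

text \<open>The set of curves of the family need not be measurable a priori. But \<open>\<gamma>\<close> belongs to it as soon as
  \<open>\<gamma> t\<close> is the state at time \<open>t\<close> issuing from \<open>fst (\<gamma> 0)\<close> for all rational \<open>t\<close>, and each of these countably
  many conditions is measurable and holds almost surely.\<close>

lemma AE_curve:
  assumes \<nu>: "sets \<nu> = sets borel"
  defines "\<eta> \<equiv> distr \<nu> (borel_of (mtopology_of (weighted_curves T C))) curve"
  shows "AE \<gamma> in \<eta>. \<exists>x. \<gamma> = curve x"
proof -
  have cm[measurable]: "curve \<in> \<nu> \<rightarrow>\<^sub>M borel_of (mtopology_of (weighted_curves T C))"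
    using curve_measurable measurable_cong_sets[OF \<nu> refl] by blast
  have s\<eta>: "sets \<eta> = sets (borel_of (mtopology_of (weighted_curves T C)))" by (simp add: \<eta>_def)
  have sp: "space \<eta> = mspace (weighted_curves T C)"
    by (simp add: \<eta>_def borel_of_def space_measure_of_conv)
  have T0: "0 \<in> {0..T}" using T by simp
  have "AE \<gamma> in \<eta>. \<gamma> t = (fst (Z t (fst (\<gamma> 0))), r * exp (snd (Z t (fst (\<gamma> 0)))))" if t: "t \<in> {0..T}" for t
  proof -
    have ev: "(\<lambda>\<gamma>. \<gamma> t) \<in> borel_measurable \<eta>" "(\<lambda>\<gamma>. \<gamma> 0) \<in> borel_measurable \<eta>"
      by (rule weighted_curves_eval_measurable[OF s\<eta>]; fact)+
    have f: "(\<lambda>z. fst z) \<in> borel_measurable (borel :: ('a \<times> real) measure)" "(\<lambda>z. snd z) \<in> borel_measurable (borel :: ('a \<times> real) measure)"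
      by (intro borel_measurable_continuous_onI continuous_intros)+
    have Zm: "(\<lambda>\<gamma>. Z t (fst (\<gamma> 0))) \<in> borel_measurable \<eta>"
      using measurable_compose[OF measurable_compose[OF ev(2) f(1)] Z_borel[OF t]] .
    have m1: "(\<lambda>\<gamma>. (fst (Z t (fst (\<gamma> 0))), r * exp (snd (Z t (fst (\<gamma> 0)))))) \<in> borel_measurable \<eta>"
      using measurable_compose[OF Zm f(1)]
        measurable_compose[OF measurable_compose[OF Zm f(2)] borel_measurable_continuous_onI[OF continuous_on_exp[OF continuous_on_id]]]
      by (intro borel_measurable_Pair borel_measurable_times borel_measurable_const)
    have "{\<gamma> \<in> space \<eta>. \<gamma> t = (fst (Z t (fst (\<gamma> 0))), r * exp (snd (Z t (fst (\<gamma> 0)))))} \<in> sets \<eta>"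
      using borel_measurable_eq[OF measurable_compose[OF borel_measurable_diff[OF ev(1) m1] borel_measurable_norm] borel_measurable_const[of 0]] by simp
    then have "{\<gamma> \<in> space (borel_of (mtopology_of (weighted_curves T C))). \<gamma> t = (fst (Z t (fst (\<gamma> 0))), r * exp (snd (Z t (fst (\<gamma> 0)))))} \<in> sets (borel_of (mtopology_of (weighted_curves T C)))"
      by (simp add: \<eta>_def)
    then show ?thesis
      unfolding \<eta>_def using t T0 by (subst AE_distr_iff[OF cm]) (auto simp: curve_eq start)
  qed
  then have "AE \<gamma> in \<eta>. \<forall>t\<in>{0..T} \<inter> \<rat>. \<gamma> t = (fst (Z t (fst (\<gamma> 0))), r * exp (snd (Z t (fst (\<gamma> 0)))))"
    by (intro AE_ball_countable[THEN iffD2]) (auto intro: countable_subset[OF _ countable_rat])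
  with AE_space[of \<eta>] show ?thesis
  proof eventually_elim
    case (elim \<gamma>)
    then have \<gamma>: "\<gamma> \<in> extensional {0..T}" "continuous_on {0..T} \<gamma>" by (auto simp: sp weighted_curves_iff)
    let ?x = "fst (\<gamma> 0)"
    have cc: "continuous_on {0..T} (curve ?x)" using curve_in weighted_curves_iff by blast
    have eq: "\<gamma> t - curve ?x t = 0" if t: "t \<in> {0..T}" for t
    proof (rule continuous_constant_on_closure[where S = "{0..T} \<inter> \<rat>"])
      have "{0..T} \<subseteq> closure ({0..T} \<inter> \<rat>)"
      proof -
        have "closure ({0<..<T} \<inter> \<rat>) = closure {0<..<T}"
          using open_Int_closure_subset[of "{0<..<T}" "\<rat> :: real set"] 
          by (intro closure_open_Int_superset) (auto simp: Rats_closure_real)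
        moreover have "closure {0<..<T} = {0..T}" using T by simp
        moreover have "closure ({0<..<T} \<inter> \<rat>) \<subseteq> closure ({0..T} \<inter> \<rat>)" by (intro closure_mono) auto
        ultimately show ?thesis by simp
      qed
      moreover have "closure ({0..T} \<inter> \<rat>) \<subseteq> {0..T}" by (intro closure_minimal) auto
      ultimately have cl: "closure ({0..T} \<inter> \<rat>) = {0..T}" by blast
      show "continuous_on (closure ({0..T} \<inter> \<rat>)) (\<lambda>t. \<gamma> t - curve ?x t)"
        unfolding cl by (intro continuous_intros \<gamma> cc)
      show "t \<in> closure ({0..T} \<inter> \<rat>)" using t cl by simp
      show "\<gamma> t - curve ?x t = 0" if "t \<in> {0..T} \<inter> \<rat>" for t
      proof -
        have "t \<in> {0..T}" using that by blast
        then have "\<gamma> t = curve ?x t" unfolding curve_eq[OF \<open>t \<in> {0..T}\<close>] using elim that by blast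
        then show ?thesis by (rule eq_iff_diff_eq_0[THEN iffD1])
      qed
    qed
    have "curve ?x \<in> extensional {0..T}" using curve_in weighted_curves_iff by blast
    with \<gamma>(1) have "\<gamma> = curve ?x"
      by (rule extensionalityI) (rule eq_iff_diff_eq_0[THEN iffD2, OF eq])
    then show ?case by blast
  qed
qed

text \<open>The image of the normalised initial measure under the map from initial positions to weighted curves.
  The constant weight \<open>r = total_mass m0\<close> of the curves undoes the normalisation.\<close>

theorem lifting_exists:
  assumes m0: "m0 \<in> finite_borel_measures1" and rm: "total_mass m0 = r"
  shows "\<exists>\<eta>. \<eta> \<in> prob_measures1 (weighted_curves T C) \<and> (AE \<gamma> in \<eta>. \<exists>x. \<gamma> = curve x) \<and>
           (\<forall>t\<in>{0..T}. weighted_marginal \<eta> t = transport m0 (Z t))"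
proof -
  have m0f: "m0 \<in> finite_borel_measures" and m0i: "integrable m0 norm"
    using m0 by (auto simp: finite_borel_measures1_def)
  note M0 = finite_borel_measuresD[OF m0f]
  interpret m0: finite_measure m0 by (rule M0)
  have rUNIV: "measure m0 UNIV = r" using rm by (simp add: total_mass_def M0)
  \<comment> \<open>If the mass is zero, all weights vanish and any probability measure with finite first moment serves.\<close>
  define \<nu> where "\<nu> = (if r = 0 then return borel (0::'a) else density m0 (\<lambda>_. ennreal (1 / r)))"
  have s\<nu>[measurable_cong]: "sets \<nu> = sets borel" by (simp add: \<nu>_def M0)
  have sm0[measurable_cong]: "sets m0 = sets borel" by (rule M0)
  have p\<nu>: "prob_space \<nu>"
  proof (cases "r = 0")
    case True
    then show ?thesis by (simp add: \<nu>_def prob_space_return)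
  next
    case False
    show ?thesis
    proof
      have "emeasure \<nu> (space \<nu>) = ennreal (1 / r) * emeasure m0 UNIV"
        using False by (simp add: \<nu>_def M0 emeasure_density nn_integral_cmult)
      also have "\<dots> = ennreal (1 / r * r)"
        using r by (simp add: m0.emeasure_eq_measure rUNIV ennreal_mult'[symmetric])
      finally show "emeasure \<nu> (space \<nu>) = 1" using False by simp
    qed
  qed
  interpret \<nu>: prob_space \<nu> by (rule p\<nu>)
  have nn: "(\<integral>\<^sup>+x. ennreal (norm x) \<partial>\<nu>) < \<infinity>"
  proof (cases "r = 0")
    case True
    then show ?thesis by (simp add: \<nu>_def nn_integral_return)
  next
    case False
    then have "(\<integral>\<^sup>+x. ennreal (norm x) \<partial>\<nu>) = ennreal (1 / r) * (\<integral>\<^sup>+x. ennreal (norm x) \<partial>m0)"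
      by (simp add: \<nu>_def nn_integral_density nn_integral_cmult)
    then show ?thesis using m0i by (simp add: nn_integral_eq_integral ennreal_mult_less_top)
  qed
  have scale: "(\<integral>x. h x \<partial>m0) = r * (\<integral>x. h x \<partial>\<nu>)" if [measurable]: "h \<in> borel_measurable borel" for h :: "'a \<Rightarrow> real"
  proof (cases "r = 0")
    case True
    then have "emeasure m0 (space m0) = 0" by (simp add: M0 m0.emeasure_eq_measure rUNIV)
    then have "AE x in m0. h x = 0" by (intro AE_I[where N = "space m0"]) auto
    then have "(\<integral>x. h x \<partial>m0) = (\<integral>x. 0 \<partial>m0)" by (intro integral_cong_AE) auto
    then show ?thesis using True by simp
  next
    case False
    then have "(\<integral>x. h x \<partial>\<nu>) = (\<integral>x. (1 / r) *\<^sub>R h x \<partial>m0)"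
      using r by (simp add: \<nu>_def integral_density)
    then show ?thesis using False by simp
  qed
  define \<eta> where "\<eta> = distr \<nu> (borel_of (mtopology_of (weighted_curves T C))) curve"
  have cm[measurable]: "curve \<in> \<nu> \<rightarrow>\<^sub>M borel_of (mtopology_of (weighted_curves T C))"
    using curve_measurable measurable_cong_sets[OF s\<nu> refl] by blast
  have s\<eta>: "sets \<eta> = sets (borel_of (mtopology_of (weighted_curves T C)))" by (simp add: \<eta>_def)
  have p\<eta>: "prob_space \<eta>" unfolding \<eta>_def by (rule \<nu>.prob_space_distr[OF cm])
  have "\<eta> \<in> prob_measures1 (weighted_curves T C)"
    unfolding prob_measures1_def
  proof (intro CollectI conjI s\<eta> p\<eta> bexI[of _ "curve 0"] curve_in)
    have "(\<integral>\<^sup>+\<gamma>. ennreal (mdist (weighted_curves T C) (curve 0) \<gamma>) \<partial>\<eta>) \<le> (\<integral>\<^sup>+x. ennreal (mdist (weighted_curves T C) (curve 0) (curve x)) \<partial>\<nu>)"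
      unfolding \<eta>_def using mdist_measurable by (subst nn_integral_distr[OF cm]) simp_all
    also have "\<dots> \<le> (\<integral>\<^sup>+x. ennreal curve_lip * ennreal (norm x) \<partial>\<nu>)"
      using curve_lipschitz[of 0] curve_lip_nonneg by (intro nn_integral_mono) (simp add: ennreal_mult[symmetric] ennreal_leI)
    also have "\<dots> = ennreal curve_lip * (\<integral>\<^sup>+x. ennreal (norm x) \<partial>\<nu>)" by (rule nn_integral_cmult) simp
    also have "\<dots> < \<infinity>" using nn by (simp add: ennreal_mult_less_top)
    finally show "(\<integral>\<^sup>+\<gamma>. ennreal (mdist (weighted_curves T C) (curve 0) \<gamma>) \<partial>\<eta>) < \<infinity>" .
  qed
  moreover have "weighted_marginal \<eta> t = transport m0 (Z t)" if t: "t \<in> {0..T}" for t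
  proof -
    have ex1: "\<exists>!\<mu>. is_weighted_marginal \<eta> t \<mu>" by (rule weighted_marginal_ex1[OF \<open>\<eta> \<in> _\<close> t])
    have f: "(\<lambda>z. fst z) \<in> borel_measurable (borel :: ('a \<times> real) measure)" "(\<lambda>z. snd z) \<in> borel_measurable (borel :: ('a \<times> real) measure)"
      by (intro borel_measurable_continuous_onI continuous_intros)+
    have Zf[measurable]: "(\<lambda>x. fst (Z t x)) \<in> borel_measurable borel" "(\<lambda>x. snd (Z t x)) \<in> borel_measurable borel"
      using measurable_compose[OF Z_borel[OF t] f(1)] measurable_compose[OF Z_borel[OF t] f(2)] by simp_all
    have "is_weighted_marginal \<eta> t (transport m0 (Z t))"
      unfolding is_weighted_marginal_def
    proof (intro conjI allI impI)
      show "transport m0 (Z t) \<in> finite_borel_measures"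
        unfolding transport_def using growth[OF t]
        by (intro weighted_push_in m0.integrable_const_bound[where B = "exp B"]) auto
      fix \<phi> :: "'a \<Rightarrow> real" assume "continuous_on UNIV \<phi> \<and> bounded (range \<phi>)"
      then have [measurable]: "\<phi> \<in> borel_measurable borel" by (auto intro: borel_measurable_continuous_onI)
      have ev: "(\<lambda>\<gamma>. \<gamma> t :: 'a \<times> real) \<in> borel_measurable (borel_of (mtopology_of (weighted_curves T C)))"
        by (rule weighted_curves_eval_measurable[OF refl t])
      have [measurable]: "(\<lambda>\<gamma>. fst (\<gamma> t :: 'a \<times> real)) \<in> borel_measurable (borel_of (mtopology_of (weighted_curves T C)))"
        "(\<lambda>\<gamma>. snd (\<gamma> t :: 'a \<times> real)) \<in> borel_measurable (borel_of (mtopology_of (weighted_curves T C)))"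
        using measurable_compose[OF ev f(1)] measurable_compose[OF ev f(2)] by simp_all
      have "(\<integral>x. \<phi> x \<partial>transport m0 (Z t)) = (\<integral>x. \<phi> (fst (Z t x)) * exp (snd (Z t x)) \<partial>m0)"
        unfolding transport_def by (rule integral_weighted_push) auto
      also have "\<dots> = r * (\<integral>x. \<phi> (fst (Z t x)) * exp (snd (Z t x)) \<partial>\<nu>)" by (rule scale) simp
      also have "\<dots> = (\<integral>x. \<phi> (fst (curve x t)) * snd (curve x t) \<partial>\<nu>)"
        using t by (simp add: curve_eq mult.left_commute flip: integral_mult_right_zero)
      also have "\<dots> = (\<integral>\<gamma>. \<phi> (fst (\<gamma> t)) * snd (\<gamma> t) \<partial>\<eta>)"
        unfolding \<eta>_def by (subst integral_distr[OF cm]) simp_all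
      finally show "(\<integral>x. \<phi> x \<partial>transport m0 (Z t)) = (\<integral>\<gamma>. \<phi> (fst (\<gamma> t)) * snd (\<gamma> t) \<partial>\<eta>)" .
    qed
    then show ?thesis unfolding weighted_marginal_def by (intro the1_equality ex1)
  qed
  moreover have "AE \<gamma> in \<eta>. \<exists>x. \<gamma> = curve x" unfolding \<eta>_def by (rule AE_curve[OF s\<nu>])
  ultimately show ?thesis by blast
qed

end

section \<open>Equilibrium distributions are weak solutions\<close>

text \<open>The measure that is specified by its integrals of bounded continuous functions is the image of \<open>\<eta>\<close>,
  weighted by \<open>w(t)\<close>, under \<open>x(t)\<close>.\<close>

lemma
  assumes \<eta>: "\<eta> \<in> prob_measures1 (weighted_curves T C)" and t: "t \<in> {0..T}"
  shows position_borel: "(\<lambda>\<gamma>. fst (\<gamma> t :: 'a::euclidean_space \<times> real)) \<in> borel_measurable \<eta>"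
    and weight_borel: "(\<lambda>\<gamma>. snd (\<gamma> t)) \<in> borel_measurable \<eta>"
    and weighted_marginal_push: "weighted_marginal \<eta> t = weighted_push \<eta> (\<lambda>\<gamma>. snd (\<gamma> t)) (\<lambda>\<gamma>. fst (\<gamma> t))"
    and weighted_marginal_in: "weighted_marginal \<eta> t \<in> finite_borel_measures"
proof -
  have s: "sets \<eta> = sets (borel_of (mtopology_of (weighted_curves T C)))"
    using \<eta> by (simp add: prob_measures1_def)
  interpret prob_space \<eta> using \<eta> by (simp add: prob_measures1_def)
  have sp: "space \<eta> = mspace (weighted_curves T C)"
    using sets_eq_imp_space_eq[OF s] by (simp add: borel_of_def space_measure_of_conv)
  have ev: "(\<lambda>\<gamma>. \<gamma> t) \<in> borel_measurable \<eta>" by (rule weighted_curves_eval_measurable[OF s t])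
  show m[measurable]: "(\<lambda>\<gamma>. fst (\<gamma> t :: 'a \<times> real)) \<in> borel_measurable \<eta>" "(\<lambda>\<gamma>. snd (\<gamma> t)) \<in> borel_measurable \<eta>"
    using measurable_compose[OF ev borel_measurable_continuous_onI[OF continuous_on_fst[OF continuous_on_id]]]
      measurable_compose[OF ev borel_measurable_continuous_onI[OF continuous_on_snd[OF continuous_on_id]]]
    by simp_all
  have w: "AE \<gamma> in \<eta>. 0 \<le> snd (\<gamma> t)" "AE \<gamma> in \<eta>. norm (snd (\<gamma> t)) \<le> C"
  proof -
    have *: "0 \<le> snd (\<gamma> t) \<and> norm (snd (\<gamma> t)) \<le> C" if "\<gamma> \<in> space \<eta>" for \<gamma>
      using weighted_curves_weight[of \<gamma> T C t] that t by (simp add: sp)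
    show "AE \<gamma> in \<eta>. 0 \<le> snd (\<gamma> t)" "AE \<gamma> in \<eta>. norm (snd (\<gamma> t)) \<le> C" by (rule AE_I2, use * in blast)+
  qed
  have i: "integrable \<eta> (\<lambda>\<gamma>. snd (\<gamma> t))" by (rule integrable_const_bound[OF w(2) m(2)])
  let ?p = "weighted_push \<eta> (\<lambda>\<gamma>. snd (\<gamma> t)) (\<lambda>\<gamma>. fst (\<gamma> t))"
  have "is_weighted_marginal \<eta> t ?p"
    unfolding is_weighted_marginal_def
  proof (intro conjI allI impI)
    show p: "?p \<in> finite_borel_measures" by (rule weighted_push_in[OF i w(1) m(1)])
    show "(\<integral>x. \<phi> x \<partial>?p) = (\<integral>\<gamma>. \<phi> (fst (\<gamma> t)) * snd (\<gamma> t) \<partial>\<eta>)"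
      if "continuous_on UNIV \<phi> \<and> bounded (range \<phi>)" for \<phi> :: "'a \<Rightarrow> real"
      using that w(1) by (intro integral_weighted_push m borel_measurable_continuous_onI) auto
  qed
  then show eq: "weighted_marginal \<eta> t = ?p"
    unfolding weighted_marginal_def by (intro the1_equality weighted_marginal_ex1[OF \<eta> t])
  show "weighted_marginal \<eta> t \<in> finite_borel_measures" unfolding eq by (rule weighted_push_in[OF i w(1) m(1)])
qed

text \<open>Continuous functions are bounded on the compact support of \<open>\<phi>\<close>. Off the support \<open>\<phi>\<close> vanishes locally, and
  so do its derivatives, because derivatives within \<open>[0, T]\<close> and in the full space are unique.\<close>

lemma C1c_test_function_bounded:
  fixes \<phi> :: "real \<Rightarrow> 'a::euclidean_space \<Rightarrow> real"
  assumes \<phi>: "C1c_test_function T \<phi> \<phi>t \<phi>x" and T: "T > 0"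
  shows "continuous_on ({0..T} \<times> UNIV) (\<lambda>(t, x). \<phi> t x)"
    and "\<exists>B\<ge>0. \<forall>t\<in>{0..T}. \<forall>x. \<bar>\<phi> t x\<bar> \<le> B \<and> \<bar>\<phi>t t x\<bar> \<le> B \<and> norm (\<phi>x t x) \<le> B"
proof -
  let ?D = "{0..T} \<times> (UNIV :: 'a set)"
  have der: "((\<lambda>(s, y). \<phi> s y) has_derivative (\<lambda>(h, v). \<phi>t t x * h + \<phi>x t x \<bullet> v)) (at (t, x) within ?D)"
    if "t \<in> {0..T}" for t x
    using \<phi> that by (simp add: C1c_test_function_def)
  show c: "continuous_on ?D (\<lambda>(t, x). \<phi> t x)"
    unfolding continuous_on_eq_continuous_within using has_derivative_continuous[OF der] by auto
  have ct: "continuous_on ?D (\<lambda>(t, x). \<phi>t t x)" and cx: "continuous_on ?D (\<lambda>(t, x). \<phi>x t x)"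
    using \<phi> by (auto simp: C1c_test_function_def)
  define S where "S = closure {(t, x). t \<in> {0..T} \<and> \<phi> t x \<noteq> 0}"
  have S: "compact S" using \<phi> by (simp add: C1c_test_function_def S_def)
  have out: "\<phi> t x = 0 \<and> \<phi>t t x = 0 \<and> \<phi>x t x = 0" if t: "t \<in> {0..T}" and tx: "(t, x) \<notin> S" for t x
  proof -
    have "open (- S)" unfolding S_def by (rule open_Compl[OF closed_closure])
    then obtain e where e: "e > 0" "\<And>p. dist p (t, x) < e \<Longrightarrow> p \<notin> S"
      using tx unfolding open_dist by (metis ComplD ComplI)
    have z: "\<phi> s y = 0" if "s \<in> {0..T}" "dist (s, y) (t, x) < e" for s y
      using e(2)[OF that(2)] that(1) closure_subset[of "{(t, x). t \<in> {0..T} \<and> \<phi> t x \<noteq> 0}"] unfolding S_def by auto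
    have d1: "((\<lambda>s. \<phi> s x) has_vector_derivative \<phi>t t x) (at t within {0..T})"
    proof -
      have "((\<lambda>s. (\<lambda>(s, y). \<phi> s y) (s, x)) has_derivative (\<lambda>h. (\<lambda>(h, v). \<phi>t t x * h + \<phi>x t x \<bullet> v) (h, 0))) (at t within {0..T})"
        by (rule has_derivative_in_compose[where f = "\<lambda>s. (s, x)" and s = "{0..T}"])
           (use t in \<open>auto intro!: derivative_eq_intros has_derivative_subset[OF der]\<close>)
      then show ?thesis by (simp add: has_vector_derivative_def mult.commute)
    qed
    have d2: "((\<lambda>s. \<phi> s x) has_vector_derivative 0) (at t within {0..T})"
      by (rule has_vector_derivative_transform_within[OF has_vector_derivative_const[of 0] e(1) t])
         (use z in \<open>auto simp: dist_Pair_Pair\<close>)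
    have 1: "\<phi>t t x = 0"
      using vector_derivative_unique_within_closed_interval[OF T _ d1[folded box_real(2)] d2[folded box_real(2)]] t by simp
    have "((\<lambda>y. (\<lambda>(s, y). \<phi> s y) (t, y)) has_derivative (\<lambda>v. (\<lambda>(h, v). \<phi>t t x * h + \<phi>x t x \<bullet> v) (0, v))) (at x)"
      by (rule has_derivative_in_compose[where f = "\<lambda>y. (t, y)" and s = UNIV])
         (use t in \<open>auto intro!: derivative_eq_intros has_derivative_subset[OF der]\<close>)
    then have "((\<lambda>y. \<phi> t y) has_derivative (\<lambda>v. \<phi>x t x \<bullet> v)) (at x)" by simp
    moreover have "((\<lambda>y. \<phi> t y) has_derivative (\<lambda>v. 0)) (at x)"
      by (rule has_derivative_transform_within[OF has_derivative_const[of 0] e(1)])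
         (use z t in \<open>auto simp: dist_Pair_Pair\<close>)
    ultimately have "(\<lambda>v. \<phi>x t x \<bullet> v) = (\<lambda>v. 0)" by (rule has_derivative_unique)
    then have 2: "\<phi>x t x = 0" by (metis inner_eq_zero_iff)
    show ?thesis using 1 2 z[of t x] t e(1) by simp
  qed
  have K: "compact (S \<inter> ?D)" using S by (intro compact_Int_closed) (auto intro!: closed_Times)
  have bdd: "\<exists>B. \<forall>p\<in>S \<inter> ?D. norm (h p) \<le> B" if "continuous_on ?D h" for h :: "real \<times> 'a \<Rightarrow> 'c::real_normed_vector"
  proof -
    have "compact (h ` (S \<inter> ?D))"
      by (rule compact_continuous_image[OF continuous_on_subset[OF that] K]) auto
    then have "bounded (h ` (S \<inter> ?D))" by (rule compact_imp_bounded)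
    then show ?thesis unfolding bounded_iff by auto
  qed
  obtain B1 B2 B3 where B: "\<forall>p\<in>S \<inter> ?D. norm (case p of (t, x) \<Rightarrow> \<phi> t x) \<le> B1"
    "\<forall>p\<in>S \<inter> ?D. norm (case p of (t, x) \<Rightarrow> \<phi>t t x) \<le> B2" "\<forall>p\<in>S \<inter> ?D. norm (case p of (t, x) \<Rightarrow> \<phi>x t x) \<le> B3"
    using bdd[OF c] bdd[OF ct] bdd[OF cx] by blast
  define B where "B = \<bar>B1\<bar> + \<bar>B2\<bar> + \<bar>B3\<bar>"
  have "\<bar>\<phi> t x\<bar> \<le> B \<and> \<bar>\<phi>t t x\<bar> \<le> B \<and> norm (\<phi>x t x) \<le> B" if t: "t \<in> {0..T}" for t x
  proof (cases "(t, x) \<in> S")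
    case True
    then have p: "(t, x) \<in> S \<inter> ?D" using t by simp
    have "\<bar>\<phi> t x\<bar> \<le> B1" "\<bar>\<phi>t t x\<bar> \<le> B2" "norm (\<phi>x t x) \<le> B3"
      using bspec[OF B(1) p] bspec[OF B(2) p] bspec[OF B(3) p] by simp_all
    then show ?thesis by (auto simp: B_def)
  next
    case False
    then show ?thesis using out[OF t False] by (simp add: B_def)
  qed
  moreover have "B \<ge> 0" by (simp add: B_def)
  ultimately show "\<exists>B\<ge>0. \<forall>t\<in>{0..T}. \<forall>x. \<bar>\<phi> t x\<bar> \<le> B \<and> \<bar>\<phi>t t x\<bar> \<le> B \<and> norm (\<phi>x t x) \<le> B" by blast
qed

text \<open>Differentiation under the integral sign, in integrated form.\<close>

lemma integral_increment:
  fixes q :: "real \<Rightarrow> 'b \<Rightarrow> real"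
  assumes M: "finite_measure M"
    and q: "\<And>t. t \<in> {0..T} \<Longrightarrow> integrable M (q t)" and q': "\<And>t. t \<in> {0..T} \<Longrightarrow> q' t \<in> borel_measurable M"
    and der: "AE \<omega> in M. \<forall>t\<in>{0..T}. ((\<lambda>s. q s \<omega>) has_vector_derivative q' t \<omega>) (at t within {0..T})"
    and B: "AE \<omega> in M. \<forall>t\<in>{0..T}. \<bar>q' t \<omega>\<bar> \<le> B"
    and c: "AE \<omega> in M. continuous_on {0..T} (\<lambda>t. q' t \<omega>)"
    and s: "s \<in> {0..T}"
  shows "(\<integral>\<omega>. q s \<omega> \<partial>M) - (\<integral>\<omega>. q 0 \<omega> \<partial>M) = (LINT t:{0..s}|lborel. (\<integral>\<omega>. q' t \<omega> \<partial>M))"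
proof -
  interpret finite_measure M by (rule M)
  let ?D = "\<lambda>t. \<integral>\<omega>. q' t \<omega> \<partial>M"
  have D: "((\<lambda>s. \<integral>\<omega>. q s \<omega> \<partial>M) has_vector_derivative ?D t) (at t within {0..T})" if t: "t \<in> {0..T}" for t
  proof -
    have lim: "((\<lambda>r. \<integral>\<omega>. (q r \<omega> - q t \<omega>) / (r - t) \<partial>M) \<longlongrightarrow> ?D t) (at t within {0..T})"
    proof (rule dominated_convergence_within[where w = "\<lambda>_. B"])
      show "(\<lambda>\<omega>. (q r \<omega> - q t \<omega>) / (r - t)) \<in> borel_measurable M" if "r \<in> {0..T} - {t}" for r
        using q[of r] q[OF t] that by (auto intro!: borel_measurable_divide borel_measurable_diff)
      show "AE \<omega> in M. ((\<lambda>r. (q r \<omega> - q t \<omega>) / (r - t)) \<longlongrightarrow> q' t \<omega>) (at t within {0..T})"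
        using der
      proof eventually_elim
        case (elim \<omega>)
        then show ?case using t
          by (simp add: has_real_derivative_iff_has_vector_derivative[symmetric] has_field_derivative_iff)
      qed
      show "AE \<omega> in M. norm ((q r \<omega> - q t \<omega>) / (r - t)) \<le> B" if r: "r \<in> {0..T} - {t}" for r
        using der B
      proof eventually_elim
        case (elim \<omega>)
        have "norm (q r \<omega> - q t \<omega>) \<le> B * \<bar>r - t\<bar>"
          by (rule vector_derivative_increment[where u' = "\<lambda>t. q' t \<omega>" and a = 0 and c = T]) (use elim r t in auto)
        then show ?case using r by (simp add: divide_le_eq)
      qed
    qed (use q' t in auto)
    have quot: "(\<integral>\<omega>. (q r \<omega> - q t \<omega>) / (r - t) \<partial>M) = ((\<integral>\<omega>. q r \<omega> \<partial>M) - (\<integral>\<omega>. q t \<omega> \<partial>M)) / (r - t)"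
      if "r \<in> {0..T}" for r
      using q[OF that] q[OF t] by simp
    have "((\<lambda>r. ((\<integral>\<omega>. q r \<omega> \<partial>M) - (\<integral>\<omega>. q t \<omega> \<partial>M)) / (r - t)) \<longlongrightarrow> ?D t) (at t within {0..T})"
    proof (rule Lim_transform_eventually[OF lim])
      have "\<forall>\<^sub>F r in at t within {0..T}. r \<in> {0..T}" by (simp add: eventually_at_filter)
      then show "\<forall>\<^sub>F r in at t within {0..T}. (\<integral>\<omega>. (q r \<omega> - q t \<omega>) / (r - t) \<partial>M) = ((\<integral>\<omega>. q r \<omega> \<partial>M) - (\<integral>\<omega>. q t \<omega> \<partial>M)) / (r - t)"
        by eventually_elim (rule quot)
    qed
    then show ?thesis
      by (simp add: has_real_derivative_iff_has_vector_derivative[symmetric] has_field_derivative_iff)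
  qed
  have cD: "continuous_on {0..T} ?D"
    unfolding continuous_on_def
  proof
    fix t assume t: "t \<in> {0..T}"
    show "(?D \<longlongrightarrow> ?D t) (at t within {0..T})"
    proof (rule dominated_convergence_within[where w = "\<lambda>_. B"])
      show "AE \<omega> in M. ((\<lambda>s. q' s \<omega>) \<longlongrightarrow> q' t \<omega>) (at t within {0..T})"
        using c by eventually_elim (use t in \<open>auto simp: continuous_on_def\<close>)
      show "AE \<omega> in M. norm (q' r \<omega>) \<le> B" if "r \<in> {0..T} - {t}" for r
        using B by eventually_elim (use that in auto)
    qed (use q' t in auto)
  qed
  have "(?D has_integral (\<integral>\<omega>. q s \<omega> \<partial>M) - (\<integral>\<omega>. q 0 \<omega> \<partial>M)) {0..s}"
    using s by (intro fundamental_theorem_of_calculus has_vector_derivative_within_subset[OF D]) auto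
  moreover have "set_integrable lborel {0..s} ?D"
    using s by (intro borel_integrable_atLeastAtMost' continuous_on_subset[OF cD]) auto
  then have "(LINT t:{0..s}|lborel. ?D t) = integral {0..s} ?D" by (rule set_borel_integral_eq_integral(2))
  ultimately show ?thesis by (simp add: integral_unique)
qed

text \<open>Along almost every curve the chain rule turns the two differential equations into the integrand
  of the weak formulation times \<open>w(t)\<close>.\<close>

theorem equilibrium_is_weak_solution:
  fixes f :: "real \<Rightarrow> 'a::euclidean_space \<Rightarrow> 'a measure \<Rightarrow> 'a" and g :: "real \<Rightarrow> 'a \<Rightarrow> 'a measure \<Rightarrow> real"
  assumes T: "T > 0" and b: "b > 0"
    and cf: "continuous_coeff T b f" and cg: "continuous_coeff T b g"
    and bf: "bounded_coeff T Cf f" and bg: "bounded_coeff T Cg g"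
    and eq: "equilibrium_distribution T C f g m0 \<eta>"
  shows "weak_solution T b f g m0 (weighted_marginal \<eta>)"
proof -
  let ?m = "weighted_marginal \<eta>"
  have \<eta>: "\<eta> \<in> prob_measures1 (weighted_curves T C)" and start: "?m 0 = m0"
    and ode: "AE \<gamma> in \<eta>. (\<forall>t\<in>{0..T}.
          ((\<lambda>s. fst (\<gamma> s)) has_vector_derivative f t (fst (\<gamma> t)) (?m t)) (at t within {0..T}) \<and>
          ((\<lambda>s. snd (\<gamma> s)) has_real_derivative g t (fst (\<gamma> t)) (?m t) * snd (\<gamma> t)) (at t within {0..T}))"
    using eq by (auto simp: equilibrium_distribution_def)
  interpret prob_space \<eta> using \<eta> by (simp add: prob_measures1_def)
  have sp: "space \<eta> = mspace (weighted_curves T C)"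
    using \<eta> sets_eq_imp_space_eq[of \<eta> "borel_of (mtopology_of (weighted_curves T C))"]
    by (simp add: prob_measures1_def borel_of_def space_measure_of_conv)
  note pm = position_borel[OF \<eta>] and wm = weight_borel[OF \<eta>] and mp = weighted_marginal_push[OF \<eta>] and mi = weighted_marginal_in[OF \<eta>]
  have weight: "0 \<le> snd (\<gamma> t)" "snd (\<gamma> t) \<le> C" if "\<gamma> \<in> space \<eta>" "t \<in> {0..T}" for \<gamma> t
    using weighted_curves_weight[of \<gamma> T C t] that by (auto simp: sp)
  have wAE: "AE \<gamma> in \<eta>. 0 \<le> snd (\<gamma> t)" if "t \<in> {0..T}" for t
    using weight that by (auto intro!: AE_I2)
  obtain \<gamma>0 where "\<gamma>0 \<in> space \<eta>" using not_empty by blast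
  then have C0: "0 \<le> C" using weight[of \<gamma>0 0] T by auto
  have cont: "AE \<gamma> in \<eta>. continuous_on {0..T} (\<lambda>t. fst (\<gamma> t)) \<and> continuous_on {0..T} (\<lambda>t. snd (\<gamma> t))"
    using ode
  proof eventually_elim
    case (elim \<gamma>)
    then show ?case unfolding continuous_on_eq_continuous_within
      using has_vector_derivative_continuous DERIV_continuous by blast
  qed
  have lim: "((\<lambda>s. prw_dist b (?m s) (?m t)) \<longlongrightarrow> 0) (at t within {0..T})" if t: "t \<in> {0..T}" for t
  proof -
    have "((\<lambda>s. prw_dist b (weighted_push \<eta> (\<lambda>\<gamma>. snd (\<gamma> s)) (\<lambda>\<gamma>. fst (\<gamma> s))) (weighted_push \<eta> (\<lambda>\<gamma>. snd (\<gamma> t)) (\<lambda>\<gamma>. fst (\<gamma> t)))) \<longlongrightarrow> 0) (at t within {0..T})"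
    proof (rule prw_dist_weighted_push_tendsto[OF b finite_measure_axioms t pm wm _ C0, where D = "Cf * T"])
      show "AE \<gamma> in \<eta>. 0 \<le> snd (\<gamma> s) \<and> snd (\<gamma> s) \<le> C" if "s \<in> {0..T}" for s
        using weight that by (auto intro!: AE_I2)
      show "AE \<gamma> in \<eta>. norm (fst (\<gamma> s) - fst (\<gamma> t)) \<le> Cf * T" if s: "s \<in> {0..T}" for s
        using ode
      proof eventually_elim
        case (elim \<gamma>)
        have bd: "norm (f r (fst (\<gamma> r)) (?m r)) \<le> Cf" if "r \<in> {0..T}" for r
          by (rule coeff_bound[OF bf that mi[OF that]])
        have "norm (fst (\<gamma> s) - fst (\<gamma> t)) \<le> Cf * \<bar>s - t\<bar>"
          by (rule vector_derivative_increment[where u' = "\<lambda>t. f t (fst (\<gamma> t)) (?m t)" and a = 0 and c = T])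
             (use elim s t bd in auto)
        also have "\<dots> \<le> Cf * T"
          using s t order_trans[OF norm_ge_zero bd[OF t]] by (intro mult_left_mono) auto
        finally show ?case .
      qed
      show "AE \<gamma> in \<eta>. ((\<lambda>s. fst (\<gamma> s)) \<longlongrightarrow> fst (\<gamma> t)) (at t within {0..T})"
        "AE \<gamma> in \<eta>. ((\<lambda>s. snd (\<gamma> s)) \<longlongrightarrow> snd (\<gamma> t)) (at t within {0..T})"
        using cont by (eventually_elim, use t in \<open>simp add: continuous_on_def\<close>)+
    qed
    then have "((\<lambda>s. prw_dist b (weighted_push \<eta> (\<lambda>\<gamma>. snd (\<gamma> s)) (\<lambda>\<gamma>. fst (\<gamma> s))) (?m t)) \<longlongrightarrow> 0) (at t within {0..T})"
      by (simp only: mp[OF t])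
    then show ?thesis
      by (rule Lim_transform_eventually) (simp add: eventually_at_filter mp)
  qed
  have cF: "continuous_on ({0..T} \<times> UNIV) (\<lambda>(t, x). f t x (?m t))" by (rule continuous_coeff_along[OF cf mi lim b])
  have cG: "continuous_on ({0..T} \<times> UNIV) (\<lambda>(t, x). g t x (?m t))" by (rule continuous_coeff_along[OF cg mi lim b])
  have slice: "continuous_on UNIV (h t)" if h: "continuous_on ({0..T} \<times> UNIV) (\<lambda>(t, x). h t x)" and t: "t \<in> {0..T}"
    for h :: "real \<Rightarrow> 'a \<Rightarrow> 'c::topological_space" and t
  proof -
    have "continuous_on UNIV (\<lambda>x. (\<lambda>(t, x). h t x) (t, x))"
      by (rule continuous_on_compose2[OF h]) (use t in \<open>auto intro!: continuous_intros\<close>)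
    then show ?thesis by simp
  qed
  have path: "continuous_on {0..T} (\<lambda>t. h t (y t))" if h: "continuous_on ({0..T} \<times> UNIV) (\<lambda>(t, x). h t x)" and y: "continuous_on {0..T} y"
    for h :: "real \<Rightarrow> 'a \<Rightarrow> 'c::topological_space" and y
  proof -
    have "continuous_on {0..T} (\<lambda>t. (\<lambda>(t, x). h t x) (t, y t))"
      by (rule continuous_on_compose2[OF h]) (use y in \<open>auto intro!: continuous_intros\<close>)
    then show ?thesis by simp
  qed
  have "(\<integral>x. \<phi> s x \<partial>?m s) - (\<integral>x. \<phi> 0 x \<partial>m0) =
          (LINT t:{0..s}|lborel. (\<integral>x. \<phi>t t x + \<phi>x t x \<bullet> f t x (?m t) + \<phi> t x * g t x (?m t) \<partial>?m t))"
    if \<phi>: "C1c_test_function T \<phi> \<phi>t \<phi>x" and s: "s \<in> {0..T}" for \<phi> \<phi>t \<phi>x s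
  proof -
    have c\<phi>: "continuous_on ({0..T} \<times> UNIV) (\<lambda>(t, x). \<phi> t x)" by (rule C1c_test_function_bounded[OF \<phi> T])
    have ct: "continuous_on ({0..T} \<times> UNIV) (\<lambda>(t, x). \<phi>t t x)" and cx: "continuous_on ({0..T} \<times> UNIV) (\<lambda>(t, x). \<phi>x t x)"
      using \<phi> by (auto simp: C1c_test_function_def)
    obtain B where B0: "B \<ge> 0" and B: "\<And>t x. t \<in> {0..T} \<Longrightarrow> \<bar>\<phi> t x\<bar> \<le> B" "\<And>t x. t \<in> {0..T} \<Longrightarrow> \<bar>\<phi>t t x\<bar> \<le> B" "\<And>t x. t \<in> {0..T} \<Longrightarrow> norm (\<phi>x t x) \<le> B"
      using C1c_test_function_bounded(2)[OF \<phi> T] by blast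
    define \<Psi> where "\<Psi> t x = \<phi>t t x + \<phi>x t x \<bullet> f t x (?m t) + \<phi> t x * g t x (?m t)" for t x
    have c\<Psi>: "continuous_on ({0..T} \<times> UNIV) (\<lambda>(t, x). \<Psi> t x)"
      using c\<phi> ct cx cF cG unfolding \<Psi>_def case_prod_beta by (intro continuous_intros)
    have \<Psi>B: "\<bar>\<Psi> t x\<bar> \<le> B + B * Cf + B * Cg" if t: "t \<in> {0..T}" for t x
    proof -
      have "\<bar>\<phi>x t x \<bullet> f t x (?m t)\<bar> \<le> B * Cf"
        using B(3)[OF t] coeff_bound[OF bf t mi[OF t]] B0 by (intro order_trans[OF Cauchy_Schwarz_ineq2] mult_mono) auto
      moreover have "\<bar>\<phi> t x * g t x (?m t)\<bar> \<le> B * Cg"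
        unfolding abs_mult using B(1)[OF t] coeff_bound[OF bg t mi[OF t]] B0 by (intro mult_mono) auto
      ultimately show ?thesis unfolding \<Psi>_def using B(2)[OF t, of x] by linarith
    qed
    have \<phi>m: "\<phi> t \<in> borel_measurable borel" "\<Psi> t \<in> borel_measurable borel" if "t \<in> {0..T}" for t
      using slice[OF c\<phi> that] slice[OF c\<Psi> that] by (auto intro: borel_measurable_continuous_onI)
    define q where "q t \<gamma> = \<phi> t (fst (\<gamma> t)) * snd (\<gamma> t)" for t and \<gamma> :: "real \<Rightarrow> 'a \<times> real"
    define q' where "q' t \<gamma> = \<Psi> t (fst (\<gamma> t)) * snd (\<gamma> t)" for t and \<gamma> :: "real \<Rightarrow> 'a \<times> real"
    have "(\<integral>\<gamma>. q s \<gamma> \<partial>\<eta>) - (\<integral>\<gamma>. q 0 \<gamma> \<partial>\<eta>) = (LINT t:{0..s}|lborel. (\<integral>\<gamma>. q' t \<gamma> \<partial>\<eta>))"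
    proof (rule integral_increment[OF finite_measure_axioms _ _ _ _ _ s, where B = "(B + B * Cf + B * Cg) * C"])
      fix t assume t: "t \<in> {0..T}"
      have m: "q t \<in> borel_measurable \<eta>"
        unfolding q_def by (intro borel_measurable_times measurable_compose[OF pm[OF t] \<phi>m(1)[OF t]] wm[OF t])
      show "q' t \<in> borel_measurable \<eta>"
        unfolding q'_def by (intro borel_measurable_times measurable_compose[OF pm[OF t] \<phi>m(2)[OF t]] wm[OF t])
      have "norm (q t \<gamma>) \<le> B * C" if "\<gamma> \<in> space \<eta>" for \<gamma>
        unfolding q_def real_norm_def abs_mult using B(1)[OF t] weight[OF that t] B0 by (intro mult_mono) auto
      then show "integrable \<eta> (q t)" using m by (intro integrable_const_bound[where B = "B * C"] AE_I2) auto
    next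
      show "AE \<gamma> in \<eta>. \<forall>t\<in>{0..T}. ((\<lambda>s. q s \<gamma>) has_vector_derivative q' t \<gamma>) (at t within {0..T})"
        using ode
      proof eventually_elim
        case (elim \<gamma>)
        show ?case
        proof
          fix t assume t: "t \<in> {0..T}"
          let ?F = "f t (fst (\<gamma> t)) (?m t)" and ?G = "g t (fst (\<gamma> t)) (?m t)"
          have dx: "((\<lambda>s. fst (\<gamma> s)) has_derivative (\<lambda>h. h *\<^sub>R ?F)) (at t within {0..T})"
            and dw: "((\<lambda>s. snd (\<gamma> s)) has_real_derivative ?G * snd (\<gamma> t)) (at t within {0..T})"
            using elim t by (auto simp: has_vector_derivative_def)
          have "((\<lambda>(s, y). \<phi> s y) has_derivative (\<lambda>(h, v). \<phi>t t (fst (\<gamma> t)) * h + \<phi>x t (fst (\<gamma> t)) \<bullet> v)) (at (t, fst (\<gamma> t)) within {0..T} \<times> UNIV)"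
            using \<phi> t by (simp add: C1c_test_function_def)
          then have d\<phi>: "((\<lambda>(s, y). \<phi> s y) has_derivative (\<lambda>(h, v). \<phi>t t (fst (\<gamma> t)) * h + \<phi>x t (fst (\<gamma> t)) \<bullet> v)) (at (t, fst (\<gamma> t)) within (\<lambda>s. (s, fst (\<gamma> s))) ` {0..T})"
            by (rule has_derivative_subset) auto
          have "((\<lambda>s. (\<lambda>(s, y). \<phi> s y) (s, fst (\<gamma> s))) has_derivative (\<lambda>h. (\<lambda>(h, v). \<phi>t t (fst (\<gamma> t)) * h + \<phi>x t (fst (\<gamma> t)) \<bullet> v) (h, h *\<^sub>R ?F))) (at t within {0..T})"
            by (rule has_derivative_in_compose[OF has_derivative_Pair[OF has_derivative_ident dx] d\<phi>])
          then have "((\<lambda>s. \<phi> s (fst (\<gamma> s))) has_derivative (\<lambda>h. \<phi>t t (fst (\<gamma> t)) * h + \<phi>x t (fst (\<gamma> t)) \<bullet> (h *\<^sub>R ?F))) (at t within {0..T})"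
            by simp
          then have "((\<lambda>s. \<phi> s (fst (\<gamma> s))) has_real_derivative \<phi>t t (fst (\<gamma> t)) + \<phi>x t (fst (\<gamma> t)) \<bullet> ?F) (at t within {0..T})"
            unfolding has_field_derivative_def by (rule has_derivative_eq_rhs) (simp add: fun_eq_iff algebra_simps)
          from DERIV_mult[OF this dw]
          show "((\<lambda>s. q s \<gamma>) has_vector_derivative q' t \<gamma>) (at t within {0..T})"
            unfolding has_real_derivative_iff_has_vector_derivative[symmetric] q_def q'_def
            by (rule DERIV_cong) (simp add: \<Psi>_def algebra_simps)
        qed
      qed
      have "\<bar>q' t \<gamma>\<bar> \<le> (B + B * Cf + B * Cg) * C" if "\<gamma> \<in> space \<eta>" "t \<in> {0..T}" for t \<gamma>
        unfolding q'_def abs_mult using \<Psi>B[OF that(2)] weight[OF that] order_trans[OF abs_ge_zero \<Psi>B[OF that(2)]] by (intro mult_mono) auto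
      then show "AE \<gamma> in \<eta>. \<forall>t\<in>{0..T}. \<bar>q' t \<gamma>\<bar> \<le> (B + B * Cf + B * Cg) * C" by (intro AE_I2) auto
      show "AE \<gamma> in \<eta>. continuous_on {0..T} (\<lambda>t. q' t \<gamma>)"
        using cont
      proof eventually_elim
        case (elim \<gamma>)
        then show ?case unfolding q'_def by (intro continuous_on_mult path[OF c\<Psi>]) auto
      qed
    qed
    moreover have "(\<integral>\<gamma>. q t \<gamma> \<partial>\<eta>) = (\<integral>x. \<phi> t x \<partial>?m t)" if t: "t \<in> {0..T}" for t
      unfolding mp[OF t] q_def by (rule integral_weighted_push[symmetric, OF wm[OF t] wAE[OF t] pm[OF t] \<phi>m(1)[OF t]])
    moreover have "(\<integral>\<gamma>. q' t \<gamma> \<partial>\<eta>) = (\<integral>x. \<Psi> t x \<partial>?m t)" if t: "t \<in> {0..T}" for t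
      unfolding mp[OF t] q'_def by (rule integral_weighted_push[symmetric, OF wm[OF t] wAE[OF t] pm[OF t] \<phi>m(2)[OF t]])
    then have "(LINT t:{0..s}|lborel. (\<integral>\<gamma>. q' t \<gamma> \<partial>\<eta>)) = (LINT t:{0..s}|lborel. (\<integral>x. \<Psi> t x \<partial>?m t))"
      using s by (intro set_lebesgue_integral_cong) auto
    ultimately show ?thesis using s T start by (simp add: \<Psi>_def)
  qed
  then show ?thesis using mi lim by (simp add: weak_solution_def)
qed

section \<open>The nonlocal balance equation\<close>

text \<open>Indicators of closed sets are pointwise limits of Lipschitz functions with compact support: multiply the usual
  distance profile by a radial cut-off.\<close>

lemma cutoff_indicator_limit:
  fixes F :: "'a::euclidean_space set"
  assumes \<rho>: "\<rho> \<in> finite_borel_measures" and F: "closed F" "F \<noteq> {}"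
  defines "h \<equiv> \<lambda>n x. max 0 (1 - real n * infdist x F) * max 0 (min 1 (real n + 1 - norm x))"
  shows "(\<lambda>n. \<integral>x. h n x \<partial>\<rho>) \<longlonglongrightarrow> measure \<rho> F"
proof -
  note R = finite_borel_measuresD[OF \<rho>]
  interpret finite_measure \<rho> by (rule R)
  have c: "continuous_on UNIV (h n)" for n unfolding h_def by (intro continuous_intros)
  have "(\<lambda>n. \<integral>x. h n x \<partial>\<rho>) \<longlonglongrightarrow> (\<integral>x. indicat_real F x \<partial>\<rho>)"
  proof (rule integral_dominated_convergence[where w = "\<lambda>_. 1"])
    show "h n \<in> borel_measurable \<rho>" for n
      using borel_measurable_continuous_onI[OF c[of n]] R by (simp cong: measurable_cong_sets)
    show "indicat_real F \<in> borel_measurable \<rho>"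
      using F by (intro borel_measurable_indicator) (simp add: R borel_closed)
    show "AE x in \<rho>. (\<lambda>n. h n x) \<longlonglongrightarrow> indicat_real F x"
    proof (rule AE_I2)
      fix x :: 'a
      obtain N1 :: nat where N1: "norm x \<le> real N1" using real_arch_simple by blast
      have cut: "max 0 (min 1 (real n + 1 - norm x)) = 1" if "n \<ge> N1" for n
      proof -
        have "real N1 \<le> real n" using that by simp
        then show ?thesis using N1 by (simp add: min_def)
      qed
      obtain N2 :: nat where N2: "x \<notin> F \<longrightarrow> 1 < real N2 * infdist x F"
      proof (cases "x \<in> F")
        case False
        then have "infdist x F > 0" using F by (meson infdist_pos_not_in_closed)
        from reals_Archimedean3[OF this] that show ?thesis by blast
      qed (use that in blast)
      have "h n x = indicat_real F x" if "n \<ge> max N1 N2" for n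
      proof (cases "x \<in> F")
        case True
        then show ?thesis using cut[of n] that by (simp add: h_def)
      next
        case False
        have "real N2 * infdist x F \<le> real n * infdist x F"
          using that infdist_nonneg[of x F] by (intro mult_right_mono) auto
        then have "max 0 (1 - real n * infdist x F) = 0" using N2 False by simp
        then show ?thesis using False by (simp add: h_def)
      qed
      then show "(\<lambda>n. h n x) \<longlonglongrightarrow> indicat_real F x"
        by (intro tendsto_eventually) (auto simp: eventually_sequentially intro!: exI[of _ "max N1 N2"])
    qed
    have "\<bar>h n x\<bar> \<le> 1 * 1" for n x
      unfolding h_def abs_mult using infdist_nonneg[of x F] by (intro mult_mono) auto
    then show "AE x in \<rho>. norm (h n x) \<le> 1" for n by simp
  qed simp
  also have "(\<integral>x. indicat_real F x \<partial>\<rho>) = measure \<rho> F" using F R by simp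
  finally show ?thesis .
qed

lemma abs_product_diff_le:
  fixes p c p' c' :: real
  shows "\<bar>p * c - p' * c'\<bar> \<le> \<bar>p - p'\<bar> * \<bar>c\<bar> + \<bar>p'\<bar> * \<bar>c - c'\<bar>"
proof -
  have "p * c - p' * c' = (p - p') * c + p' * (c - c')" by (simp add: algebra_simps)
  then have "\<bar>p * c - p' * c'\<bar> \<le> \<bar>(p - p') * c\<bar> + \<bar>p' * (c - c')\<bar>" by (simp only: abs_triangle_ineq)
  then show ?thesis by (simp only: abs_mult)
qed

lemma finite_borel_measure_eqI_lipschitz:
  fixes \<mu> \<nu> :: "'a::euclidean_space measure"
  assumes \<mu>: "\<mu> \<in> finite_borel_measures" and \<nu>: "\<nu> \<in> finite_borel_measures"
    and eq: "\<And>(\<psi> :: 'a \<Rightarrow> real) \<Lambda> \<rho>. \<lbrakk>\<And>x. \<bar>\<psi> x\<bar> \<le> 1; \<And>x y. \<bar>\<psi> x - \<psi> y\<bar> \<le> \<Lambda> * norm (x - y); 0 \<le> \<Lambda>; \<And>x. \<rho> \<le> norm x \<Longrightarrow> \<psi> x = 0\<rbrakk>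
      \<Longrightarrow> (\<integral>x. \<psi> x \<partial>\<mu>) = (\<integral>x. \<psi> x \<partial>\<nu>)"
  shows "\<mu> = \<nu>"
proof -
  interpret m: finite_measure \<mu> using finite_borel_measuresD[OF \<mu>] by simp
  interpret n: finite_measure \<nu> using finite_borel_measuresD[OF \<nu>] by simp
  have closed_eq: "emeasure \<mu> F = emeasure \<nu> F" if "closed F" for F
  proof (cases "F = {}")
    case False
    let ?p = "\<lambda>n x. max 0 (1 - real n * infdist x F)" and ?c = "\<lambda>n x. max 0 (min 1 (real n + 1 - norm (x::'a)))"
    have "(\<integral>x. ?p n x * ?c n x \<partial>\<mu>) = (\<integral>x. ?p n x * ?c n x \<partial>\<nu>)" for n
    proof (rule eq[where \<Lambda> = "real n + 1" and \<rho> = "real n + 1"])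
      have p01: "0 \<le> ?p n x" "?p n x \<le> 1" and c01: "0 \<le> ?c n x" "?c n x \<le> 1" for x
        using infdist_nonneg[of x F] by auto
      show "\<bar>?p n x * ?c n x\<bar> \<le> 1" for x
        using mult_mono[OF p01(2)[of x] c01(2)[of x]] p01(1)[of x] c01(1)[of x] by (simp add: abs_mult)
      show "\<bar>?p n x * ?c n x - ?p n y * ?c n y\<bar> \<le> (real n + 1) * norm (x - y)" for x y
      proof -
        have "real n * \<bar>infdist x F - infdist y F\<bar> \<le> real n * norm (x - y)"
          using infdist_triangle_abs[of x F y] by (intro mult_left_mono) (auto simp: dist_norm)
        then have "\<bar>real n * infdist x F - real n * infdist y F\<bar> \<le> real n * norm (x - y)"
          by (simp add: right_diff_distrib[symmetric] abs_mult)
        then have lp: "\<bar>?p n x - ?p n y\<bar> \<le> real n * norm (x - y)" by linarith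
        have lc: "\<bar>?c n x - ?c n y\<bar> \<le> norm (x - y)"
          using norm_triangle_ineq3[of x y] by linarith
        have ac: "\<bar>?c n x\<bar> \<le> 1" unfolding abs_of_nonneg[OF c01(1)] by (rule c01(2))
        have ap: "\<bar>?p n y\<bar> \<le> 1" unfolding abs_of_nonneg[OF p01(1)] by (rule p01(2))
        have 1: "\<bar>?p n x - ?p n y\<bar> * \<bar>?c n x\<bar> \<le> (real n * norm (x - y)) * 1"
          by (rule mult_mono[OF lp ac]) simp_all
        have 2: "\<bar>?p n y\<bar> * \<bar>?c n x - ?c n y\<bar> \<le> 1 * norm (x - y)"
          by (rule mult_mono[OF ap lc]) simp_all
        have "(real n * norm (x - y)) * 1 + 1 * norm (x - y) = (real n + 1) * norm (x - y)" by (simp only: distrib_right mult_1_right)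
        then show ?thesis
          using order_trans[OF abs_product_diff_le add_mono[OF 1 2]] by (simp only:)
      qed
      show "?p n x * ?c n x = 0" if "real n + 1 \<le> norm x" for x using that by simp
    qed simp
    then have "measure \<mu> F = measure \<nu> F"
      using cutoff_indicator_limit[OF \<mu> that False] cutoff_indicator_limit[OF \<nu> that False] by (simp add: LIMSEQ_unique)
    then show ?thesis by (simp add: m.emeasure_eq_measure n.emeasure_eq_measure)
  qed simp
  show ?thesis
  proof (rule measure_eqI_generator_eq[where E = "{F. closed F}" and \<Omega> = UNIV and A = "\<lambda>_. UNIV"])
    show "Int_stable {F :: 'a set. closed F}" by (auto simp: Int_stable_def)
    show "sets \<mu> = sigma_sets UNIV {F. closed F}" "sets \<nu> = sigma_sets UNIV {F. closed F}"
      unfolding finite_borel_measuresD(1)[OF \<mu>] finite_borel_measuresD(1)[OF \<nu>] by (simp_all add: borel_eq_closed)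
  qed (auto simp: closed_eq)
qed

text \<open>The total mass is continuous along the curve, being the integral of a bounded Lipschitz function.\<close>

lemma mass_bounded:
  fixes m :: "real \<Rightarrow> 'a::euclidean_space measure"
  assumes b: "b > 0" and T: "T > 0" and m: "\<And>t. t \<in> {0..T} \<Longrightarrow> m t \<in> finite_borel_measures"
    and lim: "\<And>t. t \<in> {0..T} \<Longrightarrow> ((\<lambda>s. prw_dist b (m s) (m t)) \<longlongrightarrow> 0) (at t within {0..T})"
  shows "\<exists>M\<ge>0. \<forall>t\<in>{0..T}. total_mass (m t) \<le> M"
proof -
  have "((\<lambda>s. total_mass (m s)) \<longlongrightarrow> total_mass (m t)) (at t within {0..T})" if t: "t \<in> {0..T}" for t
  proof (rule LIM_zero_cancel, rule Lim_null_comparison)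
    show "((\<lambda>s. 1 / b * prw_dist b (m s) (m t)) \<longlongrightarrow> 0) (at t within {0..T})"
      using tendsto_mult_left[OF lim[OF t], of "1 / b"] by simp
    have "\<bar>total_mass (m s) - total_mass (m t)\<bar> \<le> 1 / b * prw_dist b (m s) (m t)" if s: "s \<in> {0..T}" for s
      using prw_dist_test_function[OF b m[OF s] m[OF t], of "\<lambda>_. 1" 1 0]
      by (simp add: total_mass_def)
    then show "\<forall>\<^sub>F s in at t within {0..T}. norm (total_mass (m s) - total_mass (m t)) \<le> 1 / b * prw_dist b (m s) (m t)"
      unfolding real_norm_def by (simp only: eventually_at_filter) simp
  qed
  then have "continuous_on {0..T} (\<lambda>t. total_mass (m t))" by (simp add: continuous_on_def)
  then obtain t0 where "\<forall>t\<in>{0..T}. total_mass (m t) \<le> total_mass (m t0)"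
    using continuous_attains_sup[of "{0..T}" "\<lambda>t. total_mass (m t)"] T by auto
  then show ?thesis by (intro exI[of _ "total_mass (m t0)"]) (simp add: total_mass_def)
qed

lemma linear_field_along:
  assumes mf: "mean_field T b K L H m0"
    and m: "\<And>t. t \<in> {0..T} \<Longrightarrow> m t \<in> finite_borel_measures"
    and lim: "\<And>t. t \<in> {0..T} \<Longrightarrow> ((\<lambda>s. prw_dist b (m s) (m t)) \<longlongrightarrow> 0) (at t within {0..T})"
  shows "linear_field T K L (\<lambda>t x. H t x (m t))"
proof -
  interpret mean_field T b K L H m0 by fact
  show ?thesis
  proof
    show "continuous_on ({0..T} \<times> UNIV) (\<lambda>(t, x). H t x (m t))" by (rule continuous_coeff_along[OF continuous m lim b])
    fix t x y assume t: "t \<in> {0..T}"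
    show "norm (H t x (m t) - H t y (m t)) \<le> L * norm (x - y)"
      using lipschitz t m[OF t] prw_dist_self[OF b m[OF t]] unfolding lipschitz_coeff_def by fastforce
    show "norm (H t x (m t)) \<le> K" by (rule coeff_bound[OF bounded t m[OF t]])
  qed (fact T K L)+
qed

locale balance_equation =
  fixes T b C CLf CLg Cf Cg :: real
    and f :: "real \<Rightarrow> 'a::euclidean_space \<Rightarrow> 'a measure \<Rightarrow> 'a"
    and g :: "real \<Rightarrow> 'a \<Rightarrow> 'a measure \<Rightarrow> real"
    and m0 :: "'a measure"
  assumes T: "T > 0" and b: "b > 0" and initial: "m0 \<in> finite_borel_measures1"
    and cf: "continuous_coeff T b f" and cg: "continuous_coeff T b g"
    and lf: "lipschitz_coeff T b CLf f" and lg: "lipschitz_coeff T b CLg g"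
    and bf: "bounded_coeff T Cf f" and bg: "bounded_coeff T Cg g"
    and C: "C > total_mass m0 * exp (T * Cg)"
begin

definition field :: "real \<Rightarrow> 'a \<Rightarrow> 'a measure \<Rightarrow> 'a \<times> real" where
  "field t x m = (f t x m, g t x m)"

lemma m0_in: "m0 \<in> finite_borel_measures"
  using initial by (simp add: finite_borel_measures1_def)

sublocale mean_field T b "Cf + Cg" "\<bar>CLf\<bar> + \<bar>CLg\<bar>" field m0
proof
  show "0 \<le> Cf + Cg"
    using order_trans[OF norm_ge_zero coeff_bound[OF bf _ m0_in, of 0 0]] order_trans[OF norm_ge_zero coeff_bound[OF bg _ m0_in, of 0 0]] T by simp
  show "bounded_coeff T (Cf + Cg) field"
    unfolding bounded_coeff_def field_def
  proof (intro ballI allI)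
    fix t and x :: 'a and m :: "'a measure" assume t: "t \<in> {0..T}" and m: "m \<in> finite_borel_measures"
    show "norm (f t x m, g t x m) \<le> Cf + Cg"
      using norm_Pair_le[of "f t x m" "g t x m"] coeff_bound[OF bf t m, of x] coeff_bound[OF bg t m, of x] by linarith
  qed
  show "lipschitz_coeff T b (\<bar>CLf\<bar> + \<bar>CLg\<bar>) field"
    unfolding lipschitz_coeff_def field_def
  proof (intro ballI allI)
    fix t and x1 x2 :: 'a and m1 m2 :: "'a measure"
    assume t: "t \<in> {0..T}" and m: "m1 \<in> finite_borel_measures" "m2 \<in> finite_borel_measures"
    let ?d = "norm (x1 - x2) + prw_dist b m1 m2"
    have d: "0 \<le> ?d" by simp
    have "norm (f t x1 m1 - f t x2 m2) \<le> CLf * ?d" "norm (g t x1 m1 - g t x2 m2) \<le> CLg * ?d"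
      using lf lg t m unfolding lipschitz_coeff_def by blast+
    then have "norm (f t x1 m1 - f t x2 m2) \<le> \<bar>CLf\<bar> * ?d" "norm (g t x1 m1 - g t x2 m2) \<le> \<bar>CLg\<bar> * ?d"
      using mult_right_mono[OF abs_ge_self d] by (meson order_trans)+
    then show "norm ((f t x1 m1, g t x1 m1) - (f t x2 m2, g t x2 m2)) \<le> (\<bar>CLf\<bar> + \<bar>CLg\<bar>) * ?d"
      using norm_Pair_le[of "f t x1 m1 - f t x2 m2" "g t x1 m1 - g t x2 m2"] by (simp add: distrib_right)
  qed
  show "continuous_coeff T b field"
    unfolding continuous_coeff_def field_def
  proof (intro ballI allI impI)
    fix t and x :: 'a and m :: "'a measure" and e :: real
    assume t: "t \<in> {0..T}" and m: "m \<in> finite_borel_measures" and e: "e > 0"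
    obtain d1 where d1: "d1 > 0" "\<forall>t'\<in>{0..T}. \<forall>x'. \<forall>m'\<in>finite_borel_measures.
       \<bar>t' - t\<bar> < d1 \<and> norm (x' - x) < d1 \<and> prw_dist b m' m < d1 \<longrightarrow> norm (f t' x' m' - f t x m) < e / 2"
      using cf[unfolded continuous_coeff_def, rule_format, OF t m, of "e / 2" x] e by auto
    obtain d2 where d2: "d2 > 0" "\<forall>t'\<in>{0..T}. \<forall>x'. \<forall>m'\<in>finite_borel_measures.
       \<bar>t' - t\<bar> < d2 \<and> norm (x' - x) < d2 \<and> prw_dist b m' m < d2 \<longrightarrow> norm (g t' x' m' - g t x m) < e / 2"
      using cg[unfolded continuous_coeff_def, rule_format, OF t m, of "e / 2" x] e by auto
    have "norm ((f t' x' m', g t' x' m') - (f t x m, g t x m)) < e"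
      if "t' \<in> {0..T}" "m' \<in> finite_borel_measures" "\<bar>t' - t\<bar> < min d1 d2" "norm (x' - x) < min d1 d2" "prw_dist b m' m < min d1 d2" for t' x' m'
    proof -
      have "norm (f t' x' m' - f t x m) < e / 2" "norm (g t' x' m' - g t x m) < e / 2"
        using d1(2) d2(2) that by auto
      then show ?thesis using norm_Pair_le[of "f t' x' m' - f t x m" "g t' x' m' - g t x m"] by simp
    qed
    then show "\<exists>d>0. \<forall>t'\<in>{0..T}. \<forall>x'. \<forall>m'\<in>finite_borel_measures.
         \<bar>t' - t\<bar> < d \<and> norm (x' - x) < d \<and> prw_dist b m' m < d \<longrightarrow>
         norm ((f t' x' m', g t' x' m') - (f t x m, g t x m)) < e"
      using d1(1) d2(1) by (intro exI[of _ "min d1 d2"]) auto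
  qed
qed (use T b m0_in in auto)

lemma transport_start:
  assumes "\<And>x. z x = (x, 0)"
  shows "transport m0 z = m0"
  unfolding transport_def weighted_push_def using finite_borel_measuresD[OF m0_in]
  by (simp add: assms density_1 distr_id2)

text \<open>The flow solves the linear equation for its own curve of measures; this provides the Lipschitz
  dependence on the initial position that makes the lifting to curves measurable. The weights stay below \<open>C\<close>
  because the growth rate is bounded by \<open>Cg\<close>.\<close>

theorem flow_equilibrium:
  assumes Z: "characteristic_flow T field m0 Z"
  shows "\<exists>\<eta>. equilibrium_distribution T C f g m0 \<eta> \<and> (\<forall>t\<in>{0..T}. weighted_marginal \<eta> t = transport m0 (Z t))"
proof -
  let ?\<mu> = "\<lambda>t. transport m0 (Z t)"
  note \<mu> = characteristic_flow_bounds(1)[OF Z] and lim = characteristic_flow_bounds(2)[OF Z]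
  have start: "Z 0 x = (x, 0)" for x using Z by (simp add: characteristic_flow_def)
  have der: "((\<lambda>s. Z s x) has_vector_derivative field t (fst (Z t x)) (?\<mu> t)) (at t within {0..T})" if "t \<in> {0..T}" for t x
    using Z that by (auto simp: characteristic_flow_def)
  interpret lin: linear_field T "Cf + Cg" "\<bar>CLf\<bar> + \<bar>CLg\<bar>" "\<lambda>t x. field t x (?\<mu> t)"
    by (rule linear_field_along[OF mean_field_axioms \<mu> lim])
  have sol: "lin.solves 0 T (\<lambda>s. Z s x)" for x unfolding lin.solves_def using der by blast
  let ?L = "\<bar>CLf\<bar> + \<bar>CLg\<bar>"
  have dx: "((\<lambda>s. fst (Z s x)) has_vector_derivative f t (fst (Z t x)) (?\<mu> t)) (at t within {0..T})"
    and da: "((\<lambda>s. snd (Z s x)) has_vector_derivative g t (fst (Z t x)) (?\<mu> t)) (at t within {0..T})" if "t \<in> {0..T}" for t x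
    using bounded_linear.has_vector_derivative[OF bounded_linear_fst der[OF that, of x]]
      bounded_linear.has_vector_derivative[OF bounded_linear_snd der[OF that, of x]] by (simp_all add: field_def)
  interpret cf: curve_family T C "total_mass m0" "T * Cg" "exp (?L * T)" Z
  proof
    show "continuous_on {0..T} (\<lambda>t. Z t x)" for x
      unfolding continuous_on_eq_continuous_within using has_vector_derivative_continuous[OF der] by blast
    fix t x y assume t: "t \<in> {0..T}"
    have "norm (Z t x - Z t y) \<le> exp (?L * (t - 0)) * norm (Z 0 x - Z 0 y)"
      by (rule lin.gronwall[OF sol sol]) (use t in auto)
    also have "\<dots> \<le> exp (?L * T) * norm (x - y)"
      using t by (intro mult_mono) (auto simp: start norm_Pair intro: mult_left_mono)
    finally show "norm (Z t x - Z t y) \<le> exp (?L * T) * norm (x - y)" .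
    have "norm (snd (Z t x) - snd (Z 0 x)) \<le> Cg * \<bar>t - 0\<bar>"
      by (rule vector_derivative_increment[OF da coeff_bound[OF bg _ \<mu>]]) (use t T in auto)
    also have "\<dots> \<le> Cg * T"
      using t order_trans[OF norm_ge_zero coeff_bound[OF bg t m0_in]] by (intro mult_left_mono) auto
    finally show "snd (Z t x) \<le> T * Cg" by (simp add: start mult.commute)
  qed (use T C start in \<open>auto simp: total_mass_def\<close>)
  obtain \<eta> where \<eta>: "\<eta> \<in> prob_measures1 (weighted_curves T C)" "AE \<gamma> in \<eta>. \<exists>x. \<gamma> = cf.curve x"
    and marg: "\<And>t. t \<in> {0..T} \<Longrightarrow> weighted_marginal \<eta> t = ?\<mu> t"
    using cf.lifting_exists[OF initial refl] by blast
  have "equilibrium_distribution T C f g m0 \<eta>"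
    unfolding equilibrium_distribution_def
  proof (intro conjI \<eta>(1))
    show "weighted_marginal \<eta> 0 = m0" using marg[of 0] T transport_start[of "Z 0"] start by simp
    show "AE \<gamma> in \<eta>. (\<forall>t\<in>{0..T}.
          ((\<lambda>s. fst (\<gamma> s)) has_vector_derivative f t (fst (\<gamma> t)) (weighted_marginal \<eta> t)) (at t within {0..T}) \<and>
          ((\<lambda>s. snd (\<gamma> s)) has_real_derivative g t (fst (\<gamma> t)) (weighted_marginal \<eta> t) * snd (\<gamma> t)) (at t within {0..T})) \<and>
       snd (\<gamma> 0) = total_mass m0"
      using \<eta>(2)
    proof eventually_elim
      case (elim \<gamma>)
      then obtain x where \<gamma>: "\<gamma> = cf.curve x" by blast
      have "((\<lambda>s. fst (\<gamma> s)) has_vector_derivative f t (fst (\<gamma> t)) (weighted_marginal \<eta> t)) (at t within {0..T})"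
        and "((\<lambda>s. snd (\<gamma> s)) has_real_derivative g t (fst (\<gamma> t)) (weighted_marginal \<eta> t) * snd (\<gamma> t)) (at t within {0..T})"
        if t: "t \<in> {0..T}" for t
      proof -
        have "((\<lambda>s. fst (\<gamma> s)) has_vector_derivative f t (fst (Z t x)) (?\<mu> t)) (at t within {0..T})"
          by (rule has_vector_derivative_transform[OF t _ dx[OF t, of x]]) (simp add: \<gamma> cf.curve_eq)
        then show "((\<lambda>s. fst (\<gamma> s)) has_vector_derivative f t (fst (\<gamma> t)) (weighted_marginal \<eta> t)) (at t within {0..T})"
          using t by (simp add: marg \<gamma> cf.curve_eq)
        have "((\<lambda>s. total_mass m0 * exp (snd (Z s x))) has_real_derivative total_mass m0 * (exp (snd (Z t x)) * g t (fst (Z t x)) (?\<mu> t))) (at t within {0..T})"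
          using da[OF t, of x] unfolding has_real_derivative_iff_has_vector_derivative[symmetric]
          by (auto intro!: derivative_eq_intros)
        then have "((\<lambda>s. snd (\<gamma> s)) has_vector_derivative total_mass m0 * (exp (snd (Z t x)) * g t (fst (Z t x)) (?\<mu> t))) (at t within {0..T})"
          unfolding has_real_derivative_iff_has_vector_derivative
          by (rule has_vector_derivative_transform[OF t, rotated]) (simp add: \<gamma> cf.curve_eq)
        then show "((\<lambda>s. snd (\<gamma> s)) has_real_derivative g t (fst (\<gamma> t)) (weighted_marginal \<eta> t) * snd (\<gamma> t)) (at t within {0..T})"
          using t by (simp add: has_real_derivative_iff_has_vector_derivative marg \<gamma> cf.curve_eq mult_ac)
      qed
      moreover have "snd (\<gamma> 0) = total_mass m0" using T by (simp add: \<gamma> cf.curve_eq start)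
      ultimately show ?case by blast
    qed
  qed
  then show ?thesis using marg by blast
qed

text \<open>Insert the weak solution into the coefficients. By uniqueness for the resulting linear equation it is
  transported by the flow of that equation, which therefore solves the closed system.\<close>

theorem weak_solution_flow:
  assumes w: "weak_solution T b f g m0 m" and start: "m 0 = m0"
  shows "\<exists>Z. characteristic_flow T field m0 Z \<and> (\<forall>t\<in>{0..T}. m t = transport m0 (Z t))"
proof -
  have m: "\<And>t. t \<in> {0..T} \<Longrightarrow> m t \<in> finite_borel_measures"
    and lim: "\<And>t. t \<in> {0..T} \<Longrightarrow> ((\<lambda>s. prw_dist b (m s) (m t)) \<longlongrightarrow> 0) (at t within {0..T})"
    and eq: "\<And>\<phi> \<phi>t \<phi>x s. C1c_test_function T \<phi> \<phi>t \<phi>x \<Longrightarrow> s \<in> {0..T} \<Longrightarrow>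
          (\<integral>x. \<phi> s x \<partial>m s) - (\<integral>x. \<phi> 0 x \<partial>m0) =
          (LINT t:{0..s}|lborel. (\<integral>x. \<phi>t t x + \<phi>x t x \<bullet> f t x (m t) + \<phi> t x * g t x (m t) \<partial>m t))"
    using w by (auto simp: weak_solution_def)
  let ?K = "Cf + Cg" and ?L = "\<bar>CLf\<bar> + \<bar>CLg\<bar>" and ?V = "\<lambda>t x. field t x (m t)"
  obtain M where M: "0 \<le> M" "\<And>t. t \<in> {0..T} \<Longrightarrow> total_mass (m t) \<le> M"
    using mass_bounded[OF b T m lim] by blast
  interpret lin: linear_field T ?K ?L ?V by (rule linear_field_along[OF mean_field_axioms m lim])
  have wc: "weak_curve T ?K ?L ?V b M m"
  proof
    fix u :: "'a \<Rightarrow> real" and du \<rho> r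
    assume du: "\<And>x. (u has_derivative (\<lambda>v. du x \<bullet> v)) (at x)" and c: "continuous_on UNIV du"
      and supp: "\<And>x. \<rho> \<le> norm x \<Longrightarrow> u x = 0" and r: "r \<in> {0..T}"
    have "C1c_test_function T (\<lambda>t x. u x) (\<lambda>t x. 0) (\<lambda>t x. du x)"
      unfolding C1c_test_function_def
    proof (intro conjI ballI allI)
      fix t x
      have "((\<lambda>p. u (snd p)) has_derivative (\<lambda>p. du x \<bullet> snd p)) (at (t, x) within {0..T} \<times> UNIV)"
      proof -
        have "((\<lambda>p. snd p) has_derivative (\<lambda>p. snd p)) (at (t, x) within {0..T} \<times> UNIV)"
          by (intro derivative_intros)
        from has_derivative_compose[OF this, of u "\<lambda>v. du x \<bullet> v"] du[of x] show ?thesis by simp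
      qed
      then show "((\<lambda>(s, y). u y) has_derivative (\<lambda>(h, v). 0 * h + du x \<bullet> v)) (at (t, x) within {0..T} \<times> UNIV)"
        by (simp add: case_prod_unfold)
      show "continuous_on ({0..T} \<times> UNIV) (\<lambda>(t, x). du x)"
        unfolding case_prod_beta by (rule continuous_on_compose2[OF c]) (auto intro!: continuous_intros)
      have "{(t, x). t \<in> {0..T} \<and> u x \<noteq> 0} \<subseteq> {0..T} \<times> cball 0 \<rho>"
        using supp by (auto simp: not_le intro: less_imp_le) (meson linear)
      then have "bounded {(t, x). t \<in> {0..T} \<and> u x \<noteq> 0}"
        by (rule bounded_subset[rotated]) (intro bounded_Times, auto)
      then show "compact (closure {(t, x). t \<in> {0..T} \<and> u x \<noteq> 0})" by (simp add: compact_closure)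
    qed simp
    from eq[OF this r]
    show "(\<integral>x. u x \<partial>m r) - (\<integral>x. u x \<partial>m 0) = (LINT \<tau>:{0..r}|lborel. (\<integral>x. du x \<bullet> fst (?V \<tau> x) + u x * snd (?V \<tau> x) \<partial>m \<tau>))"
      by (simp add: field_def start)
  qed (use b M m lim in auto)
  define Z where "Z t x = lin.flow 0 t x" for t x
  have T0: "0 \<in> {0..T}" using T by simp
  have rep: "m t = transport m0 (Z t)" if t: "t \<in> {0..T}" for t
  proof (rule finite_borel_measure_eqI_lipschitz[OF m[OF t]])
    have cZ: "continuous_on UNIV (Z t)" unfolding Z_def using lin.continuous_flow[OF T0 t] by (simp add: eta_contract_eq)
    have Zm: "(\<lambda>x. fst (Z t x)) \<in> borel_measurable m0" "(\<lambda>x. exp (snd (Z t x))) \<in> borel_measurable m0"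
      using borel_measurable_continuous_onI[OF continuous_on_fst[OF cZ]]
        borel_measurable_continuous_onI[OF continuous_on_exp[OF continuous_on_snd[OF cZ]]]
      by (simp_all cong: measurable_cong_sets add: sets_m0)
    have bd: "snd (Z t x) \<le> ?K * t" for x
      using order_trans[OF norm_snd_le_norm lin.flow_displacement[OF T0 t, of x]] by (simp add: Z_def abs_le_iff)
    show "transport m0 (Z t) \<in> finite_borel_measures"
      unfolding transport_def using bd Zm
      by (intro weighted_push_in m0.integrable_const_bound[where B = "exp (?K * t)"]) auto
    fix \<psi> :: "'a \<Rightarrow> real" and \<Lambda> \<rho>
    assume \<psi>: "\<And>x. \<bar>\<psi> x\<bar> \<le> 1" "\<And>x y. \<bar>\<psi> x - \<psi> y\<bar> \<le> \<Lambda> * norm (x - y)" "0 \<le> \<Lambda>" "\<And>x. \<rho> \<le> norm x \<Longrightarrow> \<psi> x = 0"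
    have tv: "terminal_value T ?K ?L ?V t 1 \<Lambda> \<rho> \<psi>"
      by unfold_locales (use \<psi> t in auto)
    have "continuous_on UNIV \<psi>"
      using \<psi>(2) by (intro continuous_on_norm_lipschitz[where c = \<Lambda>]) simp
    then have \<psi>m: "\<psi> \<in> borel_measurable borel" by (rule borel_measurable_continuous_onI)
    have "(\<integral>x. \<psi> x \<partial>m t) = (\<integral>x. exp (snd (Z t x)) * \<psi> (fst (Z t x)) \<partial>m0)"
      using weak_curve_representation[OF wc tv] by (simp add: Z_def start)
    also have "\<dots> = (\<integral>x. \<psi> x \<partial>transport m0 (Z t))"
      unfolding transport_def using Zm \<psi>m by (subst integral_weighted_push) (auto simp: mult.commute)
    finally show "(\<integral>x. \<psi> x \<partial>m t) = (\<integral>x. \<psi> x \<partial>transport m0 (Z t))" .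
  qed
  have "characteristic_flow T field m0 Z"
    unfolding characteristic_flow_def
  proof (intro conjI ballI allI)
    fix x
    show "Z 0 x = (x, 0)" using T0 by (simp add: Z_def)
    fix t assume t: "t \<in> {0..T}"
    show "((\<lambda>s. Z s x) has_vector_derivative field t (fst (Z t x)) (transport m0 (Z t))) (at t within {0..T})"
      using lin.flow_solves[OF T0, of x] t by (simp add: lin.solves_def Z_def[symmetric] rep[OF t, symmetric])
  next
    have "norm (Z t x - (x, 0)) \<le> ?K * T" if "t \<in> {0..T}" for t x
      using order_trans[OF lin.flow_displacement[OF T0 that, of x] mult_left_mono[of "t - 0" T ?K]] that K by (simp add: Z_def)
    then show "\<exists>R. \<forall>t\<in>{0..T}. \<forall>x. norm (Z t x - (x, 0)) \<le> R" by blast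
    show "continuous_on ({0..T} \<times> UNIV) (\<lambda>(t, x). Z t x)"
      unfolding Z_def by (rule lin.continuous_flow_joint)
  qed
  then show ?thesis using rep by blast
qed

end

lemma weak_solution_cong:
  assumes "\<And>t. t \<in> {0..T} \<Longrightarrow> m t = m' t" and w: "weak_solution T b f g m0 m"
  shows "weak_solution T b f g m0 m'"
proof -
  have "((\<lambda>s. prw_dist b (m' s) (m' t)) \<longlongrightarrow> 0) (at t within {0..T})" if t: "t \<in> {0..T}" for t
  proof -
    have "((\<lambda>s. prw_dist b (m s) (m t)) \<longlongrightarrow> 0) (at t within {0..T})" using w t by (auto simp: weak_solution_def)
    then show ?thesis by (rule Lim_transform_eventually) (use assms(1) t in \<open>simp add: eventually_at_filter\<close>)
  qed
  moreover have "(LINT t:{0..s}|lborel. (\<integral>x. \<phi>t t x + \<phi>x t x \<bullet> f t x (m t) + \<phi> t x * g t x (m t) \<partial>m t)) =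
      (LINT t:{0..s}|lborel. (\<integral>x. \<phi>t t x + \<phi>x t x \<bullet> f t x (m' t) + \<phi> t x * g t x (m' t) \<partial>m' t))"
    if "s \<in> {0..T}" for s \<phi> \<phi>t \<phi>x
    using that assms(1) by (intro set_lebesgue_integral_cong) auto
  ultimately show ?thesis using w assms(1) unfolding weak_solution_def by simp
qed

theorem theorem4p3:
  fixes T b C CLf CLg Cf Cg :: real
    and f :: "real \<Rightarrow> 'a::euclidean_space \<Rightarrow> 'a measure \<Rightarrow> 'a"
    and g :: "real \<Rightarrow> 'a \<Rightarrow> 'a measure \<Rightarrow> real"
    and m0 :: "'a measure"
  assumes "T > 0" and "b > 0"
    and "m0 \<in> finite_borel_measures1"
    and "continuous_coeff T b f" and "continuous_coeff T b g"
    and "lipschitz_coeff T b CLf f" and "lipschitz_coeff T b CLg g"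
    and "bounded_coeff T Cf f" and "bounded_coeff T Cg g"
    and "C > total_mass m0 * exp (T * Cg)"
  shows "(\<forall>\<eta>. equilibrium_distribution T C f g m0 \<eta> \<longrightarrow>
            weak_solution T b f g m0 (\<lambda>t. weighted_marginal \<eta> t) \<and> weighted_marginal \<eta> 0 = m0) \<and>
         (\<forall>m. weak_solution T b f g m0 m \<and> m 0 = m0 \<longrightarrow>
            (\<exists>\<eta>. equilibrium_distribution T C f g m0 \<eta> \<and>
                 (\<forall>t\<in>{0..T}. weighted_marginal \<eta> t = m t))) \<and>
         (\<exists>!m. m \<in> extensional {0..T} \<and> weak_solution T b f g m0 m \<and> m 0 = m0)"
proof -
  interpret balance_equation T b C CLf CLg Cf Cg f g m0 by unfold_locales fact+
  have part1: "weak_solution T b f g m0 (weighted_marginal \<eta>) \<and> weighted_marginal \<eta> 0 = m0"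
    if "equilibrium_distribution T C f g m0 \<eta>" for \<eta>
    using equilibrium_is_weak_solution[OF T b cf cg bf bg that] that by (simp add: equilibrium_distribution_def)
  have part2: "\<exists>\<eta>. equilibrium_distribution T C f g m0 \<eta> \<and> (\<forall>t\<in>{0..T}. weighted_marginal \<eta> t = m t)"
    if "weak_solution T b f g m0 m" "m 0 = m0" for m
    using weak_solution_flow[OF that] flow_equilibrium by metis
  have ex: "\<exists>m. m \<in> extensional {0..T} \<and> weak_solution T b f g m0 m \<and> m 0 = m0"
  proof -
    obtain \<eta> where \<eta>: "equilibrium_distribution T C f g m0 \<eta>"
      using characteristic_flow_exists flow_equilibrium by blast
    let ?m = "restrict (weighted_marginal \<eta>) {0..T}"
    have "weak_solution T b f g m0 ?m"
      by (rule weak_solution_cong[OF _ conjunct1[OF part1[OF \<eta>]]]) simp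
    moreover have "?m 0 = m0" using part1[OF \<eta>] T by simp
    ultimately show ?thesis by blast
  qed
  have uniq: "m = m'"
    if m: "m \<in> extensional {0..T}" "weak_solution T b f g m0 m" "m 0 = m0"
      and m': "m' \<in> extensional {0..T}" "weak_solution T b f g m0 m'" "m' 0 = m0" for m m'
  proof (rule extensionalityI[OF m(1) m'(1)])
    fix t assume t: "t \<in> {0..T}"
    obtain Z where Z: "characteristic_flow T field m0 Z" "\<forall>t\<in>{0..T}. m t = transport m0 (Z t)"
      using weak_solution_flow[OF m(2,3)] by blast
    obtain Z' where Z': "characteristic_flow T field m0 Z'" "\<forall>t\<in>{0..T}. m' t = transport m0 (Z' t)"
      using weak_solution_flow[OF m'(2,3)] by blast
    have "Z t = Z' t" using characteristic_flow_unique[OF Z(1) Z'(1) t] by blast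
    then show "m t = m' t" using Z(2) Z'(2) t by simp
  qed
  show ?thesis using part1 part2 ex uniq by blast
qed

end
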